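(* There is an algorithm that, given a positive integer $n$, a set of permutations $\Pi\subseteq \mathcal S_n$ and disjoint sets $I_0,I_1\subseteq[n]$, runs in $O(n|\Pi|)$ time and outputs one of the following: (a) the message Infeasible, in which case $\mathcal X_\Pi\cap F(I_0,I_1)=\emptyset$; or (b) the message Feasible together with disjoint sets $J_0\supseteq I_0$ and $J_1\supseteq I_1$, obtained from $(I_0,I_1)$ by iteratively applying fixings that are valid for individual permutations in $\Pi$, such that $\mathcal X_\gamma\cap F(J_0,J_1)\neq\emptyset$ for every $\gamma\in\Pi$, such that $(J_0,J_1)$ is a complete set of fixings for each permutation $\gamma\in\Pi$, and such that $\mathcal X_\Pi\cap F(J_0,J_1)=\mathcal X_\Pi\cap F(I_0,I_1)$.
   Context: $[n]=\{1,\dots,n\}$ and $\mathcal S_n$ is the symmetric group on $[n]$. A permutation $\gamma\in\mathcal S_n$ acts on $x\in\mathbb R^n$ by $\gamma(x)=(x_{\gamma^{-1}(1)},\dots,x_{\gamma^{-1}(n)})$. $x\succeq y$ means that $x$ is lexicographically not smaller than $y$. $\mathcal X_\gamma=\{x\in\{0,1\}^n : x\succeq\gamma(x)\}$ and $\mathcal X_\Pi=\bigcap_{\gamma\in\Pi}\mathcal X_\gamma$. For disjoint $I_0,I_1\subseteq[n]$, $F(I_0,I_1)=\{x\in\{0,1\}^n : x_i=0 \text{ for } i\in I_0,\ x_i=1\text{ for } i\in I_1\}$. A fixing is a pair $(i,b)\in[n]\times\{0,1\}$. It is valid for $\gamma$ and $(I_0,I_1)$ if all $x\in\mathcal X_\gamma\cap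 F(I_0,I_1)$ satisfy $x_i=b$; applying it means adding $i$ to $I_b$. The pair $(I_0,I_1)$ is a complete set of fixings for $\gamma$ if there is no fixing $(i,b)$ with $i\notin I_0\cup I_1$ that is valid for $\gamma$ and $(I_0,I_1)$. Each permutation is given as an array (with its inverse), and time is counted in elementary operations (random access machine). *)

theory Defs
  imports Complex_Main "HOL-Library.FuncSet" "HOL-Library.Fun_Lexorder"
    "HOL-Combinatorics.Permutations"
begin

section \<open>Permutation symmetries of binary vectors\<close>

text \<open>
  A vector of dimension \<open>n\<close> is a function that is extensional on \<open>{1..n}\<close>, so that equality
  of functions is equality of vectors.
\<close>

type_synonym vec = "nat \<Rightarrow> real"

definition binary_cube :: "nat \<Rightarrow> vec set" where
  "binary_cube n = ({1..n} \<rightarrow>\<^sub>E {0, 1})"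

definition perm_act :: "nat \<Rightarrow> (nat \<Rightarrow> nat) \<Rightarrow> vec \<Rightarrow> vec" where
  "perm_act n \<gamma> x = (\<lambda>i\<in>{1..n}. x (inv \<gamma> i))"

text \<open>
  \<^const>\<open>less_fun\<close> is the strict lexicographic order on functions. Extensional vectors agree
  outside \<open>{1..n}\<close>, hence only the coordinates in \<open>{1..n}\<close> matter.
\<close>

definition lex_ge :: "vec \<Rightarrow> vec \<Rightarrow> bool" (infix "\<succeq>\<^sub>l\<^sub>e\<^sub>x" 50) where
  "x \<succeq>\<^sub>l\<^sub>e\<^sub>x y \<longleftrightarrow> \<not> less_fun x y"

definition X_perm :: "nat \<Rightarrow> (nat \<Rightarrow> nat) \<Rightarrow> vec set" where
  "X_perm n \<gamma> = {x \<in> binary_cube n. x \<succeq>\<^sub>l\<^sub>e\<^sub>x perm_act n \<gamma> x}"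

text \<open>The empty intersection is the whole cube.\<close>

definition X_set :: "nat \<Rightarrow> (nat \<Rightarrow> nat) set \<Rightarrow> vec set" where
  "X_set n \<Gamma> = binary_cube n \<inter> (\<Inter>\<gamma>\<in>\<Gamma>. X_perm n \<gamma>)"

definition face :: "nat \<Rightarrow> nat set \<Rightarrow> nat set \<Rightarrow> vec set" where
  "face n I0 I1 = {x \<in> binary_cube n. (\<forall>i\<in>I0. x i = 0) \<and> (\<forall>i\<in>I1. x i = 1)}"


section \<open>Fixings\<close>

definition fixings :: "nat \<Rightarrow> (nat \<times> real) set" where
  "fixings n = {1..n} \<times> {0, 1}"

definition valid_fixing ::
    "nat \<Rightarrow> (nat \<Rightarrow> nat) \<Rightarrow> nat set \<Rightarrow> nat set \<Rightarrow> nat \<times> real \<Rightarrow> bool" where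
  "valid_fixing n \<gamma> I0 I1 f \<longleftrightarrow>
     f \<in> fixings n \<and> (\<forall>x \<in> X_perm n \<gamma> \<inter> face n I0 I1. x (fst f) = snd f)"

definition apply_fixing :: "nat \<times> real \<Rightarrow> nat set \<times> nat set \<Rightarrow> nat set \<times> nat set" where
  "apply_fixing f I =
     (if snd f = 0 then (insert (fst f) (fst I), snd I) else (fst I, insert (fst f) (snd I)))"

definition complete_fixings :: "nat \<Rightarrow> (nat \<Rightarrow> nat) \<Rightarrow> nat set \<Rightarrow> nat set \<Rightarrow> bool" where
  "complete_fixings n \<gamma> I0 I1 \<longleftrightarrow>
     \<not> (\<exists>i b. (i, b) \<in> fixings n \<and> i \<notin> I0 \<union> I1 \<and> valid_fixing n \<gamma> I0 I1 (i, b))"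

definition fixing_step ::
    "nat \<Rightarrow> (nat \<Rightarrow> nat) set \<Rightarrow> nat set \<times> nat set \<Rightarrow> nat set \<times> nat set \<Rightarrow> bool" where
  "fixing_step n \<Gamma> I J \<longleftrightarrow>
     (\<exists>\<gamma>\<in>\<Gamma>. \<exists>f. valid_fixing n \<gamma> (fst I) (snd I) f \<and> J = apply_fixing f I)"


section \<open>Random access machine with unit costs\<close>

text \<open>
  The machine has registers, named directly in the program text, and a separate memory that is
  addressed through registers; both hold natural numbers. A program is a finite list of
  instructions, so it uses only finitely many registers. Jump targets are absolute, and the
  machine halts when the program counter leaves the program. Subtraction is truncated. There are
  no multiplications, shifts or bitwise operations.
\<close>

datatype instr =
    Const nat nat       \<comment> \<open>\<open>Const r k\<close>: \<open>r := k\<close>\<close>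
  | Add nat nat nat     \<comment> \<open>\<open>Add r a b\<close>: \<open>r := a + b\<close>\<close>
  | Sub nat nat nat     \<comment> \<open>\<open>Sub r a b\<close>: \<open>r := a - b\<close>\<close>
  | Load nat nat        \<comment> \<open>\<open>Load r a\<close>: \<open>r := mem[a]\<close>\<close>
  | Store nat nat       \<comment> \<open>\<open>Store a r\<close>: \<open>mem[a] := r\<close>\<close>
  | Jump nat
  | JumpZero nat nat    \<comment> \<open>\<open>JumpZero r l\<close>: if \<open>r = 0\<close> then go to \<open>l\<close>\<close>

type_synonym ram_program = "instr list"

record ram_config =
  pc :: nat
  regs :: "nat \<Rightarrow> nat"
  mem :: "nat \<Rightarrow> nat"

fun exec_instr :: "instr \<Rightarrow> ram_config \<Rightarrow> ram_config" where
  "exec_instr (Const r k) s = s\<lparr>pc := Suc (pc s), regs := (regs s)(r := k)\<rparr>"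
| "exec_instr (Add r a b) s = s\<lparr>pc := Suc (pc s), regs := (regs s)(r := regs s a + regs s b)\<rparr>"
| "exec_instr (Sub r a b) s = s\<lparr>pc := Suc (pc s), regs := (regs s)(r := regs s a - regs s b)\<rparr>"
| "exec_instr (Load r a) s = s\<lparr>pc := Suc (pc s), regs := (regs s)(r := mem s (regs s a))\<rparr>"
| "exec_instr (Store a r) s = s\<lparr>pc := Suc (pc s), mem := (mem s)(regs s a := regs s r)\<rparr>"
| "exec_instr (Jump l) s = s\<lparr>pc := l\<rparr>"
| "exec_instr (JumpZero r l) s = s\<lparr>pc := (if regs s r = 0 then l else Suc (pc s))\<rparr>"

definition halted :: "ram_program \<Rightarrow> ram_config \<Rightarrow> bool" where
  "halted P s \<longleftrightarrow> length P \<le> pc s"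

definition ram_step :: "ram_program \<Rightarrow> ram_config \<Rightarrow> ram_config" where
  "ram_step P s = (if halted P s then s else exec_instr (P ! pc s) s)"

definition initial_config :: "nat list \<Rightarrow> ram_config" where
  "initial_config xs =
     \<lparr>pc = 0, regs = (\<lambda>_. 0), mem = (\<lambda>a. if a < length xs then xs ! a else 0)\<rparr>"

text \<open>Since \<^const>\<open>ram_step\<close> does not change a halted configuration, the final one is unique.\<close>

definition halts_within :: "ram_program \<Rightarrow> nat list \<Rightarrow> nat \<Rightarrow> ram_config \<Rightarrow> bool" where
  "halts_within P xs T s \<longleftrightarrow>
     (\<exists>t\<le>T. s = (ram_step P ^^ t) (initial_config xs) \<and> halted P s)"


section \<open>Input and output conventions\<close>

definition indicator_array :: "nat \<Rightarrow> nat set \<Rightarrow> nat list" where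
  "indicator_array n I = map (\<lambda>i. of_bool (i \<in> I)) [1..<Suc n]"

definition perm_arrays :: "nat \<Rightarrow> (nat \<Rightarrow> nat) \<Rightarrow> nat list" where
  "perm_arrays n \<gamma> = map \<gamma> [1..<Suc n] @ map (inv \<gamma>) [1..<Suc n]"

definition encode_input ::
    "nat \<Rightarrow> (nat \<Rightarrow> nat) list \<Rightarrow> nat set \<Rightarrow> nat set \<Rightarrow> nat list" where
  "encode_input n \<gamma>s I0 I1 =
     [n, length \<gamma>s] @ indicator_array n I0 @ indicator_array n I1 @ concat (map (perm_arrays n) \<gamma>s)"

datatype answer = Infeasible | Feasible "nat set" "nat set"

text \<open>
  The message is read from register \<open>0\<close>; the sets are read in the same place and format in
  which \<^const>\<open>encode_input\<close> puts \<open>I0\<close> and \<open>I1\<close>.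
\<close>

definition decode_output :: "nat \<Rightarrow> ram_config \<Rightarrow> answer" where
  "decode_output n s =
     (if regs s 0 = 0 then Infeasible
      else Feasible {i \<in> {1..n}. mem s (1 + i) = 1} {i \<in> {1..n}. mem s (1 + n + i) = 1})"

end

theory Submission
  imports Defs
begin

text \<open>
  Fix a permutation and let \<open>f j\<close>, \<open>g j\<close> be the variables compared at position \<open>j\<close>. As long as the two
  components are equal, the comparison at the next position is forced. At the first position \<open>p\<close> that
  leaves a choice, \<open>x (f p) = 1\<close> and \<open>x (g p) = 0\<close> make the rest of \<open>x\<close> arbitrary, so that only
  \<open>f p := 1\<close> and \<open>g p := 0\<close> can still be valid fixings. The first is valid iff propagating the
  hypothesis \<open>x (f p) = x (g p) = 0\<close> to the positions behind \<open>p\<close> runs into a contradiction; the second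
  is its dual under complementing the values and exchanging \<open>f\<close> and \<open>g\<close>.

  Neither of these lookaheads ever moves backwards, even when its hypothesis is abandoned because the
  main position moves on. This is sound since an abandoned lookahead for \<open>0\<close> can only have passed
  positions \<open>i\<close> at which \<open>f i\<close> is determined as soon as all earlier positions are settled; if the main
  position stops there, \<open>f i\<close> is \<open>1\<close> already and no lookahead for \<open>0\<close> is needed. So a permutation costs
  \<open>O(n)\<close> for its three positions and \<open>O(1)\<close> for every newly fixed variable, which is compared with the
  tentative values of the lookaheads.
\<close>

section \<open>Lexicographic propagation\<close>

text \<open>A fixing found for one permutation can destroy completeness for all others, and
  restarting a scan of length \<open>n\<close> after each of up to \<open>n\<close> fixings would
  exceed the time bound by a factor \<open>n\<close>. The bound therefore rests on amortisation: a
  variable enters the queue only when it becomes fixed, so with one dummy entry that triggers the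
  first sweep there are at most \<open>n + 1\<close> sweeps of constant cost per permutation; all
  further work is charged to the three positions of a permutation, whose sum never decreases and is
  at most \<open>3 * n\<close>. A sweep that leaves the queue empty has fixed nothing, so that all
  permutations are complete for the same sets.

  The delicate point is that an abandoned hypothesis leaves positions behind that were passed
  because of it. A tentative zero other than \<open>f p\<close> arose as \<open>g j\<close> at an
  earlier position. If \<open>f i\<close> is such a \<open>g j\<close>, injectivity of
  \<open>f\<close> gives \<open>f j \<noteq> f i\<close>, so settling position \<open>j\<close>
  gives \<open>f i\<close> a fixed value, whatever it is. As this has to survive all later fixings,
  \<open>forced_at\<close> ranges over every consistent refinement of the fixed variables.\<close>

definition extends :: "nat set \<Rightarrow> nat set \<Rightarrow> (nat \<Rightarrow> bool) \<Rightarrow> bool" where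
  "extends Z W x \<longleftrightarrow> (\<forall>v\<in>Z. \<not> x v) \<and> (\<forall>v\<in>W. x v)"

text \<open>The vector read along \<open>f\<close> is lexicographically not smaller than the one
  read along \<open>g\<close>: the first difference is never 0 against 1. Keeping both index maps
  free turns complementation with exchange of \<open>f\<close> and \<open>g\<close> into a
  symmetry.\<close>

definition lex_sol :: "nat \<Rightarrow> (nat \<Rightarrow> nat) \<Rightarrow> (nat \<Rightarrow> nat) \<Rightarrow> (nat \<Rightarrow> bool) \<Rightarrow> bool" where
  "lex_sol n f g x \<longleftrightarrow>
     (\<forall>j<n. (\<forall>i<j. x (f i) = x (g i)) \<longrightarrow> x (g j) \<longrightarrow> x (f j))"

definition eq_at :: "(nat \<Rightarrow> nat) \<Rightarrow> (nat \<Rightarrow> nat) \<Rightarrow> nat set \<Rightarrow> nat set \<Rightarrow> nat \<Rightarrow> bool" where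
  "eq_at f g Z W i \<longleftrightarrow> f i = g i \<or> f i \<in> Z \<and> g i \<in> Z \<or> f i \<in> W \<and> g i \<in> W"

text \<open>Neither propagation rule applies: a one at \<open>g i\<close> would force
  \<open>f i\<close>, a zero at \<open>f i\<close> would force \<open>g i\<close>. A position with
  \<open>f i \<in> W\<close> and \<open>g i \<in> Z\<close> is also a stop, because the comparison
  is already decided there.\<close>

definition stop_at :: "(nat \<Rightarrow> nat) \<Rightarrow> (nat \<Rightarrow> nat) \<Rightarrow> nat set \<Rightarrow> nat set \<Rightarrow> nat \<Rightarrow> bool" where
  "stop_at f g Z W i \<longleftrightarrow> f i \<noteq> g i \<and> g i \<notin> W \<and> f i \<notin> Z"

definition refines :: "nat set \<Rightarrow> nat set \<Rightarrow> nat set \<Rightarrow> nat set \<Rightarrow> bool" where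
  "refines Z W Z' W' \<longleftrightarrow> Z \<subseteq> Z' \<and> W \<subseteq> W' \<and> Z' \<inter> W' = {}"

text \<open>Quantifying over refinements makes the property hereditary under later fixings, so it
  outlives the hypothesis under which position \<open>i\<close> was passed. If the refinement stops
  at \<open>i\<close>, only \<open>f i \<in> W'\<close> remains of the four alternatives.\<close>

definition forced_at :: "(nat \<Rightarrow> nat) \<Rightarrow> (nat \<Rightarrow> nat) \<Rightarrow> nat set \<Rightarrow> nat set \<Rightarrow> nat \<Rightarrow> bool" where
  "forced_at f g Z W i \<longleftrightarrow>
     (\<forall>Z' W'. refines Z W Z' W' \<and> (\<forall>j<i. eq_at f g Z' W' j) \<longrightarrow>
        f i = g i \<or> f i \<in> Z' \<or> f i \<in> W' \<or> g i \<in> W')"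

text \<open>
  The lookahead for \<open>0\<close> from the main position \<open>p\<close> has passed the positions before \<open>q\<close> and found the
  tentative zeros \<open>T0\<close> and ones \<open>T1\<close>. If \<open>f p \<in> W\<close>, then \<open>q\<close> may stem from an earlier main position.
\<close>

definition lookahead ::
    "nat \<Rightarrow> (nat \<Rightarrow> nat) \<Rightarrow> (nat \<Rightarrow> nat) \<Rightarrow> nat set \<Rightarrow> nat set \<Rightarrow> nat \<Rightarrow> nat \<Rightarrow> nat set \<Rightarrow> nat set \<Rightarrow> bool"
  where
  "lookahead n f g Z W p q T0 T1 \<longleftrightarrow>
     q \<le> n \<and>
     (\<forall>i<q. i \<noteq> p \<or> f p \<in> W \<longrightarrow> forced_at f g Z W i) \<and>
     (p < n \<longrightarrow> (\<forall>x. lex_sol n f g x \<and> extends Z W x \<and> \<not> x (f p) \<longrightarrow>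
        (\<forall>i<q. x (f i) = x (g i)) \<and> extends T0 T1 x)) \<and>
     T0 \<subseteq> insert (f p) (g ` {..<q}) \<and>
     (\<forall>v\<in>T1. \<forall>Z' W'. refines Z W Z' W' \<and> (\<forall>j<q. eq_at f g Z' W' j) \<longrightarrow> v \<in> W') \<and>
     (p < n \<and> f p \<notin> W \<and> p < q \<longrightarrow> f p \<in> T0 \<and>
        (\<forall>i. p \<le> i \<and> i < q \<longrightarrow> eq_at f g (Z \<union> T0) (W \<union> T1) i)) \<and>
     T0 \<inter> T1 = {} \<and>
     (q \<le> p \<longrightarrow> T0 = {} \<and> T1 = {})"

lemma lookaheadI:
  assumes "q \<le> n"
    and "\<And>i. i < q \<Longrightarrow> i \<noteq> p \<or> f p \<in> W \<Longrightarrow> forced_at f g Z W i"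
    and "\<And>x i. p < n \<Longrightarrow> lex_sol n f g x \<Longrightarrow> extends Z W x \<Longrightarrow> \<not> x (f p) \<Longrightarrow> i < q \<Longrightarrow> x (f i) = x (g i)"
    and "\<And>x. p < n \<Longrightarrow> lex_sol n f g x \<Longrightarrow> extends Z W x \<Longrightarrow> \<not> x (f p) \<Longrightarrow> extends T0 T1 x"
    and "T0 \<subseteq> insert (f p) (g ` {..<q})"
    and "\<And>v Z' W'. v \<in> T1 \<Longrightarrow> refines Z W Z' W' \<Longrightarrow> \<forall>j<q. eq_at f g Z' W' j \<Longrightarrow> v \<in> W'"
    and "p < n \<Longrightarrow> f p \<notin> W \<Longrightarrow> p < q \<Longrightarrow> f p \<in> T0"
    and "\<And>i. p < n \<Longrightarrow> f p \<notin> W \<Longrightarrow> p \<le> i \<Longrightarrow> i < q \<Longrightarrow> eq_at f g (Z \<union> T0) (W \<union> T1) i"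
    and "T0 \<inter> T1 = {}"
    and "q \<le> p \<Longrightarrow> T0 = {} \<and> T1 = {}"
  shows "lookahead n f g Z W p q T0 T1"
  unfolding lookahead_def
  by (intro conjI allI ballI impI; (elim conjE)?; (blast intro: assms(2-4,6-8) | simp add: assms))

lemma lookaheadD:
  assumes "lookahead n f g Z W p q T0 T1"
  shows "q \<le> n"
    and "\<And>i. i < q \<Longrightarrow> i \<noteq> p \<or> f p \<in> W \<Longrightarrow> forced_at f g Z W i"
    and "\<And>x i. p < n \<Longrightarrow> lex_sol n f g x \<Longrightarrow> extends Z W x \<Longrightarrow> \<not> x (f p) \<Longrightarrow> i < q \<Longrightarrow> x (f i) = x (g i)"
    and "\<And>x. p < n \<Longrightarrow> lex_sol n f g x \<Longrightarrow> extends Z W x \<Longrightarrow> \<not> x (f p) \<Longrightarrow> extends T0 T1 x"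
    and "T0 \<subseteq> insert (f p) (g ` {..<q})"
    and "\<And>v Z' W'. v \<in> T1 \<Longrightarrow> refines Z W Z' W' \<Longrightarrow> \<forall>j<q. eq_at f g Z' W' j \<Longrightarrow> v \<in> W'"
    and "p < n \<Longrightarrow> f p \<notin> W \<Longrightarrow> p < q \<Longrightarrow> f p \<in> T0"
    and "\<And>i. p < n \<Longrightarrow> f p \<notin> W \<Longrightarrow> p \<le> i \<Longrightarrow> i < q \<Longrightarrow> eq_at f g (Z \<union> T0) (W \<union> T1) i"
    and "T0 \<inter> T1 = {}"
    and "q \<le> p \<Longrightarrow> T0 = {} \<and> T1 = {}"
proof -
  note A = assms[unfolded lookahead_def]
  show "q \<le> n" "T0 \<subseteq> insert (f p) (g ` {..<q})" "T0 \<inter> T1 = {}"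
    using A by simp_all
  show "q \<le> p \<Longrightarrow> T0 = {} \<and> T1 = {}" using A by simp
  show "forced_at f g Z W i" if "i < q" "i \<noteq> p \<or> f p \<in> W" for i using A that by simp
  show "x (f i) = x (g i)"
    if "p < n" "lex_sol n f g x" "extends Z W x" "\<not> x (f p)" "i < q" for x i
    using A that by simp
  show "extends T0 T1 x" if "p < n" "lex_sol n f g x" "extends Z W x" "\<not> x (f p)" for x
    using A that by simp
  show "v \<in> W'" if "v \<in> T1" "refines Z W Z' W'" "\<forall>j<q. eq_at f g Z' W' j" for v Z' W'
    using A that by simp
  show "f p \<in> T0" if "p < n" "f p \<notin> W" "p < q" using A that by simp
  show "eq_at f g (Z \<union> T0) (W \<union> T1) i" if "p < n" "f p \<notin> W" "p \<le> i" "i < q" for i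
    using A that by simp
qed

section \<open>Duality and monotonicity of the propagation notions\<close>

lemma lex_sol_dual: "lex_sol n g f (\<lambda>v. \<not> x v) \<longleftrightarrow> lex_sol n f g x"
  unfolding lex_sol_def by metis

lemma extends_dual: "extends W Z (\<lambda>v. \<not> x v) \<longleftrightarrow> extends Z W x"
  unfolding extends_def by auto

lemma eq_at_dual: "eq_at g f W Z i \<longleftrightarrow> eq_at f g Z W i"
  unfolding eq_at_def by auto

lemma stop_at_dual: "stop_at g f W Z i \<longleftrightarrow> stop_at f g Z W i"
  unfolding stop_at_def by auto

lemma eq_at_mono: "eq_at f g Z W i \<Longrightarrow> Z \<subseteq> Z' \<Longrightarrow> W \<subseteq> W' \<Longrightarrow> eq_at f g Z' W' i"
  unfolding eq_at_def by blast

lemma eq_at_extends: "eq_at f g Z W i \<Longrightarrow> extends Z W x \<Longrightarrow> x (f i) = x (g i)"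
  unfolding eq_at_def extends_def by auto

lemma extends_mono: "extends Z' W' x \<Longrightarrow> Z \<subseteq> Z' \<Longrightarrow> W \<subseteq> W' \<Longrightarrow> extends Z W x"
  unfolding extends_def by blast

lemma refines_mono: "refines Z' W' Z'' W'' \<Longrightarrow> Z \<subseteq> Z' \<Longrightarrow> W \<subseteq> W' \<Longrightarrow> refines Z W Z'' W''"
  unfolding refines_def by blast

lemma forced_at_mono:
  "forced_at f g Z W i \<Longrightarrow> Z \<subseteq> Z' \<Longrightarrow> W \<subseteq> W' \<Longrightarrow> forced_at f g Z' W' i"
  unfolding forced_at_def by (meson refines_mono)

lemma forced_at_eq: "eq_at f g Z W i \<Longrightarrow> forced_at f g Z W i"
  unfolding forced_at_def eq_at_def refines_def by blast

lemma forced_at_one: "f i \<in> W \<Longrightarrow> forced_at f g Z W i"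
  unfolding forced_at_def refines_def by blast

section \<open>Moves of a lookahead\<close>

lemma lookahead_empty: "lookahead n f g Z W 0 0 {} {}"
  by (rule lookaheadI) (auto simp: extends_def)

text \<open>The clauses about extensions and refinements of \<open>(Z, W)\<close> weaken when the
  sets grow. The only position that has to be added to the forced ones is \<open>p\<close> itself
  when \<open>f p\<close> enters \<open>W\<close>, and a one at \<open>f p\<close> is forced
  trivially.\<close>

lemma lookahead_mono:
  assumes L: "lookahead n f g Z W p q T0 T1" and Z: "Z \<subseteq> Z'" and W: "W \<subseteq> W'"
  shows "lookahead n f g Z' W' p q T0 T1"
proof (rule lookaheadI)
  note D = lookaheadD[OF L]
  show "forced_at f g Z' W' i" if "i < q" "i \<noteq> p \<or> f p \<in> W'" for i
  proof (cases "i = p")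
    case True
    then show ?thesis using that forced_at_one by blast
  next
    case False
    then show ?thesis using forced_at_mono[OF D(2) Z W] that by blast
  qed
  show "x (f i) = x (g i)"
    if "p < n" "lex_sol n f g x" "extends Z' W' x" "\<not> x (f p)" "i < q" for x i
    by (rule D(3)[OF that(1,2) extends_mono[OF that(3) Z W] that(4,5)])
  show "extends T0 T1 x" if "p < n" "lex_sol n f g x" "extends Z' W' x" "\<not> x (f p)" for x
    by (rule D(4)[OF that(1,2) extends_mono[OF that(3) Z W] that(4)])
  show "v \<in> W''" if "v \<in> T1" "refines Z' W' Z'' W''" "\<forall>j<q. eq_at f g Z'' W'' j" for v Z'' W''
    by (rule D(6)[OF that(1) refines_mono[OF that(2) Z W] that(3)])
  show "f p \<in> T0" if "p < n" "f p \<notin> W'" "p < q" using D(7) that W by blast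
  show "eq_at f g (Z' \<union> T0) (W' \<union> T1) i" if "p < n" "f p \<notin> W'" "p \<le> i" "i < q" for i
  proof (rule eq_at_mono)
    show "eq_at f g (Z \<union> T0) (W \<union> T1) i" using D(8) that W by blast
  qed (use Z W in auto)
qed (use lookaheadD[OF L] in auto)

text \<open>The reason why a lookahead never has to move back: a new main position \<open>p'\<close>
  that it has already passed is forced, and stopping there excludes every alternative except
  \<open>f p' \<in> W\<close>. The fixing that the lookahead would have to decide is then already
  made.\<close>

lemma lookahead_live:
  assumes L: "lookahead n f g Z W p q T0 T1" and "p' < n" "p < p'" "p' < q" "Z \<inter> W = {}"
    and eq: "\<forall>i<p'. eq_at f g Z W i" and stop: "stop_at f g Z W p'"
  shows "f p' \<in> W"
proof -
  have "forced_at f g Z W p'" using lookaheadD(2)[OF L] assms(3,4) by simp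
  then have "f p' = g p' \<or> f p' \<in> Z \<or> f p' \<in> W \<or> g p' \<in> W"
    using eq assms(5) unfolding forced_at_def refines_def by simp
  then show ?thesis using stop unfolding stop_at_def by auto
qed

text \<open>All tentative values are dropped while \<open>q\<close> is kept. If
  \<open>q <= p'\<close>, only settled positions have been passed; if \<open>p' < q\<close> and
  \<open>p' < n\<close>, then \<open>f p' \<in> W\<close> by \<open>lookahead_live\<close>, and the
  new hypothesis \<open>\<not> x (f p')\<close> contradicts \<open>W\<close>.\<close>

lemma lookahead_move:
  assumes L: "lookahead n f g Z W p q T0 T1" and "p' \<le> n" "p < p'" "Z \<inter> W = {}"
    and eq: "\<forall>i<p'. eq_at f g Z W i" and stop: "p' < n \<Longrightarrow> stop_at f g Z W p'"
  shows "lookahead n f g Z W p' q {} {}"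
proof -
  have live: "f p' \<in> W" if "p' < n" "p' < q"
    using lookahead_live[OF L that(1) assms(3) that(2) assms(4) eq stop[OF that(1)]] .
  show ?thesis
  proof (rule lookaheadI)
    show "forced_at f g Z W i" if "i < q" "i \<noteq> p' \<or> f p' \<in> W" for i
    proof (cases "i = p")
      case True
      \<comment> \<open>The old main position was exempt from the forced positions of
        \<open>L\<close>; it is settled by now, hence forced.\<close>
      then show ?thesis using eq forced_at_eq \<open>p < p'\<close> by blast
    next
      case False
      then show ?thesis using lookaheadD(2)[OF L] that by blast
    qed
    show "x (f i) = x (g i)"
      if "p' < n" "lex_sol n f g x" "extends Z W x" "\<not> x (f p')" "i < q" for x i
    proof (cases "p' < q")
      case True
      then have "x (f p')" using live that unfolding extends_def by auto
      then show ?thesis using that by auto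
    next
      case False
      then have "eq_at f g Z W i" using eq that by auto
      then show ?thesis using that eq_at_extends by blast
    qed
    show "f p' \<in> {}" if "p' < n" "f p' \<notin> W" "p' < q" using live that by auto
    show "eq_at f g (Z \<union> {}) (W \<union> {}) i" if "p' < n" "f p' \<notin> W" "p' \<le> i" "i < q" for i
      using live that by auto
  qed (use lookaheadD(1)[OF L] in \<open>auto simp: extends_def\<close>)
qed

lemma lookahead_start:
  assumes "p < n" and eq: "\<forall>i<p. eq_at f g Z W i"
  shows "lookahead n f g Z W p (Suc p) {f p, g p} {}"
proof (rule lookaheadI)
  have a: "x (g p) = x (f p)" "\<forall>i<p. x (f i) = x (g i)"
    if "lex_sol n f g x" "extends Z W x" "\<not> x (f p)" for x
  proof -
    show e: "\<forall>i<p. x (f i) = x (g i)" using eq that(2) eq_at_extends by blast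
    then show "x (g p) = x (f p)" using that \<open>p < n\<close> unfolding lex_sol_def by auto
  qed
  show "forced_at f g Z W i" if "i < Suc p" "i \<noteq> p \<or> f p \<in> W" for i
  proof (cases "i = p")
    case True
    then show ?thesis using that forced_at_one by blast
  next
    case False
    then show ?thesis using eq forced_at_eq that by (simp add: less_Suc_eq)
  qed
  show "x (f i) = x (g i)"
    if "lex_sol n f g x" "extends Z W x" "\<not> x (f p)" "i < Suc p" for x i
    using a[OF that(1-3)] that(4) by (auto simp: less_Suc_eq)
  show "extends {f p, g p} {} x"
    if "lex_sol n f g x" "extends Z W x" "\<not> x (f p)" for x
    using a[OF that(1-3)] that(3) by (auto simp: extends_def)
  show "eq_at f g (Z \<union> {f p, g p}) (W \<union> {}) i" if "p \<le> i" "i < Suc p" for i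
  proof -
    have "i = p" using that by simp
    then show ?thesis by (simp add: eq_at_def)
  qed
qed (use \<open>p < n\<close> in auto)

lemma lookahead_pass_eq:
  assumes L: "lookahead n f g Z W p q T0 T1" and "p < q" "q < n" "f q = g q"
  shows "lookahead n f g Z W p (Suc q) T0 T1"
proof (rule lookaheadI)
  note D = lookaheadD[OF L]
  show "forced_at f g Z W i" if "i < Suc q" "i \<noteq> p \<or> f p \<in> W" for i
  proof (cases "i = q")
    case True
    then show ?thesis using assms(4) by (simp add: forced_at_def)
  next
    case False
    then show ?thesis using D(2) that by (simp add: less_Suc_eq)
  qed
  show "x (f i) = x (g i)"
    if "p < n" "lex_sol n f g x" "extends Z W x" "\<not> x (f p)" "i < Suc q" for x i
    using D(3)[OF that(1-4)] that(5) assms(4) by (auto simp: less_Suc_eq)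
  show "extends T0 T1 x" if "p < n" "lex_sol n f g x" "extends Z W x" "\<not> x (f p)" for x
    by (rule D(4)[OF that])
  show "T0 \<subseteq> insert (f p) (g ` {..<Suc q})" using D(5) by (auto simp: lessThan_Suc)
  show "v \<in> W'" if "v \<in> T1" "refines Z W Z' W'" "\<forall>j<Suc q. eq_at f g Z' W' j" for v Z' W'
    using D(6)[OF that(1,2)] that(3) by simp
  show "f p \<in> T0" if "p < n" "f p \<notin> W" using D(7) that assms(2) by simp
  show "eq_at f g (Z \<union> T0) (W \<union> T1) i" if "p < n" "f p \<notin> W" "p \<le> i" "i < Suc q" for i
    using D(8)[OF that(1-3)] that(4) assms(4) by (auto simp: less_Suc_eq eq_at_def)
qed (use assms(2,3) lookaheadD(9)[OF L] in auto)

text \<open>Tentative ones do not depend on the hypothesis: once the earlier positions are settled,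
  \<open>g q\<close> is a one in every refinement, and settling position \<open>q\<close> as well
  carries this over to \<open>f q\<close>.\<close>

lemma lookahead_pass_one:
  assumes L: "lookahead n f g Z W p q T0 T1" and "p < q" "q < n"
    and b: "g q \<in> W \<union> T1" and a: "f q \<notin> Z \<union> T0"
  shows "lookahead n f g Z W p (Suc q) T0 (insert (f q) T1)"
proof (rule lookaheadI)
  note D = lookaheadD[OF L]
  have gq: "g q \<in> W'" if "refines Z W Z' W'" "\<forall>j<q. eq_at f g Z' W' j" for Z' W'
    using b D(6)[OF _ that] that(1) unfolding refines_def by auto
  have xq: "x (g q) \<and> x (f q)" "\<forall>i<q. x (f i) = x (g i)" "extends T0 T1 x"
    if "p < n" "lex_sol n f g x" "extends Z W x" "\<not> x (f p)" for x
  proof -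
    show eq: "\<forall>i<q. x (f i) = x (g i)" using D(3)[OF that] by blast
    show ext: "extends T0 T1 x" by (rule D(4)[OF that])
    have "x (g q)" using b ext that(3) unfolding extends_def by auto
    then show "x (g q) \<and> x (f q)" using eq that(2) \<open>q < n\<close> unfolding lex_sol_def by blast
  qed
  show "forced_at f g Z W i" if "i < Suc q" "i \<noteq> p \<or> f p \<in> W" for i
  proof (cases "i = q")
    case True
    then show ?thesis unfolding forced_at_def using gq by blast
  next
    case False
    then show ?thesis using D(2) that by (simp add: less_Suc_eq)
  qed
  show "x (f i) = x (g i)"
    if "p < n" "lex_sol n f g x" "extends Z W x" "\<not> x (f p)" "i < Suc q" for x i
    using xq[OF that(1-4)] that(5) by (auto simp: less_Suc_eq)
  show "extends T0 (insert (f q) T1) x"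
    if "p < n" "lex_sol n f g x" "extends Z W x" "\<not> x (f p)" for x
    using xq[OF that] unfolding extends_def by simp
  show "T0 \<subseteq> insert (f p) (g ` {..<Suc q})" using D(5) by (auto simp: lessThan_Suc)
  show "v \<in> W'" if v: "v \<in> insert (f q) T1" and r: "refines Z W Z' W'"
    and e: "\<forall>j<Suc q. eq_at f g Z' W' j" for v Z' W'
  proof (cases "v = f q")
    case True
    have "eq_at f g Z' W' q" "g q \<in> W'" using e gq[OF r] by auto
    then show ?thesis using True r unfolding eq_at_def refines_def by auto
  next
    case False
    then show ?thesis using D(6)[OF _ r] v e by auto
  qed
  show "f p \<in> T0" if "p < n" "f p \<notin> W" using D(7) that assms(2) by simp
  show "eq_at f g (Z \<union> T0) (W \<union> insert (f q) T1) i" if "p < n" "f p \<notin> W" "p \<le> i" "i < Suc q" for i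
  proof (cases "i = q")
    case True
    then show ?thesis using b unfolding eq_at_def by auto
  next
    case False
    then have "eq_at f g (Z \<union> T0) (W \<union> T1) i" using D(8)[OF that(1-3)] that(4) by simp
    then show ?thesis by (rule eq_at_mono) auto
  qed
  show "T0 \<inter> insert (f q) T1 = {}" using D(9) a by auto
qed (use assms(2,3) in auto)

text \<open>Tentative zeros do depend on the hypothesis, so after it is dropped \<open>f q\<close>
  need not be a zero. That it is still determined is the crucial case of
  \<open>forced_at\<close>.\<close>

lemma lookahead_pass_zero:
  assumes L: "lookahead n f g Z W p q T0 T1" and "p < q" "q < n" and inj: "inj_on f {..<n}"
    and a: "f q \<in> Z \<union> T0" and b: "g q \<notin> W \<union> T1"
  shows "lookahead n f g Z W p (Suc q) (insert (g q) T0) T1"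
proof (rule lookaheadI)
  note D = lookaheadD[OF L]
  have fq: "f q = g q \<or> f q \<in> Z' \<or> f q \<in> W'"
    if r: "refines Z W Z' W'" and e: "\<forall>j<q. eq_at f g Z' W' j" for Z' W'
  proof (cases "f q \<in> Z")
    case True
    then show ?thesis using r unfolding refines_def by auto
  next
    case False
    \<comment> \<open>By its origin, \<open>f q\<close> is \<open>f p\<close> or some
      \<open>g j\<close> with \<open>j < q\<close>. Injectivity excludes \<open>f q = f p\<close>
      and \<open>f q = f j\<close>, so equality at position \<open>j\<close> cannot be the trivial
      one and fixes the value of \<open>g j\<close>, that is of \<open>f q\<close>.\<close>
    then have "f q \<in> insert (f p) (g ` {..<q})" using a D(5) by auto
    moreover have "f q \<noteq> f p" using inj assms(2,3) by (auto dest: inj_onD)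
    ultimately obtain j where j: "j < q" "f q = g j" by auto
    then have "f j \<noteq> f q" using inj_onD[OF inj, of j q] assms(3) by auto
    then show ?thesis using e j unfolding eq_at_def by auto
  qed
  have xq: "\<not> x (f q) \<and> \<not> x (g q)" "\<forall>i<q. x (f i) = x (g i)" "extends T0 T1 x"
    if "p < n" "lex_sol n f g x" "extends Z W x" "\<not> x (f p)" for x
  proof -
    show eq: "\<forall>i<q. x (f i) = x (g i)" using D(3)[OF that] by blast
    show ext: "extends T0 T1 x" by (rule D(4)[OF that])
    have "\<not> x (f q)" using a ext that(3) unfolding extends_def by auto
    then show "\<not> x (f q) \<and> \<not> x (g q)" using eq that(2) \<open>q < n\<close> unfolding lex_sol_def by blast
  qed
  show "forced_at f g Z W i" if "i < Suc q" "i \<noteq> p \<or> f p \<in> W" for i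
  proof (cases "i = q")
    case True
    then show ?thesis unfolding forced_at_def using fq by blast
  next
    case False
    then show ?thesis using D(2) that by (simp add: less_Suc_eq)
  qed
  show "x (f i) = x (g i)"
    if "p < n" "lex_sol n f g x" "extends Z W x" "\<not> x (f p)" "i < Suc q" for x i
    using xq[OF that(1-4)] that(5) by (auto simp: less_Suc_eq)
  show "extends (insert (g q) T0) T1 x"
    if "p < n" "lex_sol n f g x" "extends Z W x" "\<not> x (f p)" for x
    using xq[OF that] unfolding extends_def by simp
  show "insert (g q) T0 \<subseteq> insert (f p) (g ` {..<Suc q})" using D(5) by (auto simp: lessThan_Suc)
  show "v \<in> W'" if "v \<in> T1" "refines Z W Z' W'" "\<forall>j<Suc q. eq_at f g Z' W' j" for v Z' W'
    using D(6)[OF that(1,2)] that(3) by simp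
  show "f p \<in> insert (g q) T0" if "p < n" "f p \<notin> W" using D(7) that assms(2) by simp
  show "eq_at f g (Z \<union> insert (g q) T0) (W \<union> T1) i" if "p < n" "f p \<notin> W" "p \<le> i" "i < Suc q" for i
  proof (cases "i = q")
    case True
    then show ?thesis using a unfolding eq_at_def by auto
  next
    case False
    then have "eq_at f g (Z \<union> T0) (W \<union> T1) i" using D(8)[OF that(1-3)] that(4) by simp
    then show ?thesis by (rule eq_at_mono) auto
  qed
  show "insert (g q) T0 \<inter> T1 = {}" using D(9) b by auto
qed (use assms(2,3) in auto)

section \<open>Outcomes of a lookahead\<close>

lemma lookahead_fail:
  assumes L: "lookahead n f g Z W p q T0 T1" and "p < n" "q < n"
    and "f q \<in> Z \<union> T0" and "g q \<in> W \<union> T1"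
    and x: "lex_sol n f g x" "extends Z W x"
  shows "x (f p)"
proof (rule ccontr)
  assume "\<not> x (f p)"
  then have "\<forall>i<q. x (f i) = x (g i)" "extends T0 T1 x"
    using lookaheadD(3,4)[OF L \<open>p < n\<close> x] by blast+
  moreover then have "x (g q)" "\<not> x (f q)" using assms(4,5) x(2) unfolding extends_def by auto
  ultimately show False using x(1) \<open>q < n\<close> unfolding lex_sol_def by blast
qed

lemma lookahead_conflict:
  assumes L: "lookahead n f g Z W p q T0 T1" and "p < n"
    and "v \<in> T0 \<inter> W \<or> v \<in> T1 \<inter> Z"
    and x: "lex_sol n f g x" "extends Z W x"
  shows "x (f p)"
proof (rule ccontr)
  assume "\<not> x (f p)"
  then have "extends T0 T1 x" by (rule lookaheadD(4)[OF L \<open>p < n\<close> x])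
  then show False using assms(3) x(2) unfolding extends_def by auto
qed

text \<open>The witness is \<open>1\<close> on the determined ones and at the first variable of the stop, \<open>0\<close> elsewhere.\<close>

lemma lookahead_witness:
  assumes L: "lookahead n f g Z W p q T0 T1" and "p < n" "p < q"
    and inj: "inj_on f {..<n}" and dis: "Z \<inter> W = {}"
    and eq: "\<forall>i<p. eq_at f g Z W i" and live: "f p \<notin> W"
    and stop: "q < n \<Longrightarrow> stop_at f g (Z \<union> T0) (W \<union> T1) q"
    and nc: "T0 \<inter> W = {}" "T1 \<inter> Z = {}"
  obtains x where "lex_sol n f g x" "extends Z W x" "\<not> x (f p)"
proof
  define x where "x v \<longleftrightarrow> v \<in> W \<union> T1 \<or> q < n \<and> v = f q" for v
  have T: "T0 \<inter> T1 = {}" "f p \<in> T0" and e: "\<forall>i. p \<le> i \<and> i < q \<longrightarrow> eq_at f g (Z \<union> T0) (W \<union> T1) i"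
    using lookaheadD(7,8,9)[OF L] assms(2,3) live by blast+
  have e': "eq_at f g (Z \<union> T0) (W \<union> T1) i" if "i < q" for i
    using that e eq eq_at_mono[of f g Z W i "Z \<union> T0" "W \<union> T1"] by (cases "i < p") auto
  have E: "extends (Z \<union> T0) (W \<union> T1) x"
    using T(1) nc dis stop unfolding extends_def x_def stop_at_def by blast
  then show "extends Z W x" by (rule extends_mono) auto
  show "\<not> x (f p)" using E T(2) unfolding extends_def by auto
  have "x (f j)" if "j < n" "\<forall>i<j. x (f i) = x (g i)" "x (g j)" for j
  proof (cases j q rule: linorder_cases)
    case less
    then show ?thesis using e'[OF less] E that(3) eq_at_extends by blast
  next
    case equal
    then show ?thesis using that by (simp add: x_def)
  next
    \<comment> \<open>Position \<open>q\<close> is strict, with \<open>x (f q)\<close> and not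
      \<open>x (g q)\<close>, so no later position is ever compared.\<close>
    case greater
    then have "x (f q) = x (g q)" "q < n" using that by auto
    then show ?thesis using stop unfolding x_def stop_at_def by auto
  qed
  then show "lex_sol n f g x" unfolding lex_sol_def by blast
qed

lemma lex_sol_at:
  assumes "lex_sol n f g x" "extends Z W x" "\<forall>i<p. eq_at f g Z W i" "p < n" "x (g p)"
  shows "x (f p)"
  using assms eq_at_extends[of f g Z W _ x] unfolding lex_sol_def by blast

text \<open>Covers both ways in which the main position can end: for \<open>p < n\<close> there is a
  strict first difference at \<open>p\<close>, for \<open>p = n\<close> all compared values
  agree.\<close>

lemma lex_sol_eq:
  assumes "extends Z W x" "\<forall>i<p. eq_at f g Z W i" "p < n \<Longrightarrow> x (f p) \<and> \<not> x (g p)" "p \<le> n"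
  shows "lex_sol n f g x"
  unfolding lex_sol_def
proof (intro allI impI)
  fix j assume j: "j < n" "\<forall>i<j. x (f i) = x (g i)" "x (g j)"
  show "x (f j)"
  proof (cases "j < p")
    case True
    then show ?thesis using eq_at_extends[of f g Z W j x] assms j by blast
  next
    case False
    then show ?thesis using assms j by (metis le_neq_implies_less not_less order.strict_trans2)
  qed
qed

section \<open>Structured programs\<close>

type_synonym store = "(nat \<Rightarrow> nat) \<times> (nat \<Rightarrow> nat)"

text \<open>\<open>Abort\<close> leaves the whole program from any depth. Register \<open>0\<close>
  is still zero at that time, which decodes as the message Infeasible.\<close>

datatype com =
    Skip
  | Abort
  | Ins instr
  | Seq com com (infixr \<open>;;\<close> 60)
  | IfZ nat com com
  | While nat com

fun is_jump :: "instr \<Rightarrow> bool" where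
  "is_jump (Jump l) = True"
| "is_jump (JumpZero r l) = True"
| "is_jump _ = False"

fun jump_free :: "com \<Rightarrow> bool" where
  "jump_free (Ins i) = (\<not> is_jump i)"
| "jump_free (c ;; d) = (jump_free c \<and> jump_free d)"
| "jump_free (IfZ r c d) = (jump_free c \<and> jump_free d)"
| "jump_free (While r c) = jump_free c"
| "jump_free _ = True"

definition effect :: "instr \<Rightarrow> store \<Rightarrow> store" where
  "effect i s = (let s' = exec_instr i \<lparr>pc = 0, regs = fst s, mem = snd s\<rparr> in (regs s', mem s'))"

lemma effect_simps [simp]:
  "effect (Const a k) (r, m) = (r(a := k), m)"
  "effect (Add a b c) (r, m) = (r(a := r b + r c), m)"
  "effect (Sub a b c) (r, m) = (r(a := r b - r c), m)"
  "effect (Load a b) (r, m) = (r(a := m (r b)), m)"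
  "effect (Store a b) (r, m) = (r, m(r a := r b))"
  by (simp_all add: effect_def)

text \<open>
  \<open>exec c s t h s'\<close>: from \<open>s\<close> the command reaches \<open>s'\<close> at cost at most \<open>t\<close>, and \<open>h\<close> says whether
  it has aborted.
\<close>

inductive exec :: "com \<Rightarrow> store \<Rightarrow> nat \<Rightarrow> bool \<Rightarrow> store \<Rightarrow> bool" where
  exec_Skip: "exec Skip s 0 False s"
| exec_Abort: "exec Abort s 1 True s"
| exec_Ins: "exec (Ins i) s 1 False (effect i s)"
| exec_Seq: "exec c s t False s' \<Longrightarrow> exec d s' t' h s'' \<Longrightarrow> exec (c ;; d) s (t + t') h s''"
| exec_Seq_abort: "exec c s t True s' \<Longrightarrow> exec (c ;; d) s t True s'"
| exec_IfZ_true: "fst s r = 0 \<Longrightarrow> exec c s t h s' \<Longrightarrow> exec (IfZ r c d) s (t + 2) h s'"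
| exec_IfZ_false: "fst s r \<noteq> 0 \<Longrightarrow> exec d s t h s' \<Longrightarrow> exec (IfZ r c d) s (t + 2) h s'"
| exec_While_end: "fst s r = 0 \<Longrightarrow> exec (While r c) s 1 False s"
| exec_While_step: "fst s r \<noteq> 0 \<Longrightarrow> exec c s t False s' \<Longrightarrow> exec (While r c) s' t' h s'' \<Longrightarrow>
    exec (While r c) s (t + t' + 2) h s''"
| exec_While_abort: "fst s r \<noteq> 0 \<Longrightarrow> exec c s t True s' \<Longrightarrow> exec (While r c) s (t + 1) True s'"

inductive_cases exec_SkipE: "exec Skip s t h s'"
inductive_cases exec_InsE: "exec (Ins i) s t h s'"
inductive_cases exec_AbortE: "exec Abort s t h s'"
inductive_cases exec_SeqE: "exec (c ;; d) s t h s'"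
inductive_cases exec_IfZE: "exec (IfZ r c d) s t h s'"

fun code_length :: "com \<Rightarrow> nat" where
  "code_length Skip = 0"
| "code_length Abort = 1"
| "code_length (Ins i) = 1"
| "code_length (c ;; d) = code_length c + code_length d"
| "code_length (IfZ r c d) = code_length c + code_length d + 2"
| "code_length (While r c) = code_length c + 2"

text \<open>The code for \<open>c\<close> placed at address \<open>a\<close>; \<open>e\<close> is the address to which \<^const>\<open>Abort\<close> jumps.\<close>

fun compile :: "nat \<Rightarrow> nat \<Rightarrow> com \<Rightarrow> instr list" where
  "compile e a Skip = []"
| "compile e a Abort = [Jump e]"
| "compile e a (Ins i) = [i]"
| "compile e a (c ;; d) = compile e a c @ compile e (a + code_length c) d"
| "compile e a (IfZ r c d) =
     [JumpZero r (a + code_length d + 2)] @ compile e (a + 1) d @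
     [Jump (a + code_length d + code_length c + 2)] @ compile e (a + code_length d + 2) c"
| "compile e a (While r c) =
     [JumpZero r (a + code_length c + 2)] @ compile e (a + 1) c @ [Jump a]"

lemma length_compile [simp]: "length (compile e a c) = code_length c"
  by (induction c arbitrary: a) auto

section \<open>Execution of compiled code on the machine\<close>

definition config :: "nat \<Rightarrow> store \<Rightarrow> ram_config" where
  "config a s = \<lparr>pc = a, regs = fst s, mem = snd s\<rparr>"

fun code_at :: "ram_program \<Rightarrow> nat \<Rightarrow> instr list \<Rightarrow> bool" where
  "code_at P a [] = True"
| "code_at P a (i # xs) = (a < length P \<and> P ! a = i \<and> code_at P (Suc a) xs)"

lemma code_at_append [simp]:
  "code_at P a (xs @ ys) \<longleftrightarrow> code_at P a xs \<and> code_at P (a + length xs) ys"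
  by (induction xs arbitrary: a) auto

lemma code_at_suffix: "code_at (us @ xs) (length us) xs"
proof (induction xs arbitrary: us)
  case (Cons i xs)
  show ?case using Cons[of "us @ [i]"] by simp
qed simp

definition reaches :: "ram_program \<Rightarrow> ram_config \<Rightarrow> nat \<Rightarrow> ram_config \<Rightarrow> bool" where
  "reaches P s t s' \<longleftrightarrow> (\<exists>k\<le>t. s' = (ram_step P ^^ k) s)"

lemma reaches_refl: "reaches P s t s"
  unfolding reaches_def by (rule exI[of _ 0]) auto

lemma reaches_trans:
  assumes "reaches P s t s'" "reaches P s' t' s''" "t + t' \<le> u"
  shows "reaches P s u s''"
proof -
  obtain k k' where "k \<le> t" "s' = (ram_step P ^^ k) s" "k' \<le> t'" "s'' = (ram_step P ^^ k') s'"
    using assms(1,2) unfolding reaches_def by auto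
  then have "s'' = (ram_step P ^^ (k' + k)) s" "k' + k \<le> u" using assms(3) by (auto simp: funpow_add)
  then show ?thesis unfolding reaches_def by blast
qed

lemma reaches_step: "ram_step P s = s' \<Longrightarrow> reaches P s 1 s'"
  unfolding reaches_def by (rule exI[of _ 1]) auto

lemma ram_step_effect:
  assumes "\<not> is_jump i" "a < length P" "P ! a = i"
  shows "ram_step P (config a s) = config (Suc a) (effect i s)"
  using assms by (cases i; cases s) (auto simp: ram_step_def halted_def config_def)

text \<open>The cost in \<open>exec\<close> is only an upper bound for the machine steps: every
  conditional is charged for the test and a closing jump, although the branch for zero is placed
  last and ends without a jump.\<close>

lemma compile_correct:
  assumes "exec c s t h s'" "jump_free c" "code_at P a (compile e a c)"
  shows "reaches P (config a s) t (config (if h then e else a + code_length c) s')"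
  using assms
proof (induction arbitrary: a rule: exec.induct)
  case (exec_Skip s)
  then show ?case by (simp add: reaches_refl)
next
  case (exec_Abort s)
  then show ?case
    by (intro reaches_step) (auto simp: ram_step_def halted_def config_def)
next
  case (exec_Ins i s)
  then show ?case
    using ram_step_effect[of i a P s] by (intro reaches_step) auto
next
  case (exec_Seq c s t s' d t' h s'')
  then have "reaches P (config a s) t (config (a + code_length c) s')"
    and "reaches P (config (a + code_length c) s') t'
      (config (if h then e else a + code_length c + code_length d) s'')"
    by auto
  then have "reaches P (config a s) (t + t')
      (config (if h then e else a + code_length c + code_length d) s'')"
    by (rule reaches_trans) simp
  then show ?case by (simp only: code_length.simps add.assoc)
next
  case (exec_Seq_abort c s t s' d)
  then show ?case by auto
next
  case (exec_IfZ_true s r c t h s' d)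
  have C: "a < length P" "P ! a = JumpZero r (a + code_length d + 2)"
      "code_at P (a + code_length d + 2) (compile e (a + code_length d + 2) c)"
    using exec_IfZ_true.prems(2) by (auto simp: algebra_simps)
  have "reaches P (config a s) 1 (config (a + code_length d + 2) s)"
    using C exec_IfZ_true.hyps(1)
    by (intro reaches_step) (auto simp: ram_step_def halted_def config_def)
  moreover have "reaches P (config (a + code_length d + 2) s) t
      (config (if h then e else a + code_length d + 2 + code_length c) s')"
    by (rule exec_IfZ_true.IH[OF _ C(3)]) (use exec_IfZ_true.prems(1) in simp)
  ultimately have "reaches P (config a s) (t + 2)
      (config (if h then e else a + code_length d + 2 + code_length c) s')"
    by (rule reaches_trans) simp
  then show ?case by (cases h) (simp_all add: algebra_simps)
next
  case (exec_IfZ_false s r d t h s' c)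
  let ?b = "a + 1 + code_length d"
  have C: "a < length P" "P ! a = JumpZero r (a + code_length d + 2)"
      "code_at P (a + 1) (compile e (a + 1) d)"
      "?b < length P" "P ! ?b = Jump (a + code_length d + code_length c + 2)"
    using exec_IfZ_false.prems(2) by (auto simp: algebra_simps)
  have 1: "reaches P (config a s) 1 (config (a + 1) s)"
    using C exec_IfZ_false.hyps(1)
    by (intro reaches_step) (auto simp: ram_step_def halted_def config_def)
  have 2: "reaches P (config (a + 1) s) t (config (if h then e else ?b) s')"
    by (rule exec_IfZ_false.IH[OF _ C(3)]) (use exec_IfZ_false.prems(1) in simp)
  have 3: "reaches P (config ?b s') 1 (config (a + code_length d + code_length c + 2) s')"
    using C(4,5) by (intro reaches_step) (auto simp: ram_step_def halted_def config_def)
  have 12: "reaches P (config a s) (t + 1) (config (if h then e else ?b) s')"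
    by (rule reaches_trans[OF 1 2]) simp
  show ?case
  proof (cases h)
    case True
    then show ?thesis using reaches_trans[OF 12 reaches_refl, of 0 "t + 2"] by simp
  next
    case False
    then have "reaches P (config a s) (t + 1) (config ?b s')" using 12 by simp
    from reaches_trans[OF this 3, of "t + 2"] False show ?thesis by (simp add: algebra_simps)
  qed
next
  case (exec_While_end s r c)
  then show ?case
    by (intro reaches_step) (auto simp: ram_step_def halted_def config_def)
next
  case (exec_While_step s r c t s' t' h s'')
  let ?b = "a + 1 + code_length c"
  have C: "a < length P" "P ! a = JumpZero r (a + code_length c + 2)"
      "code_at P (a + 1) (compile e (a + 1) c)" "?b < length P" "P ! ?b = Jump a"
    using exec_While_step.prems(2) by (auto simp: algebra_simps)
  have 1: "reaches P (config a s) 1 (config (a + 1) s)"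
    using C exec_While_step.hyps(1)
    by (intro reaches_step) (auto simp: ram_step_def halted_def config_def)
  have 2: "reaches P (config (a + 1) s) t (config ?b s')"
    using exec_While_step.IH(1)[OF _ C(3)] exec_While_step.prems(1) by simp
  have 3: "reaches P (config ?b s') 1 (config a s')"
    using C(4,5) by (intro reaches_step) (auto simp: ram_step_def halted_def config_def)
  have 4: "reaches P (config a s') t' (config (if h then e else a + code_length (While r c)) s'')"
    using exec_While_step.IH(2) exec_While_step.prems by blast
  have 12: "reaches P (config a s) (t + 1) (config ?b s')"
    by (rule reaches_trans[OF 1 2]) simp
  have "reaches P (config a s) (t + 2) (config a s')"
    by (rule reaches_trans[OF 12 3]) simp
  from this 4 show ?case by (rule reaches_trans) simp
next
  case (exec_While_abort s r c t s')
  have C: "a < length P" "P ! a = JumpZero r (a + code_length c + 2)"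
      "code_at P (a + 1) (compile e (a + 1) c)"
    using exec_While_abort.prems(2) by (auto simp: algebra_simps)
  have 1: "reaches P (config a s) 1 (config (a + 1) s)"
    using C exec_While_abort.hyps(1)
    by (intro reaches_step) (auto simp: ram_step_def halted_def config_def)
  have 2: "reaches P (config (a + 1) s) t (config e s')"
    using exec_While_abort.IH[OF _ C(3)] exec_While_abort.prems(1) by simp
  show ?case using reaches_trans[OF 1 2, of "t + 1"] by simp
qed

definition program :: "com \<Rightarrow> ram_program" where
  "program c = compile (code_length c) 0 c"

lemma program_correct:
  assumes "exec c ((\<lambda>_. 0), (\<lambda>a. if a < length xs then xs ! a else 0)) t h (r, m)" "jump_free c"
  obtains s where "halts_within (program c) xs t s" "regs s = r" "mem s = m"
proof -
  have "code_at (program c) 0 (compile (code_length c) 0 c)"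
    using code_at_suffix[of "[]"] by (simp add: program_def)
  from compile_correct[OF assms this]
  have "reaches (program c) (initial_config xs) t (config (code_length c) (r, m))"
    by (cases h) (simp_all add: config_def initial_config_def)
  then have "halts_within (program c) xs t (config (code_length c) (r, m))"
    unfolding reaches_def halts_within_def
    by (auto simp: halted_def program_def config_def)
  then show ?thesis using that by (simp add: config_def)
qed

subsection \<open>Total correctness with a running clock\<close>

text \<open>
  The postcondition \<open>Q\<close> also receives an upper bound for the time at which it is reached when the
  command starts at time \<open>t\<close>; \<open>A\<close> is required at an abort.
\<close>

definition wp ::
    "(store \<Rightarrow> nat \<Rightarrow> bool) \<Rightarrow> com \<Rightarrow> store \<Rightarrow> nat \<Rightarrow> (store \<Rightarrow> nat \<Rightarrow> bool) \<Rightarrow> bool" where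
  "wp A c s t Q \<longleftrightarrow> (\<exists>k h s'. exec c s k h s' \<and> ((h \<longrightarrow> A s' (t + k)) \<and> (\<not> h \<longrightarrow> Q s' (t + k))))"

lemma wpI: "exec c s k h s' \<Longrightarrow> ((h \<longrightarrow> A s' (t + k)) \<and> (\<not> h \<longrightarrow> Q s' (t + k))) \<Longrightarrow> wp A c s t Q"
  unfolding wp_def by blast

lemma wp_Skip [simp]: "wp A Skip s t Q \<longleftrightarrow> Q s t"
proof
  show "wp A Skip s t Q \<Longrightarrow> Q s t" unfolding wp_def by (auto elim!: exec_SkipE)
  show "Q s t \<Longrightarrow> wp A Skip s t Q" by (rule wpI[OF exec_Skip]) simp
qed

lemma wp_Abort [simp]: "wp A Abort s t Q \<longleftrightarrow> A s (t + 1)"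
proof
  show "wp A Abort s t Q \<Longrightarrow> A s (t + 1)" unfolding wp_def by (auto elim!: exec_AbortE)
  show "A s (t + 1) \<Longrightarrow> wp A Abort s t Q" by (rule wpI[OF exec_Abort]) simp
qed

lemma wp_Ins [simp]: "wp A (Ins i) s t Q \<longleftrightarrow> Q (effect i s) (t + 1)"
proof
  show "wp A (Ins i) s t Q \<Longrightarrow> Q (effect i s) (t + 1)" unfolding wp_def by (auto elim!: exec_InsE)
  show "Q (effect i s) (t + 1) \<Longrightarrow> wp A (Ins i) s t Q" by (rule wpI[OF exec_Ins]) simp
qed

lemma wp_Seq [simp]: "wp A (c ;; d) s t Q \<longleftrightarrow> wp A c s t (\<lambda>s t. wp A d s t Q)"
proof
  assume "wp A (c ;; d) s t Q"
  then obtain k h s' where e: "exec (c ;; d) s k h s'" and q: "(h \<longrightarrow> A s' (t + k)) \<and> (\<not> h \<longrightarrow> Q s' (t + k))"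
    unfolding wp_def by blast
  from e consider k1 s1 k2 where "exec c s k1 False s1" "exec d s1 k2 h s'" "k = k1 + k2"
    | "exec c s k True s'" h by (auto elim: exec_SeqE)
  then show "wp A c s t (\<lambda>s t. wp A d s t Q)"
  proof cases
    case 1
    have "wp A d s1 (t + k1) Q" using q 1(3) by (intro wpI[OF 1(2)]) (simp add: add.assoc)
    then show ?thesis by (intro wpI[OF 1(1)]) simp
  next
    case 2
    then show ?thesis using q by (intro wpI[OF 2(1)]) simp
  qed
next
  assume "wp A c s t (\<lambda>s t. wp A d s t Q)"
  then obtain k h s' where e: "exec c s k h s'"
    and q: "(h \<longrightarrow> A s' (t + k)) \<and> (\<not> h \<longrightarrow> wp A d s' (t + k) Q)" unfolding wp_def[of A c] by blast
  show "wp A (c ;; d) s t Q"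
  proof (cases h)
    case True
    with e q show ?thesis by (intro wpI[OF exec_Seq_abort]) simp_all
  next
    case False
    then obtain k' h' s'' where "exec d s' k' h' s''"
      "(h' \<longrightarrow> A s'' (t + k + k')) \<and> (\<not> h' \<longrightarrow> Q s'' (t + k + k'))" using q unfolding wp_def by auto
    with e False show ?thesis by (intro wpI[OF exec_Seq]) (simp_all add: add.assoc)
  qed
qed

lemma wp_IfZ [simp]:
  "wp A (IfZ r c d) s t Q \<longleftrightarrow> (if fst s r = 0 then wp A c s (t + 2) Q else wp A d s (t + 2) Q)"
proof
  assume "wp A (IfZ r c d) s t Q"
  then obtain k h s' where e: "exec (IfZ r c d) s k h s'" and q: "(h \<longrightarrow> A s' (t + k)) \<and> (\<not> h \<longrightarrow> Q s' (t + k))"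
    unfolding wp_def by blast
  from e obtain k' where k: "k = k' + 2" and e': "exec (if fst s r = 0 then c else d) s k' h s'"
    by (auto elim: exec_IfZE)
  have "wp A (if fst s r = 0 then c else d) s (t + 2) Q"
    using q k by (intro wpI[OF e']) (simp add: ac_simps)
  then show "if fst s r = 0 then wp A c s (t + 2) Q else wp A d s (t + 2) Q"
    by (simp split: if_splits)
next
  assume "if fst s r = 0 then wp A c s (t + 2) Q else wp A d s (t + 2) Q"
  then obtain k h s' where "exec (if fst s r = 0 then c else d) s k h s'"
    and q: "(h \<longrightarrow> A s' (t + 2 + k)) \<and> (\<not> h \<longrightarrow> Q s' (t + 2 + k))"
    unfolding wp_def by (auto split: if_splits)
  then have "exec (IfZ r c d) s (k + 2) h s'"
    using exec_IfZ_true exec_IfZ_false by (auto split: if_splits)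
  then show "wp A (IfZ r c d) s t Q"
  proof (rule wpI)
    show "(h \<longrightarrow> A s' (t + (k + 2))) \<and> (\<not> h \<longrightarrow> Q s' (t + (k + 2)))" using q by (simp add: ac_simps)
  qed
qed

lemma wp_mono:
  assumes "wp A c s t Q" "\<And>s' t'. Q s' t' \<Longrightarrow> Q' s' t'"
  shows "wp A c s t Q'"
  using assms unfolding wp_def by meson

text \<open>The invariant may mention the clock, so that amortised time bounds are ordinary
  invariants. Closure of \<open>A\<close> under earlier times bridges the charge for an aborting
  iteration, one step for the test, and the two steps with which every body is started.\<close>

lemma wp_While:
  fixes \<mu> :: "store \<Rightarrow> nat"
  assumes "I s t"
    and step: "\<And>s t. I s t \<Longrightarrow> fst s r \<noteq> 0 \<Longrightarrow> wp A c s (t + 2) (\<lambda>s' t'. I s' t' \<and> \<mu> s' < \<mu> s)"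
    and fin: "\<And>s t. I s t \<Longrightarrow> fst s r = 0 \<Longrightarrow> Q s (t + 1)"
    and abt: "\<And>s t t'. A s t \<Longrightarrow> t' \<le> t \<Longrightarrow> A s t'"
  shows "wp A (While r c) s t Q"
  using assms(1)
proof (induction "\<mu> s" arbitrary: s t rule: less_induct)
  case less
  show ?case
  proof (cases "fst s r = 0")
    case True
    show ?thesis by (rule wpI[OF exec_While_end[OF True]]) (simp add: fin[OF less.prems True] del: One_nat_def)
  next
    case False
    from step[OF less.prems False] obtain k h s' where e: "exec c s k h s'"
      and q: "(h \<longrightarrow> A s' (t + 2 + k)) \<and> (\<not> h \<longrightarrow> I s' (t + 2 + k) \<and> \<mu> s' < \<mu> s)"
      unfolding wp_def by blast
    show ?thesis
    proof (cases h)
      case True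
      then have "exec (While r c) s (k + 1) True s'" using e False True by (intro exec_While_abort) simp_all
      moreover have "A s' (t + (k + 1))" using q True abt[of s' "t + 2 + k" "t + (k + 1)"] by simp
      ultimately show ?thesis using wpI[of "While r c" s "k + 1" True s' A t Q] by simp
    next
      case h: False
      then have "wp A (While r c) s' (t + 2 + k) Q" using less.hyps q by auto
      then obtain k' h' s'' where e': "exec (While r c) s' k' h' s''"
        and q': "(h' \<longrightarrow> A s'' (t + 2 + k + k')) \<and> (\<not> h' \<longrightarrow> Q s'' (t + 2 + k + k'))"
        unfolding wp_def by blast
      have "exec (While r c) s (k + k' + 2) h' s''"
        using exec_While_step[of s r c k s' k' h' s''] False e e' h by simp
      moreover have "t + (k + k' + 2) = t + 2 + k + k'" by simp
      ultimately show ?thesis using q' by (intro wpI[where k = "k + k' + 2"]) (simp_all only:)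
    qed
  qed
qed

section \<open>Vectors and solutions\<close>

abbreviation bits :: "vec \<Rightarrow> nat \<Rightarrow> bool" where
  "bits x \<equiv> \<lambda>v. x v = 1"

abbreviation preimage :: "(nat \<Rightarrow> nat) \<Rightarrow> nat \<Rightarrow> nat" where
  "preimage \<gamma> \<equiv> \<lambda>j. inv \<gamma> (Suc j)"

lemma preimage_range: "\<gamma> permutes {1..n} \<Longrightarrow> j < n \<Longrightarrow> preimage \<gamma> j \<in> {1..n}"
  using permutes_in_image[OF permutes_inv, of \<gamma> "{1..n}" "Suc j"] by auto

lemma inj_preimage: "\<gamma> permutes {1..n} \<Longrightarrow> inj_on (preimage \<gamma>) A"
  by (metis (no_types, lifting) inj_onI nat.inject permutes_inverses(1))

lemma binary_cube_value: "x \<in> binary_cube n \<Longrightarrow> i \<in> {1..n} \<Longrightarrow> x i = 0 \<or> x i = 1"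
  unfolding binary_cube_def by auto

text \<open>Coordinate \<open>Suc j\<close> is position \<open>j\<close>. Extensionality confines
  the first difference to \<open>{1..n}\<close>, and for values 0 and 1 a strict increase is a
  change from unset to set bit.\<close>

lemma X_perm_iff:
  assumes x: "x \<in> binary_cube n" and \<gamma>: "\<gamma> permutes {1..n}"
  shows "x \<in> X_perm n \<gamma> \<longleftrightarrow> lex_sol n Suc (preimage \<gamma>) (bits x)"
proof -
  let ?y = "perm_act n \<gamma> x"
  have y: "?y (Suc j) = x (preimage \<gamma> j)" if "j < n" for j
    using that by (simp add: perm_act_def)
  have out: "?y k = x k" if "k \<notin> {1..n}" for k
  proof -
    have "x k = undefined" using PiE_arb[OF x[unfolded binary_cube_def] that] .
    then show ?thesis using that unfolding perm_act_def by (subst restrict_apply) auto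
  qed
  have v: "x (Suc j) = 0 \<or> x (Suc j) = 1" "?y (Suc j) = 0 \<or> ?y (Suc j) = 1" if "j < n" for j
    using binary_cube_value[OF x] preimage_range[OF \<gamma> that] y[OF that] that by auto
  have "less_fun x ?y \<longleftrightarrow> \<not> lex_sol n Suc (preimage \<gamma>) (bits x)"
  proof
    assume "less_fun x ?y"
    then obtain k where k: "x k < ?y k" "\<And>i. i < k \<Longrightarrow> x i = ?y i" by (rule less_funE) blast
    then have "k \<in> {1..n}" using out[of k] by (metis less_irrefl)
    then obtain j where j: "k = Suc j" "j < n" by (cases k) auto
    have "bits x (preimage \<gamma> j)" "\<not> bits x (Suc j)" using v[OF j(2)] k(1) y[OF j(2)] j(1) by auto
    moreover have "\<forall>i<j. bits x (Suc i) = bits x (preimage \<gamma> i)" using k(2) y j by auto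
    ultimately show "\<not> lex_sol n Suc (preimage \<gamma>) (bits x)" using j(2) unfolding lex_sol_def by blast
  next
    assume "\<not> lex_sol n Suc (preimage \<gamma>) (bits x)"
    then obtain j where j: "j < n" "\<forall>i<j. bits x (Suc i) = bits x (preimage \<gamma> i)"
      "bits x (preimage \<gamma> j)" "\<not> bits x (Suc j)" unfolding lex_sol_def by blast
    have "x (Suc j) < ?y (Suc j)" using v[OF j(1)] j y by auto
    moreover have "x k = ?y k" if "k < Suc j" for k
    proof (cases k)
      \<comment> \<open>\<open>less_fun\<close> also inspects coordinate \<open>0\<close>, which
        precedes all positions; the two vectors agree there because it lies outside
        \<open>{1..n}\<close>.\<close>
      case 0
      then show ?thesis using out by auto
    next
      case (Suc i)
      then have "i < j" "i < n" using that j(1) by auto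
      then show ?thesis using v[of i] j(2) y[of i] Suc by auto
    qed
    ultimately show "less_fun x ?y" by (intro less_funI) blast
  qed
  then show ?thesis using x by (simp add: X_perm_def lex_ge_def)
qed

lemma face_iff:
  assumes "x \<in> binary_cube n" "Z \<subseteq> {1..n}"
  shows "x \<in> face n Z W \<longleftrightarrow> extends Z W (bits x)"
  using assms binary_cube_value[OF assms(1)] unfolding face_def extends_def by fastforce

lemma face_subset: "face n Z W \<subseteq> binary_cube n"
  by (auto simp: face_def)

lemma X_perm_face_iff:
  assumes "\<gamma> permutes {1..n}" "Z \<subseteq> {1..n}"
  shows "x \<in> X_perm n \<gamma> \<inter> face n Z W \<longleftrightarrow>
    x \<in> binary_cube n \<and> lex_sol n Suc (preimage \<gamma>) (bits x) \<and> extends Z W (bits x)"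
  using X_perm_iff[OF _ assms(1)] face_iff[OF _ assms(2)] face_subset by blast

text \<open>Propagation argues with arbitrary Boolean functions; restricting one to
  \<open>{1..n}\<close> changes no compared value, as \<open>Suc j\<close> and
  \<open>preimage \<gamma> j\<close> stay in this range for \<open>j < n\<close>.\<close>

lemma ex_vector:
  assumes \<gamma>: "\<gamma> permutes {1..n}" and "Z \<subseteq> {1..n}" "W \<subseteq> {1..n}"
    and x: "lex_sol n Suc (preimage \<gamma>) x" "extends Z W x"
  obtains y where "y \<in> X_perm n \<gamma> \<inter> face n Z W" "\<And>v. v \<in> {1..n} \<Longrightarrow> bits y v = x v"
proof
  define y :: vec where "y = (\<lambda>v\<in>{1..n}. if x v then 1 else 0)"
  show b: "bits y v = x v" if "v \<in> {1..n}" for v using that by (simp add: y_def)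
  have "y \<in> binary_cube n" by (simp add: y_def binary_cube_def)
  moreover have "lex_sol n Suc (preimage \<gamma>) (bits y)" unfolding lex_sol_def
  proof (intro allI impI)
    fix j assume j: "j < n" "\<forall>i<j. bits y (Suc i) = bits y (preimage \<gamma> i)" "bits y (preimage \<gamma> j)"
    have e: "bits y (Suc i) = x (Suc i)" "bits y (preimage \<gamma> i) = x (preimage \<gamma> i)" if "i \<le> j" for i
      using that j(1) b preimage_range[OF \<gamma>, of i] by auto
    have "\<forall>i<j. x (Suc i) = x (preimage \<gamma> i)" using j(2) e by (metis less_imp_le)
    then have "x (Suc j)" using x(1) j(1,3) e(2)[of j] unfolding lex_sol_def by blast
    then show "bits y (Suc j)" using e(1)[of j] by simp
  qed
  moreover have "extends Z W (bits y)" using x(2) b assms(2,3) unfolding extends_def by blast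
  ultimately show "y \<in> X_perm n \<gamma> \<inter> face n Z W" using X_perm_face_iff[OF \<gamma> assms(2)] by blast
qed

lemma valid_fixing_one:
  assumes "\<gamma> permutes {1..n}" "Z \<subseteq> {1..n}" "v \<in> {1..n}"
    and "\<And>x. lex_sol n Suc (preimage \<gamma>) x \<Longrightarrow> extends Z W x \<Longrightarrow> x v"
  shows "valid_fixing n \<gamma> Z W (v, 1)"
  using assms X_perm_face_iff[OF assms(1,2)] by (auto simp: valid_fixing_def fixings_def)

lemma valid_fixing_zero:
  assumes "\<gamma> permutes {1..n}" "Z \<subseteq> {1..n}" "v \<in> {1..n}"
    and "\<And>x. lex_sol n Suc (preimage \<gamma>) x \<Longrightarrow> extends Z W x \<Longrightarrow> \<not> x v"
  shows "valid_fixing n \<gamma> Z W (v, 0)"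
proof -
  have "x v = 0" if "x \<in> X_perm n \<gamma> \<inter> face n Z W" for x
    using that assms(4)[of "bits x"] X_perm_face_iff[OF assms(1,2)] binary_cube_value[of x n v] assms(3)
    by blast
  then show ?thesis using assms(3) by (auto simp: valid_fixing_def fixings_def)
qed

lemma propagation_complete:
  assumes \<gamma>: "\<gamma> permutes {1..n}" and ZW: "Z \<subseteq> {1..n}" "W \<subseteq> {1..n}" "Z \<inter> W = {}"
    and "p \<le> n" and eq: "\<forall>i<p. eq_at Suc (preimage \<gamma>) Z W i"
    and stop: "p < n \<Longrightarrow> stop_at Suc (preimage \<gamma>) Z W p"
    and low: "p < n \<Longrightarrow> Suc p \<notin> W \<Longrightarrow>
      \<exists>x. lex_sol n Suc (preimage \<gamma>) x \<and> extends Z W x \<and> \<not> x (Suc p)"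
    and high: "p < n \<Longrightarrow> preimage \<gamma> p \<notin> Z \<Longrightarrow>
      \<exists>x. lex_sol n Suc (preimage \<gamma>) x \<and> extends Z W x \<and> x (preimage \<gamma> p)"
  shows "X_perm n \<gamma> \<inter> face n Z W \<noteq> {}" "complete_fixings n \<gamma> Z W"
proof -
  let ?g = "preimage \<gamma>"
  have sol: "lex_sol n Suc ?g x"
    if "extends Z W x" "p < n \<Longrightarrow> x (Suc p) \<and> \<not> x (?g p)" for x
    using that eq \<open>p \<le> n\<close> by (intro lex_sol_eq)
  define x0 where "x0 u \<longleftrightarrow> u \<in> W \<or> p < n \<and> u = Suc p" for u
  have "extends Z W x0" using ZW stop unfolding x0_def extends_def stop_at_def by blast
  moreover then have "lex_sol n Suc ?g x0"
    using stop by (intro sol) (auto simp: x0_def stop_at_def)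
  ultimately show "X_perm n \<gamma> \<inter> face n Z W \<noteq> {}" using ex_vector[OF \<gamma> ZW(1,2), of x0] by blast
  have ex: "\<exists>x. lex_sol n Suc ?g x \<and> extends Z W x \<and> x v = b"
    if v: "v \<notin> Z \<union> W" for v b
  proof -
    \<comment> \<open>A solution that is strict at \<open>p\<close>, with \<open>v\<close> raised on
      demand. It fails only if \<open>v\<close> is one of the two compared variables and
      \<open>b\<close> is the wrong value for it; these are the cases left to \<open>low\<close> and
      \<open>high\<close>.\<close>
    define x where "x u \<longleftrightarrow> u \<in> W \<or> p < n \<and> u = Suc p \<or> u = v \<and> b" for u
    have e: "extends Z W x" using ZW v stop unfolding x_def extends_def stop_at_def by blast
    consider "p < n" "v = Suc p" "\<not> b" | "p < n" "v = ?g p" b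
      | "p < n \<longrightarrow> (v = Suc p \<longrightarrow> b) \<and> (v = ?g p \<longrightarrow> \<not> b)" by blast
    then show ?thesis
    proof cases
      case 1
      then show ?thesis using low v by auto
    next
      case 2
      then show ?thesis using high v by auto
    next
      case 3
      have "lex_sol n Suc ?g x"
        using stop 3 by (intro sol[OF e]) (auto simp: x_def stop_at_def)
      moreover have "x v = b" using v 3 by (auto simp: x_def)
      ultimately show ?thesis using e by blast
    qed
  qed
  show "complete_fixings n \<gamma> Z W" unfolding complete_fixings_def
  proof (intro notI, elim exE conjE)
    fix i b assume i: "i \<notin> Z \<union> W" and V: "valid_fixing n \<gamma> Z W (i, b)"
    \<comment> \<open>The value at \<open>i\<close> is chosen opposite to the claimed
      \<open>b\<close>.\<close>
    obtain x where x: "lex_sol n Suc ?g x" "extends Z W x" "x i = (b \<noteq> 1)" using ex[OF i] by blast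
    obtain y where y: "y \<in> X_perm n \<gamma> \<inter> face n Z W" "\<And>v. v \<in> {1..n} \<Longrightarrow> bits y v = x v"
      using ex_vector[OF \<gamma> ZW(1,2) x(1,2)] by blast
    have "y i = b" "i \<in> {1..n}" using V y(1) by (auto simp: valid_fixing_def fixings_def)
    then show False using y(2)[of i] x(3) by auto
  qed
qed

text \<open>A fixing valid for one member of \<open>\<Gamma>\<close> removes no point of
  \<open>X_set n \<Gamma>\<close>. This also carries emptiness discovered after some fixings back to
  the initial sets, which justifies an abort.\<close>

lemma fixing_step_X_set:
  assumes "(fixing_step n \<Gamma>)\<^sup>*\<^sup>* I J"
  shows "X_set n \<Gamma> \<inter> face n (fst J) (snd J) = X_set n \<Gamma> \<inter> face n (fst I) (snd I)"
    and "fst I \<subseteq> fst J" "snd I \<subseteq> snd J"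
  using assms
proof (induction rule: rtranclp_induct)
  case (step J K)
  from step.hyps(2) obtain \<gamma> i b where \<gamma>: "\<gamma> \<in> \<Gamma>"
    and V: "valid_fixing n \<gamma> (fst J) (snd J) (i, b)" and K: "K = apply_fixing (i, b) J"
    unfolding fixing_step_def by auto
  have b: "b = 0 \<or> b = 1" using V by (auto simp: valid_fixing_def fixings_def)
  have "x i = b" if "x \<in> X_set n \<Gamma> \<inter> face n (fst J) (snd J)" for x
    using that V \<gamma> by (auto simp: valid_fixing_def X_set_def)
  then have "X_set n \<Gamma> \<inter> face n (fst K) (snd K) = X_set n \<Gamma> \<inter> face n (fst J) (snd J)"
    using b unfolding K apply_fixing_def face_def by auto
  then show "X_set n \<Gamma> \<inter> face n (fst K) (snd K) = X_set n \<Gamma> \<inter> face n (fst I) (snd I)"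
    using step.IH(1) by simp
  show "fst I \<subseteq> fst K" "snd I \<subseteq> snd K" using step.IH(2,3) unfolding K apply_fixing_def by auto
qed auto

section \<open>The program\<close>

text \<open>
  Positions are counted from \<open>0\<close>, so that zeroed memory is a correct initial state; position \<open>j\<close>
  compares the variables \<open>Suc j\<close> and \<open>preimage \<gamma> j\<close>. Besides the input, the memory holds a queue of
  the variables fixed so far and, for every permutation, a block of \<open>4 * n + 3\<close> cells: the main
  position, the positions of the two lookaheads, and for each lookahead two arrays of marks for the
  variables that are tentatively \<open>0\<close> and \<open>1\<close>. A mark is \<open>Suc p\<close> for the main position \<open>p\<close> at
  which it was made, so that marks expire when \<open>p\<close> moves.

  Registers: 0 message (and constant 0), 1 \<open>n\<close>, 2 constant 1, 3 and 4 bases of the flags for fixed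
  zeros and ones, 5 base of the queue, 6 head and 7 tail of the queue, 8 current variable, 9 loop
  counter, 10 base of the current inverse permutation, 11 current block, 12 main position, 13
  lookahead position, 14 and 15 bases of the marks for tentative zeros and ones, 16 and 17 the
  variables compared, 18 loop condition, 19 failure of the lookahead, 20 and 21 scratch, 22 \<open>2 * n\<close>,
  23 size of a block, 24 and 25 the variables compared at the main position, 26 main loop condition,
  27 address of the lookahead position, 29 number of permutations, 30 and 31 initial values of 10 and
  11.
\<close>

definition fix_code :: "nat \<Rightarrow> nat \<Rightarrow> nat \<Rightarrow> com" where
  "fix_code x y i =
     Ins (Add 20 x i) ;; Ins (Load 20 20) ;;
     IfZ 20
       (Ins (Add 20 y i) ;; Ins (Load 21 20) ;;
        IfZ 21
          (Ins (Store 20 2) ;; Ins (Add 21 5 7) ;; Ins (Store 21 i) ;; Ins (Add 7 7 2))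
          Skip)
       Abort"

text \<open>Register 20 ends up nonzero iff the variable has the value, fixed or tentatively.
  Register 12 holds the main position \<open>p\<close>: a mark made at \<open>p\<close> is
  \<open>Suc p\<close> and survives the truncated subtraction, older marks are at most
  \<open>p\<close> and vanish.\<close>

definition flag_code :: "nat \<Rightarrow> nat \<Rightarrow> nat \<Rightarrow> com" where
  "flag_code x y v =
     Ins (Add 20 x v) ;; Ins (Load 20 20) ;; Ins (Add 21 y v) ;; Ins (Load 21 21) ;;
     Ins (Sub 21 21 12) ;; Ins (Add 20 20 21)"

text \<open>The sum of both truncated differences vanishes iff the compared variables coincide.
  Register 24 holds \<open>Suc p\<close>, which serves both as the first variable of the main
  position and as the mark to be written.\<close>

definition look_step :: com where
  "look_step =
     Ins (Add 16 13 2) ;; Ins (Add 17 10 13) ;; Ins (Load 17 17) ;;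
     Ins (Sub 20 16 17) ;; Ins (Sub 21 17 16) ;; Ins (Add 20 20 21) ;;
     IfZ 20
       (Ins (Add 13 13 2) ;; Ins (Sub 18 1 13))
       (flag_code 4 15 17 ;;
        IfZ 20
          (flag_code 3 14 16 ;;
           IfZ 20
             (Ins (Const 18 0))
             (Ins (Add 20 14 17) ;; Ins (Store 20 24) ;; Ins (Add 13 13 2) ;; Ins (Sub 18 1 13)))
          (flag_code 3 14 16 ;;
           IfZ 20
             (Ins (Add 20 15 16) ;; Ins (Store 20 24) ;; Ins (Add 13 13 2) ;; Ins (Sub 18 1 13))
             (Ins (Const 19 1) ;; Ins (Const 18 0))))"

definition conflict_code :: com where
  "conflict_code =
     Ins (Add 20 14 8) ;; Ins (Load 20 20) ;; Ins (Sub 20 20 12) ;;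
     IfZ 20 Skip
       (Ins (Add 20 4 8) ;; Ins (Load 20 20) ;; IfZ 20 Skip (Ins (Const 19 1))) ;;
     Ins (Add 20 15 8) ;; Ins (Load 20 20) ;; Ins (Sub 20 20 12) ;;
     IfZ 20 Skip
       (Ins (Add 20 3 8) ;; Ins (Load 20 20) ;; IfZ 20 Skip (Ins (Const 19 1)))"

definition look_code :: com where
  "look_code = Ins (Sub 18 1 13) ;; While 18 look_step ;; Ins (Store 27 13)"

definition side_init :: "bool \<Rightarrow> com" where
  "side_init s =
     Ins (Const 19 0) ;; Ins (Const 14 2) ;; Ins (Add 14 14 11) ;;
     (if s then Skip else Ins (Add 14 14 22)) ;;
     Ins (Add 15 14 1) ;; Ins (Const 27 (if s then 1 else 2)) ;; Ins (Add 27 27 11) ;;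
     Ins (Load 13 27)"

text \<open>A lookahead position not beyond the main position shows that no lookahead has run from
  here: it is started with the two compared variables as its first marks. Otherwise it resumes where
  it was.\<close>

definition side_run :: "bool \<Rightarrow> com" where
  "side_run s =
     IfZ 19
       (Ins (Sub 20 13 12) ;;
        IfZ 20
          (Ins (Add 13 12 2) ;;
           Ins (Add 20 (if s then 14 else 15) 24) ;; Ins (Store 20 24) ;;
           Ins (Add 20 (if s then 14 else 15) 25) ;; Ins (Store 20 24))
          Skip ;;
        look_code)
       Skip"

text \<open>The lookahead from the hypothesis that both variables at the main position are \<open>0\<close> (if \<open>s\<close>)
  or \<open>1\<close> (otherwise).\<close>

definition side_code :: "bool \<Rightarrow> com" where
  "side_code s =
     side_init s ;; conflict_code ;; side_run s ;;
     IfZ 19 Skip (fix_code (if s then 3 else 4) (if s then 4 else 3) (if s then 24 else 25))"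

definition main_step :: com where
  "main_step =
     Ins (Add 16 12 2) ;; Ins (Add 17 10 12) ;; Ins (Load 17 17) ;;
     Ins (Sub 20 16 17) ;; Ins (Sub 21 17 16) ;; Ins (Add 20 20 21) ;;
     IfZ 20
       (Ins (Add 12 12 2) ;; Ins (Sub 18 1 12))
       (Ins (Add 20 4 17) ;; Ins (Load 20 20) ;;
        IfZ 20
          (Ins (Add 20 3 16) ;; Ins (Load 20 20) ;;
           IfZ 20
             (Ins (Const 18 0))
             (fix_code 4 3 17 ;; Ins (Add 12 12 2) ;; Ins (Sub 18 1 12)))
          (fix_code 3 4 16 ;; Ins (Add 12 12 2) ;; Ins (Sub 18 1 12)))"

definition sides_code :: com where
  "sides_code =
     IfZ 20 Skip
       (Ins (Add 24 12 2) ;; Ins (Add 25 10 12) ;; Ins (Load 25 25) ;;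
        side_code True ;; side_code False)"

definition process_code :: com where
  "process_code =
     Ins (Load 12 11) ;; Ins (Sub 18 1 12) ;; While 18 main_step ;; Ins (Store 11 12) ;;
     Ins (Sub 20 1 12) ;; sides_code"

definition sweep_code :: com where
  "sweep_code =
     Ins (Add 9 29 0) ;; Ins (Add 10 30 0) ;; Ins (Add 11 31 0) ;;
     While 9
       (process_code ;; Ins (Add 10 10 22) ;; Ins (Add 11 11 23) ;; Ins (Sub 9 9 2))"

text \<open>For lack of multiplication the queue address is obtained by adding \<open>2 * n\<close>
  once per permutation. The queue starts with the dummy entry \<open>1\<close>, a legal variable as
  \<open>n\<close> is positive, so that every permutation is processed at least once.\<close>

definition init_code :: com where
  "init_code =
     Ins (Load 1 0) ;; Ins (Const 2 1) ;; Ins (Load 29 2) ;; Ins (Const 3 1) ;;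
     Ins (Add 4 3 1) ;; Ins (Add 22 1 1) ;; Ins (Const 20 2) ;; Ins (Add 20 20 22) ;;
     Ins (Add 30 20 1) ;; Ins (Add 5 20 0) ;; Ins (Add 9 29 0) ;;
     While 9 (Ins (Add 5 5 22) ;; Ins (Sub 9 9 2)) ;;
     Ins (Add 31 5 1) ;; Ins (Add 31 31 2) ;; Ins (Add 23 22 22) ;; Ins (Const 20 3) ;;
     Ins (Add 23 23 20) ;; Ins (Store 5 2) ;; Ins (Const 6 0) ;; Ins (Const 7 1)"

definition propagation_code :: com where
  "propagation_code =
     init_code ;; Ins (Const 26 1) ;;
     While 26
       (Ins (Add 20 5 6) ;; Ins (Load 8 20) ;; Ins (Add 6 6 2) ;; sweep_code ;;
        Ins (Sub 26 7 6)) ;;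
     Ins (Const 0 1)"

lemma jump_free_propagation_code: "jump_free propagation_code"
  by (simp add: propagation_code_def init_code_def sweep_code_def process_code_def sides_code_def main_step_def
      side_code_def side_init_def side_run_def look_code_def conflict_code_def look_step_def flag_code_def fix_code_def)

section \<open>Correctness of the program\<close>

definition zeros :: "nat \<Rightarrow> (nat \<Rightarrow> nat) \<Rightarrow> nat set" where
  "zeros n M = {v \<in> {1..n}. M (1 + v) \<noteq> 0}"

definition ones :: "nat \<Rightarrow> (nat \<Rightarrow> nat) \<Rightarrow> nat set" where
  "ones n M = {v \<in> {1..n}. M (1 + n + v) \<noteq> 0}"

definition marked :: "nat \<Rightarrow> (nat \<Rightarrow> nat) \<Rightarrow> nat \<Rightarrow> nat \<Rightarrow> nat set" where
  "marked n M b p = {v \<in> {1..n}. p < M (b + v)}"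

definition pending :: "nat \<Rightarrow> (nat \<Rightarrow> nat) \<Rightarrow> nat \<Rightarrow> nat \<Rightarrow> nat set" where
  "pending E M h \<tau> = (\<lambda>j. M (E + j)) ` {h..<\<tau>}"

text \<open>\<open>E\<close> is the address of the queue and \<open>\<tau>\<close> the index of its first free cell.\<close>

definition fixed_state ::
    "nat \<Rightarrow> (nat \<Rightarrow> nat) set \<Rightarrow> nat set \<times> nat set \<Rightarrow> nat \<Rightarrow> nat \<Rightarrow> (nat \<Rightarrow> nat) \<Rightarrow> bool" where
  "fixed_state n \<Gamma> I E \<tau> M \<longleftrightarrow>
     zeros n M \<inter> ones n M = {} \<and>
     (\<forall>v\<in>{1..n}. M (1 + v) \<le> 1 \<and> M (1 + n + v) \<le> 1) \<and>
     \<tau> \<le> Suc (card (zeros n M \<union> ones n M)) \<and>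
     (\<forall>j<\<tau>. M (E + j) \<in> {1..n}) \<and>
     (fixing_step n \<Gamma>)\<^sup>*\<^sup>* I (zeros n M, ones n M)"

text \<open>The queue only grows at its end, and each newly fixed variable has an entry there,
  through which the lookaheads learn of it. The last conjunct makes an unchanged tail a certificate
  that nothing was fixed; the final completeness rests on it.\<close>

definition advances ::
    "nat \<Rightarrow> nat \<Rightarrow> nat \<Rightarrow> (nat \<Rightarrow> nat) \<Rightarrow> nat \<Rightarrow> (nat \<Rightarrow> nat) \<Rightarrow> bool" where
  "advances n E \<tau> M \<tau>' M' \<longleftrightarrow>
     \<tau> \<le> \<tau>' \<and> (\<forall>j<\<tau>. M' (E + j) = M (E + j)) \<and>
     zeros n M \<subseteq> zeros n M' \<and> ones n M \<subseteq> ones n M' \<and>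
     (zeros n M' \<union> ones n M') - (zeros n M \<union> ones n M) \<subseteq> pending E M' \<tau> \<tau>' \<and>
     (\<tau>' = \<tau> \<longrightarrow> zeros n M' = zeros n M \<and> ones n M' = ones n M)"

definition same_except :: "nat set \<Rightarrow> (nat \<Rightarrow> nat) \<Rightarrow> (nat \<Rightarrow> nat) \<Rightarrow> bool" where
  "same_except S f f' \<longleftrightarrow> (\<forall>i. i \<notin> S \<longrightarrow> f' i = f i)"

text \<open>The flags and the queue. Its \<open>n + 1\<close> cells suffice for the dummy entry and
  one entry per variable.\<close>

definition shared_cells :: "nat \<Rightarrow> nat \<Rightarrow> nat set" where
  "shared_cells n E = {2..2 * n + 1} \<union> {E..E + n}"

definition base_regs :: "nat \<Rightarrow> nat \<Rightarrow> (nat \<Rightarrow> nat) \<Rightarrow> bool" where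
  "base_regs n E r \<longleftrightarrow> r 0 = 0 \<and> r 1 = n \<and> r 2 = 1 \<and> r 3 = 1 \<and> r 4 = Suc n \<and> r 5 = E \<and> r 22 = 2 * n"

definition infeasible ::
    "nat \<Rightarrow> (nat \<Rightarrow> nat) set \<Rightarrow> nat set \<times> nat set \<Rightarrow> nat \<Rightarrow> store \<Rightarrow> nat \<Rightarrow> bool" where
  "infeasible n \<Gamma> I T s t \<longleftrightarrow> fst s 0 = 0 \<and> t \<le> T \<and> X_set n \<Gamma> \<inter> face n (fst I) (snd I) = {}"

lemma zeros_cong: "(\<And>a. a \<le> 2 * n + 1 \<Longrightarrow> M' a = M a) \<Longrightarrow> zeros n M' = zeros n M"
  unfolding zeros_def by auto

lemma ones_cong: "(\<And>a. a \<le> 2 * n + 1 \<Longrightarrow> M' a = M a) \<Longrightarrow> ones n M' = ones n M"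
  unfolding ones_def by auto

lemma zeros_upd:
  "zeros n (M(1 + v := 1)) = (if v \<in> {1..n} then insert v (zeros n M) else zeros n M)"
  "v \<in> {1..n} \<Longrightarrow> zeros n (M(1 + n + v := x)) = zeros n M"
  unfolding zeros_def by auto

lemma ones_upd:
  "ones n (M(1 + n + v := 1)) = (if v \<in> {1..n} then insert v (ones n M) else ones n M)"
  "v \<in> {1..n} \<Longrightarrow> ones n (M(1 + v := x)) = ones n M"
  unfolding ones_def by auto

lemma zeros_ones_high:
  "2 * n + 1 < a \<Longrightarrow> zeros n (M(a := x)) = zeros n M"
  "2 * n + 1 < a \<Longrightarrow> ones n (M(a := x)) = ones n M"
  by (auto intro!: zeros_cong ones_cong)

lemma zeros_ones_subset: "zeros n M \<subseteq> {1..n}" "ones n M \<subseteq> {1..n}"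
  unfolding zeros_def ones_def by auto

lemma marked_upd:
  "v \<in> {1..n} \<Longrightarrow> p < x \<Longrightarrow> marked n (M(b + v := x)) b p = insert v (marked n M b p)"
  "a \<notin> {b + 1..b + n} \<Longrightarrow> marked n (M(a := x)) b p = marked n M b p"
  unfolding marked_def by auto

lemma marked_cong: "(\<And>a. a \<in> {b + 1..b + n} \<Longrightarrow> M' a = M a) \<Longrightarrow> marked n M' b p = marked n M b p"
  unfolding marked_def by auto

lemma fixed_state_tail:
  assumes "fixed_state n \<Gamma> I E \<tau> M"
  shows "\<tau> \<le> Suc n"
proof -
  have "card (zeros n M \<union> ones n M) \<le> card {1..n}" using zeros_ones_subset by (intro card_mono) auto
  then show ?thesis using assms unfolding fixed_state_def by simp
qed

lemma advances_refl: "advances n E \<tau> M \<tau> M"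
  unfolding advances_def by auto

lemma advances_trans:
  assumes "advances n E \<tau> M \<tau>' M'" "advances n E \<tau>' M' \<tau>'' M''"
  shows "advances n E \<tau> M \<tau>'' M''"
proof -
  note A = assms[unfolded advances_def]
  have 1: "\<tau> \<le> \<tau>'" "\<tau>' \<le> \<tau>''" and 2: "\<forall>j<\<tau>'. M'' (E + j) = M' (E + j)" using A by blast+
  have "pending E M' \<tau> \<tau>' = (\<lambda>j. M'' (E + j)) ` {\<tau>..<\<tau>'}"
    unfolding pending_def using 2 by (intro image_cong) auto
  then have 3: "pending E M'' \<tau> \<tau>'' = pending E M' \<tau> \<tau>' \<union> pending E M'' \<tau>' \<tau>''"
    unfolding pending_def by (simp add: image_Un[symmetric] ivl_disj_un_two(3) 1)
  show ?thesis unfolding advances_def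
  proof (intro conjI)
    show "\<tau> \<le> \<tau>''" using 1 by simp
    show "\<forall>j<\<tau>. M'' (E + j) = M (E + j)" using A 1 by simp
    show "zeros n M \<subseteq> zeros n M''" "ones n M \<subseteq> ones n M''" using A by blast+
    show "(zeros n M'' \<union> ones n M'') - (zeros n M \<union> ones n M) \<subseteq> pending E M'' \<tau> \<tau>''"
      unfolding 3 using A by blast
    show "\<tau>'' = \<tau> \<longrightarrow> zeros n M'' = zeros n M \<and> ones n M'' = ones n M"
      using A 1 by auto
  qed
qed

lemma advances_same:
  assumes "\<And>a. a \<le> 2 * n + 1 \<Longrightarrow> M' a = M a" "\<And>a. E \<le> a \<Longrightarrow> a < E + \<tau> \<Longrightarrow> M' a = M a"
  shows "advances n E \<tau> M \<tau> M'"
  using zeros_cong[OF assms(1)] ones_cong[OF assms(1)] assms(2) unfolding advances_def by simp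

lemma fixed_state_same:
  assumes "fixed_state n \<Gamma> I E \<tau> M"
    and "\<And>a. a \<le> 2 * n + 1 \<Longrightarrow> M' a = M a" "\<And>a. E \<le> a \<Longrightarrow> a < E + \<tau> \<Longrightarrow> M' a = M a"
  shows "fixed_state n \<Gamma> I E \<tau> M'"
  using assms zeros_cong[OF assms(2)] ones_cong[OF assms(2)] unfolding fixed_state_def by simp

lemma same_except_refl: "same_except S f f"
  unfolding same_except_def by simp

lemma same_except_trans:
  "same_except S f f' \<Longrightarrow> same_except S' f' f'' \<Longrightarrow> S \<subseteq> T \<Longrightarrow> S' \<subseteq> T \<Longrightarrow> same_except T f f''"
  unfolding same_except_def by (metis subsetD)

text \<open>If the opposite flag is set, the valid fixing demands a value that the face excludes;
  hence \<open>X_perm n \<gamma>\<close> has no point in the current face and the abort is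
  justified. A flag already set correctly leaves everything as it is.\<close>

lemma wp_fix:
  fixes s :: bool
  assumes K: "base_regs n E r" and G: "fixed_state n \<Gamma> I E (r 7) M" and E: "2 * n + 1 < E"
    and \<Gamma>: "\<gamma> \<in> \<Gamma>" and v: "r i = v" "v \<in> {1..n}" "i \<notin> {7, 20, 21}"
    and V: "valid_fixing n \<gamma> (zeros n M) (ones n M) (v, if s then 1 else 0)"
    and Q: "\<And>r' M' t'. same_except {7, 20, 21} r r' \<Longrightarrow> fixed_state n \<Gamma> I E (r' 7) M' \<Longrightarrow>
      advances n E (r 7) M (r' 7) M' \<Longrightarrow> same_except (shared_cells n E) M M' \<Longrightarrow>
      zeros n M' = (if s then zeros n M else insert v (zeros n M)) \<Longrightarrow>
      ones n M' = (if s then insert v (ones n M) else ones n M) \<Longrightarrow> t' \<le> t + 20 \<Longrightarrow> Q (r', M') t'"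
    and T: "t + 20 \<le> T"
  shows "wp (infeasible n \<Gamma> I T) (fix_code (if s then 3 else 4) (if s then 4 else 3) i) (r, M) t Q"
proof -
  let ?Z = "zeros n M" and ?W = "ones n M" and ?\<tau> = "r 7"
  let ?a = "if s then 1 + n + v else 1 + v" and ?c = "if s then 1 + v else 1 + n + v"
  have k: "r 0 = 0" "r 2 = 1" "r 3 = 1" "r 4 = Suc n" "r 5 = E" using K unfolding base_regs_def by auto
  have disj: "?Z \<inter> ?W = {}" and steps: "(fixing_step n \<Gamma>)\<^sup>*\<^sup>* I (?Z, ?W)"
    using G unfolding fixed_state_def by auto
  have bad: "infeasible n \<Gamma> I T (r', M) t'" if "M ?c \<noteq> 0" "r' 0 = 0" "t' \<le> t + 20" for r' t'
  proof -
    have "v \<in> (if s then ?Z else ?W)" using that(1) v(2) by (auto simp: zeros_def ones_def)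
    then have "X_perm n \<gamma> \<inter> face n ?Z ?W = {}"
      using V unfolding valid_fixing_def face_def by (fastforce split: if_splits)
    then have "X_set n \<Gamma> \<inter> face n ?Z ?W = {}" using \<Gamma> unfolding X_set_def by blast
    then show ?thesis using fixing_step_X_set(1)[OF steps] that(2,3) T by (simp add: infeasible_def)
  qed
  have old: "Q (r', M) t'"
    if "M ?a \<noteq> 0" "t' \<le> t + 20" "same_except {7, 20, 21} r r'" "r' 7 = ?\<tau>" for r' t'
  proof -
    have "v \<in> (if s then ?W else ?Z)" using that(1) v(2) by (auto simp: zeros_def ones_def)
    then show ?thesis
      using that G by (intro Q) (simp_all add: advances_refl same_except_refl insert_absorb split: if_splits)
  qed
  have new: "Q (r', M(?a := 1, E + ?\<tau> := v)) t'"
    if a: "M ?a = 0" "M ?c = 0" and "t' \<le> t + 20" "same_except {7, 20, 21} r r'" and r': "r' 7 = Suc ?\<tau>"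
    for r' t'
  proof -
    define N where "N = M(?a := 1, E + ?\<tau> := v)"
    have vn: "v \<notin> ?Z \<union> ?W" using a by (auto simp: zeros_def ones_def split: if_splits)
    have ZW: "zeros n N = (if s then ?Z else insert v ?Z)" "ones n N = (if s then insert v ?W else ?W)"
      using v(2) E unfolding N_def
      by (auto simp only: zeros_ones_high zeros_upd ones_upd if_True if_False split: if_splits)
    have q: "N (E + j) = (if j = ?\<tau> then v else M (E + j))" for j using v(2) E by (auto simp: N_def)
    have un: "zeros n N \<union> ones n N = insert v (?Z \<union> ?W)" unfolding ZW by auto
    have "finite (?Z \<union> ?W)" using zeros_ones_subset by (meson finite_Un finite_atLeastAtMost finite_subset)
    then have card: "card (zeros n N \<union> ones n N) = Suc (card (?Z \<union> ?W))"
      unfolding un using vn by simp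
    have "(zeros n N, ones n N) = apply_fixing (v, if s then 1 else 0) (?Z, ?W)"
      by (simp add: apply_fixing_def ZW)
    then have "fixing_step n \<Gamma> (?Z, ?W) (zeros n N, ones n N)"
      unfolding fixing_step_def using \<Gamma> V by (intro bexI exI conjI) simp_all
    then have st: "(fixing_step n \<Gamma>)\<^sup>*\<^sup>* I (zeros n N, ones n N)" using steps by simp
    have fl: "\<forall>u\<in>{1..n}. N (1 + u) \<le> 1 \<and> N (1 + n + u) \<le> 1"
      using G E unfolding fixed_state_def N_def by auto
    have ent: "\<forall>j<Suc ?\<tau>. N (E + j) \<in> {1..n}"
      using G v(2) unfolding fixed_state_def q by (auto simp: less_Suc_eq)
    have dis: "zeros n N \<inter> ones n N = {}" using disj vn unfolding ZW by auto
    \<comment> \<open>The new queue entry is paid for by the newly fixed variable.\<close>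
    have "Suc ?\<tau> \<le> Suc (card (zeros n N \<union> ones n N))" using G unfolding card fixed_state_def by simp
    then have G': "fixed_state n \<Gamma> I E (Suc ?\<tau>) N"
      unfolding fixed_state_def using st fl ent dis by blast
    have "pending E N ?\<tau> (Suc ?\<tau>) = {v}" unfolding pending_def by (simp add: q)
    then have adv: "advances n E ?\<tau> M (Suc ?\<tau>) N"
      unfolding advances_def by (auto simp: ZW q split: if_splits)
    have fr: "same_except (shared_cells n E) M N"
      using v(2) fixed_state_tail[OF G'] unfolding same_except_def shared_cells_def N_def by auto
    have "Q (r', N) t'" using that(3,4) r' G' adv fr ZW by (intro Q) simp_all
    then show ?thesis unfolding N_def .
  qed
  show ?thesis
    using v(1,3) k bad old new by (cases s) (auto simp: fix_code_def same_except_def)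
qed

text \<open>The lookahead for 1 is the dual one, with index maps, fixed sets and tentative sets
  exchanged. In both cases \<open>T0\<close> holds the variables that are tentatively 0 and
  \<open>T1\<close> those that are tentatively 1.\<close>

definition side_inv ::
    "bool \<Rightarrow> nat \<Rightarrow> (nat \<Rightarrow> nat) \<Rightarrow> nat set \<Rightarrow> nat set \<Rightarrow> nat \<Rightarrow> nat \<Rightarrow> nat set \<Rightarrow> nat set \<Rightarrow> bool" where
  "side_inv s n g Z W p q T0 T1 =
     (if s then lookahead n Suc g Z W p q T0 T1 else lookahead n g Suc W Z p q T1 T0)"

text \<open>Tells whether the fixing that this lookahead has to decide is still open.\<close>

definition live :: "bool \<Rightarrow> (nat \<Rightarrow> nat) \<Rightarrow> nat set \<Rightarrow> nat set \<Rightarrow> nat \<Rightarrow> bool" where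
  "live s g Z W p \<longleftrightarrow> (if s then Suc p \<notin> W else g p \<notin> Z)"

definition refuted :: "bool \<Rightarrow> nat \<Rightarrow> (nat \<Rightarrow> nat) \<Rightarrow> nat set \<Rightarrow> nat set \<Rightarrow> nat \<Rightarrow> bool" where
  "refuted s n g Z W p \<longleftrightarrow>
     (\<forall>x. lex_sol n Suc g x \<and> extends Z W x \<longrightarrow> (if s then x (Suc p) else \<not> x (g p)))"

section \<open>Moves and outcomes for both hypotheses at once\<close>

lemma side_pass_eq:
  "side_inv s n g Z W p q T0 T1 \<Longrightarrow> p < q \<Longrightarrow> q < n \<Longrightarrow> Suc q = g q \<Longrightarrow>
    side_inv s n g Z W p (Suc q) T0 T1"
  using lookahead_pass_eq[of n Suc g Z W p q T0 T1] lookahead_pass_eq[of n g Suc W Z p q T1 T0]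
  unfolding side_inv_def by presburger

lemma side_pass_one:
  "side_inv s n g Z W p q T0 T1 \<Longrightarrow> p < q \<Longrightarrow> q < n \<Longrightarrow> inj_on g {..<n} \<Longrightarrow>
    g q \<in> W \<union> T1 \<Longrightarrow> Suc q \<notin> Z \<union> T0 \<Longrightarrow> side_inv s n g Z W p (Suc q) T0 (insert (Suc q) T1)"
  unfolding side_inv_def
  using lookahead_pass_one[of n Suc g Z W p q T0 T1] lookahead_pass_zero[of n g Suc W Z p q T1 T0]
  by simp

lemma side_pass_zero:
  "side_inv s n g Z W p q T0 T1 \<Longrightarrow> p < q \<Longrightarrow> q < n \<Longrightarrow> inj_on g {..<n} \<Longrightarrow>
    Suc q \<in> Z \<union> T0 \<Longrightarrow> g q \<notin> W \<union> T1 \<Longrightarrow> side_inv s n g Z W p (Suc q) (insert (g q) T0) T1"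
  unfolding side_inv_def
  using lookahead_pass_one[of n g Suc W Z p q T1 T0] lookahead_pass_zero[of n Suc g Z W p q T0 T1]
  by simp

lemma dual_sol: "lex_sol n Suc g x \<Longrightarrow> lex_sol n g Suc (\<lambda>v. \<not> x v)"
  and dual_ext: "extends Z W x \<Longrightarrow> extends W Z (\<lambda>v. \<not> x v)"
  by (simp_all add: lex_sol_dual extends_dual)

lemma side_fail:
  assumes "side_inv s n g Z W p q T0 T1" "p < n" "q < n" "Suc q \<in> Z \<union> T0" "g q \<in> W \<union> T1"
  shows "refuted s n g Z W p"
proof (cases s)
  case True
  then show ?thesis using assms lookahead_fail[of n Suc g Z W p q T0 T1]
    unfolding refuted_def side_inv_def by auto
next
  case False
  then have "lookahead n g Suc W Z p q T1 T0" using assms(1) unfolding side_inv_def by simp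
  from lookahead_fail[OF this assms(2,3,5,4) dual_sol dual_ext] False
  show ?thesis unfolding refuted_def by auto
qed

lemma side_conflict:
  assumes "side_inv s n g Z W p q T0 T1" "p < n" "v \<in> T0 \<inter> W \<or> v \<in> T1 \<inter> Z"
  shows "refuted s n g Z W p"
proof (cases s)
  case True
  then show ?thesis using assms lookahead_conflict[of n Suc g Z W p q T0 T1 v]
    unfolding refuted_def side_inv_def by auto
next
  case False
  then have L: "lookahead n g Suc W Z p q T1 T0" using assms(1) unfolding side_inv_def by simp
  have "v \<in> T1 \<inter> Z \<or> v \<in> T0 \<inter> W" using assms(3) by blast
  from lookahead_conflict[OF L assms(2) this dual_sol dual_ext] False
  show ?thesis unfolding refuted_def by auto
qed

lemma side_mono:
  "side_inv s n g Z W p q T0 T1 \<Longrightarrow> Z \<subseteq> Z' \<Longrightarrow> W \<subseteq> W' \<Longrightarrow> side_inv s n g Z' W' p q T0 T1"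
  unfolding side_inv_def by (auto intro: lookahead_mono)

lemma side_start:
  assumes "p < n" "\<forall>i<p. eq_at Suc g Z W i"
  shows "side_inv s n g Z W p (Suc p) (if s then {Suc p, g p} else {}) (if s then {} else {Suc p, g p})"
  using lookahead_start[of p n Suc g Z W] lookahead_start[of p n g Suc W Z] assms
  unfolding side_inv_def by (simp add: eq_at_dual insert_commute)

lemma side_move:
  assumes "side_inv s n g Z W p q T0 T1" "p' \<le> n" "p < p'" "Z \<inter> W = {}"
    "\<forall>i<p'. eq_at Suc g Z W i" "p' < n \<Longrightarrow> stop_at Suc g Z W p'"
  shows "side_inv s n g Z W p' q {} {}"
proof (cases s)
  case True
  then show ?thesis using assms lookahead_move[of n Suc g Z W p q T0 T1 p'] unfolding side_inv_def by simp
next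
  case False
  have "W \<inter> Z = {}" using assms(4) by blast
  then show ?thesis using False assms(1-3,5,6) lookahead_move[of n g Suc W Z p q T1 T0 p']
    unfolding side_inv_def by (simp add: eq_at_dual stop_at_dual)
qed

lemma side_witness:
  assumes "side_inv s n g Z W p q T0 T1" "p < n" "p < q" "inj_on g {..<n}" "Z \<inter> W = {}"
    "\<forall>i<p. eq_at Suc g Z W i" "live s g Z W p"
    "q < n \<Longrightarrow> stop_at Suc g (Z \<union> T0) (W \<union> T1) q" "T0 \<inter> W = {}" "T1 \<inter> Z = {}"
  obtains x where "lex_sol n Suc g x" "extends Z W x" "if s then \<not> x (Suc p) else x (g p)"
proof (cases s)
  case True
  then show ?thesis
    using assms lookahead_witness[of n Suc g Z W p q T0 T1] that
    unfolding side_inv_def live_def by simp metis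
next
  case False
  have d: "W \<inter> Z = {}" using assms(5) by blast
  obtain x where "lex_sol n g Suc x" "extends W Z x" "\<not> x (g p)"
    using lookahead_witness[of n g Suc W Z p q T1 T0 thesis] False assms d
    unfolding side_inv_def live_def by (auto simp: eq_at_dual stop_at_dual)
  then show ?thesis using that[of "\<lambda>v. \<not> x v"] False lex_sol_dual[of n g Suc x] lex_sol_dual[of n Suc g x]
    extends_dual[of Z W x]
    by (metis dual_ext dual_sol lex_sol_dual)
qed

lemma side_pos: "side_inv s n g Z W p q T0 T1 \<Longrightarrow> q \<le> n"
  unfolding side_inv_def using lookaheadD(1) by (metis (full_types))

text \<open>The tentative values are not yet known to be consistent with the variables in \<open>U\<close>.\<close>

definition side_mem ::
    "bool \<Rightarrow> nat \<Rightarrow> (nat \<Rightarrow> nat) \<Rightarrow> nat set \<Rightarrow> nat \<Rightarrow> nat \<Rightarrow> nat \<Rightarrow> nat \<Rightarrow> (nat \<Rightarrow> nat) \<Rightarrow> nat set \<Rightarrow> nat set \<Rightarrow> bool"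
  where
  "side_mem s n g U p q b0 b1 M Z W \<longleftrightarrow>
     side_inv s n g Z W p q (marked n M b0 p) (marked n M b1 p) \<and>
     (\<forall>v\<in>{1..n}. M (b0 + v) \<le> Suc p \<and> M (b1 + v) \<le> Suc p) \<and>
     (live s g Z W p \<longrightarrow> marked n M b0 p \<inter> W \<subseteq> U \<and> marked n M b1 p \<inter> Z \<subseteq> U)"

section \<open>A lookahead run by the program\<close>

definition mark_cells :: "nat \<Rightarrow> nat \<Rightarrow> nat \<Rightarrow> nat set" where
  "mark_cells n b0 b1 = {b0 + 1..b0 + n} \<union> {b1 + 1..b1 + n}"

definition side_stop ::
    "nat \<Rightarrow> (nat \<Rightarrow> nat) \<Rightarrow> nat \<Rightarrow> nat \<Rightarrow> nat \<Rightarrow> nat \<Rightarrow> (nat \<Rightarrow> nat) \<Rightarrow> nat set \<Rightarrow> nat set \<Rightarrow> bool" where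
  "side_stop n g p q b0 b1 M Z W \<longleftrightarrow>
     p < q \<and> (q < n \<longrightarrow> stop_at Suc g (Z \<union> marked n M b0 p) (W \<union> marked n M b1 p) q)"

text \<open>A mark is written only after the test that its variable does not carry the opposite
  value, so the set \<open>U\<close> of unchecked variables need not grow. Every round but the last
  raises register 13 and is paid for by 60 units per position.\<close>

lemma wp_look:
  assumes K: "base_regs n E r" and R: "r 10 = D" "r 12 = p" "r 24 = Suc p" "r 14 = b0" "r 15 = b1"
      "r 18 = n - r 13" "r 19 = 0"
    and perm: "\<And>j. j < n \<Longrightarrow> M (D + j) = g j" "\<And>j. j < n \<Longrightarrow> g j \<in> {1..n}" and inj: "inj_on g {..<n}"
    and lay: "2 * n + 1 < D" "D + n \<le> E" "E \<le> b0" "b0 + n \<le> b1" and p: "p < n" "p < r 13"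
    and ZW: "Z = zeros n M" "W = ones n M"
    and S: "side_mem s n g U p (r 13) b0 b1 M Z W"
    and Q: "\<And>r' M' t'. same_except {13, 16, 17, 18, 19, 20, 21} r r' \<Longrightarrow>
      same_except (mark_cells n b0 b1) M M' \<Longrightarrow> r 13 \<le> r' 13 \<Longrightarrow>
      side_mem s n g U p (r' 13) b0 b1 M' Z W \<Longrightarrow>
      (r' 19 = 0 \<and> side_stop n g p (r' 13) b0 b1 M' Z W \<or> r' 19 = 1 \<and> refuted s n g Z W p) \<Longrightarrow>
      t' + 60 * r 13 \<le> t + 60 * r' 13 + 70 \<Longrightarrow> Q (r', M') t'"
  shows "wp (infeasible n \<Gamma> I T) (While 18 look_step) (r, M) t Q"
proof -
  define J :: "store \<Rightarrow> nat \<Rightarrow> bool" where "J = (\<lambda>(r', M') t'.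
      same_except {13, 16, 17, 18, 19, 20, 21} r r' \<and>
      same_except (mark_cells n b0 b1) M M' \<and> r 13 \<le> r' 13 \<and>
      side_mem s n g U p (r' 13) b0 b1 M' Z W \<and>
      (r' 18 \<noteq> 0 \<longrightarrow> r' 18 = n - r' 13 \<and> r' 19 = 0) \<and>
      (r' 18 = 0 \<longrightarrow>
        r' 19 = 0 \<and> side_stop n g p (r' 13) b0 b1 M' Z W \<or> r' 19 = 1 \<and> refuted s n g Z W p) \<and>
      t' + 60 * r 13 \<le> t + 60 * r' 13 + (if r' 18 = 0 then 60 else 0))"
  have init: "J (r, M) t"
    using R S p unfolding J_def by (auto simp: same_except_refl side_stop_def)
  show ?thesis
  \<comment> \<open>The extra unit in the measure is for the last round, which clears register 18
    without moving the position.\<close>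
  proof (rule wp_While[where I = J and \<mu> = "\<lambda>(r', M'). n - r' 13 + (if r' 18 = 0 then 0 else 1)"])
    show "J (r, M) t" by (rule init)
  next
    fix s' t' assume "J s' t'" "fst s' 18 = 0"
    then show "Q s' (t' + 1)" unfolding J_def by (cases s') (auto intro: Q)
  next
    fix s' t1 assume J: "J s' t1" and nz: "fst s' 18 \<noteq> 0"
    obtain r1 M1 where s': "s' = (r1, M1)" by (cases s')
    define q where "q = r1 13"
    define T0 where "T0 = marked n M1 b0 p"
    define T1 where "T1 = marked n M1 b1 p"
    have r1: "same_except {13, 16, 17, 18, 19, 20, 21} r r1" and M1: "same_except (mark_cells n b0 b1) M M1"
      and q0: "r 13 \<le> q" and S1: "side_mem s n g U p q b0 b1 M1 Z W"
      and r18: "r1 18 = n - q" "r1 19 = 0" and t1: "t1 + 60 * r 13 \<le> t + 60 * q"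
      using J nz unfolding J_def s' q_def by (auto split: if_splits)
    have qn: "q < n" "p < q" using nz r18 q0 p unfolding s' by auto
    have k: "r1 (Suc 0) = n" "r1 2 = 1" "r1 3 = 1" "r1 4 = Suc n" "r1 10 = D" "r1 12 = p" "r1 24 = Suc p"
        "r1 14 = b0" "r1 15 = b1" "r1 13 = q"
      using r1 K R unfolding same_except_def base_regs_def q_def by auto
    have gq: "g q \<in> {1..n}" using perm(2) qn by simp
    have low: "M1 a = M a" if "a \<notin> mark_cells n b0 b1" for a using M1 that unfolding same_except_def by simp
    have Mg: "M1 (D + q) = g q" using low[of "D + q"] perm(1) qn lay unfolding mark_cells_def by auto
    have z: "M1 (Suc v) = 0 \<longleftrightarrow> v \<notin> Z" and w: "M1 (Suc (n + v)) = 0 \<longleftrightarrow> v \<notin> W" if "v \<in> {1..n}" for v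
      using low[of "Suc v"] low[of "Suc (n + v)"] that lay unfolding mark_cells_def ZW zeros_def ones_def by auto
    have m: "M1 (b0 + v) - p = 0 \<longleftrightarrow> v \<notin> T0" "M1 (b1 + v) - p = 0 \<longleftrightarrow> v \<notin> T1" if "v \<in> {1..n}" for v
      using that unfolding T0_def T1_def marked_def by auto
    have inv: "side_inv s n g Z W p q T0 T1"
      and mk: "\<forall>v\<in>{1..n}. M1 (b0 + v) \<le> Suc p \<and> M1 (b1 + v) \<le> Suc p"
      and nc: "live s g Z W p \<longrightarrow> T0 \<inter> W \<subseteq> U \<and> T1 \<inter> Z \<subseteq> U"
      using S1 unfolding side_mem_def T0_def T1_def by auto
    define F where "F = (\<lambda>(r', M') t'. J (r', M') t' \<and>
      n - r' 13 + (if r' 18 = 0 then 0 else 1) < n - q + (1::nat))"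
    have pass: "F (r2, M2) t2"
      if "same_except {13, 16, 17, 18, 19, 20, 21} r1 r2" "r2 13 = Suc q" "r2 18 = n - Suc q" "r2 19 = 0"
        "same_except (mark_cells n b0 b1) M1 M2" "side_mem s n g U p (Suc q) b0 b1 M2 Z W" "t2 \<le> t1 + 60"
      for r2 M2 t2
      unfolding F_def J_def
      using that q0 t1 qn same_except_trans[OF r1 that(1)] same_except_trans[OF M1 that(5)]
      by (auto simp: side_stop_def)
    have halt: "F (r2, M1) t2"
      if "same_except {13, 16, 17, 18, 19, 20, 21} r1 r2" "r2 13 = q" "r2 18 = 0" "t2 \<le> t1 + 60"
        "r2 19 = 0 \<and> stop_at Suc g (Z \<union> T0) (W \<union> T1) q \<or> r2 19 = 1 \<and> refuted s n g Z W p"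
      for r2 t2
      unfolding F_def J_def
      using that q0 t1 qn same_except_trans[OF r1 that(1)] M1 S1
      by (auto simp: side_stop_def T0_def T1_def)
    have mc: "Suc (b1 + q) \<in> mark_cells n b0 b1" "b0 + g q \<in> mark_cells n b0 b1"
      using qn gq unfolding mark_cells_def by auto
    have mk_upd: "\<forall>v\<in>{1..n}. (M1(a := Suc p)) (b0 + v) \<le> Suc p \<and> (M1(a := Suc p)) (b1 + v) \<le> Suc p" for a
      using mk by simp
    have S_eq: "side_mem s n g U p (Suc q) b0 b1 M1 Z W" if "Suc q = g q"
      using side_pass_eq[OF inv qn(2,1) that] S1 unfolding side_mem_def T0_def T1_def by blast
    have S_one: "side_mem s n g U p (Suc q) b0 b1 (M1(b1 + Suc q := Suc p)) Z W"
      if "g q \<in> W \<union> T1" "Suc q \<notin> Z \<union> T0"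
    proof -
      have mk': "marked n (M1(b1 + Suc q := Suc p)) b0 p = T0"
          "marked n (M1(b1 + Suc q := Suc p)) b1 p = insert (Suc q) T1"
        using qn lay unfolding T0_def T1_def by (auto simp only: marked_upd marked_def) (auto simp: marked_def)
      show ?thesis unfolding side_mem_def mk'
        using side_pass_one[OF inv qn(2,1) inj that] mk_upd nc that by blast
    qed
    have S_zero: "side_mem s n g U p (Suc q) b0 b1 (M1(b0 + g q := Suc p)) Z W"
      if "Suc q \<in> Z \<union> T0" "g q \<notin> W \<union> T1"
    proof -
      have mk': "marked n (M1(b0 + g q := Suc p)) b1 p = T1"
          "marked n (M1(b0 + g q := Suc p)) b0 p = insert (g q) T0"
        using gq lay unfolding T0_def T1_def by (auto simp: marked_def)
      show ?thesis unfolding side_mem_def mk'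
        using side_pass_zero[OF inv qn(2,1) inj that] mk_upd nc that by blast
    qed
    have "wp (infeasible n \<Gamma> I T) look_step (r1, M1) (t1 + 2) F"
    proof (cases "Suc q = g q")
      case True
      then show ?thesis
        by (simp add: look_step_def k Mg flip: True)
          (rule pass, simp_all add: same_except_def k r18 S_eq flip: True)
    next
      case False
      then have eq: "\<not> (Suc q \<le> g q \<and> g q \<le> Suc q)" by auto
      consider (one) "g q \<in> W \<union> T1" "Suc q \<notin> Z \<union> T0" | (zero) "g q \<notin> W \<union> T1" "Suc q \<in> Z \<union> T0"
        | (fail) "g q \<in> W \<union> T1" "Suc q \<in> Z \<union> T0" | (stop) "g q \<notin> W \<union> T1" "Suc q \<notin> Z \<union> T0" by blast
      then show ?thesis
      proof cases
        case one
        have c: "\<not> (M1 (Suc (n + g q)) = 0 \<and> M1 (b1 + g q) \<le> p)" "(M1 (Suc (Suc q)) = 0 \<and> M1 (Suc (b0 + q)) \<le> p)"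
          using one w[OF gq] m(2)[OF gq] z[of "Suc q"] m(1)[of "Suc q"] qn by auto
        show ?thesis
          by (simp add: look_step_def flag_code_def k Mg eq c)
            (rule pass, use S_one one mc in \<open>simp_all add: same_except_def k r18\<close>)
      next
        case zero
        have c: "(M1 (Suc (n + g q)) = 0 \<and> M1 (b1 + g q) \<le> p)" "\<not> (M1 (Suc (Suc q)) = 0 \<and> M1 (Suc (b0 + q)) \<le> p)"
          using zero w[OF gq] m(2)[OF gq] z[of "Suc q"] m(1)[of "Suc q"] qn by auto
        show ?thesis
          by (simp add: look_step_def flag_code_def k Mg eq c)
            (rule pass, use S_zero zero mc in \<open>simp_all add: same_except_def k r18\<close>)
      next
        case fail
        have c: "\<not> (M1 (Suc (n + g q)) = 0 \<and> M1 (b1 + g q) \<le> p)" "\<not> (M1 (Suc (Suc q)) = 0 \<and> M1 (Suc (b0 + q)) \<le> p)"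
          using fail w[OF gq] m(2)[OF gq] z[of "Suc q"] m(1)[of "Suc q"] qn by auto
        show ?thesis
          by (simp add: look_step_def flag_code_def k Mg eq c)
            (rule halt, use side_fail[OF inv p(1) qn(1) fail(2,1)] in \<open>simp_all add: same_except_def k r18\<close>)
      next
        case stop
        have c: "(M1 (Suc (n + g q)) = 0 \<and> M1 (b1 + g q) \<le> p)" "(M1 (Suc (Suc q)) = 0 \<and> M1 (Suc (b0 + q)) \<le> p)"
          using stop w[OF gq] m(2)[OF gq] z[of "Suc q"] m(1)[of "Suc q"] qn by auto
        show ?thesis
          by (simp add: look_step_def flag_code_def k Mg eq c)
            (rule halt, use stop False in \<open>simp_all add: same_except_def k r18 stop_at_def\<close>)
      qed
    qed
    then show "wp (infeasible n \<Gamma> I T) look_step s' (t1 + 2)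
        (\<lambda>s2 t2. J s2 t2 \<and> (case s2 of (r', M') \<Rightarrow> n - r' 13 + (if r' 18 = 0 then 0 else 1))
           < (case s' of (r', M') \<Rightarrow> n - r' 13 + (if r' 18 = 0 then 0 else 1)))"
      unfolding s' by (rule wp_mono) (use nz in \<open>auto simp: F_def s' q_def\<close>)
  qed (auto simp: infeasible_def)
qed

lemma wp_conflict:
  assumes K: "base_regs n E r" and R: "r 8 = v" "v \<in> {1..n}" "r 12 = p" "r 14 = b0" "r 15 = b1"
    and Q: "\<And>r' t'. same_except {19, 20} r r' \<Longrightarrow>
      r' 19 = (if v \<in> marked n M b0 p \<inter> ones n M \<or> v \<in> marked n M b1 p \<inter> zeros n M then 1 else r 19) \<Longrightarrow>
      t' \<le> t + 20 \<Longrightarrow> Q (r', M) t'"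
  shows "wp A conflict_code (r, M) t Q"
proof -
  have k: "r 3 = 1" "r 4 = Suc n" using K unfolding base_regs_def by auto
  have z: "v \<in> zeros n M \<longleftrightarrow> M (Suc v) \<noteq> 0" "v \<in> ones n M \<longleftrightarrow> M (Suc (n + v)) \<noteq> 0"
    using R(2) unfolding zeros_def ones_def by auto
  have m: "v \<in> marked n M b0 p \<longleftrightarrow> \<not> M (b0 + v) \<le> p" "v \<in> marked n M b1 p \<longleftrightarrow> \<not> M (b1 + v) \<le> p"
    using R(2) unfolding marked_def by auto
  show ?thesis
    by (simp add: conflict_code_def k R, intro conjI impI)
      (rule Q, simp_all add: same_except_def z m)+
qed

lemma wp_side_run:
  assumes K: "base_regs n E r" and R: "r 10 = D" "r 12 = p" "r 24 = Suc p" "r 25 = g p"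
      "r 14 = b0" "r 15 = b1" "r 27 = qa" "r 13 = M qa"
    and r19: "r 19 = 0 \<or> r 19 = 1 \<and> refuted s n g Z W p"
    and perm: "\<And>j. j < n \<Longrightarrow> M (D + j) = g j" "\<And>j. j < n \<Longrightarrow> g j \<in> {1..n}" and inj: "inj_on g {..<n}"
    and lay: "2 * n + 1 < D" "D + n \<le> E" "E \<le> b0" "b0 + n \<le> b1" "E \<le> qa" "qa \<notin> mark_cells n b0 b1"
    and p: "p < n"
    and ZW: "Z = zeros n M" "W = ones n M"
    and eq: "\<forall>i<p. eq_at Suc g Z W i" and stop: "stop_at Suc g Z W p"
    and S: "side_mem s n g U p (M qa) b0 b1 M Z W"
    and Q: "\<And>r' M' t'. same_except {13, 16, 17, 18, 19, 20, 21} r r' \<Longrightarrow>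
      same_except (insert qa (mark_cells n b0 b1)) M M' \<Longrightarrow> M qa \<le> M' qa \<Longrightarrow>
      side_mem s n g U p (M' qa) b0 b1 M' Z W \<Longrightarrow>
      (r' 19 = 0 \<and> side_stop n g p (M' qa) b0 b1 M' Z W \<or> r' 19 = 1 \<and> refuted s n g Z W p) \<Longrightarrow>
      (r' 19 = 0 \<longrightarrow> r 19 = 0) \<Longrightarrow>
      t' + 60 * M qa \<le> t + 60 * M' qa + 100 \<Longrightarrow> Q (r', M') t'"
  shows "wp (infeasible n \<Gamma> I T) (side_run s) (r, M) t Q"
proof (cases "r 19 = 0")
  case False
  then show ?thesis using r19 S
    by (simp add: side_run_def) (rule Q, simp_all add: same_except_refl)
next
  case True
  define X where "X = mark_cells n b0 b1"
  have k: "r (Suc 0) = n" "r 2 = 1" using K unfolding base_regs_def by auto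
  have gp: "g p \<in> {1..n}" using perm(2) p by blast
  have store: "wp (infeasible n \<Gamma> I T) look_code (r1, M1) t1 Q"
    if r1: "same_except {13, 20} r r1" and M1: "same_except X M M1" and q: "p < r1 13" "M qa \<le> r1 13"
      and S1: "side_mem s n g U p (r1 13) b0 b1 M1 Z W" and t1: "t1 \<le> t + 20" for r1 M1 t1
  proof -
    have low: "M1 a = M a" if "a \<notin> X" for a using M1 that unfolding same_except_def by simp
    have a: "a \<notin> X" if "a < E" for a using that lay unfolding X_def mark_cells_def by auto
    have k1: "r1 (Suc 0) = n" "r1 19 = 0" "r1 10 = D" "r1 12 = p" "r1 24 = Suc p" "r1 14 = b0" "r1 15 = b1"
      "r1 27 = qa"
      using r1 K R True unfolding same_except_def base_regs_def by auto
    have ZW1: "Z = zeros n M1" "W = ones n M1"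
      unfolding ZW using lay by (intro zeros_cong[symmetric] ones_cong[symmetric] low a; simp)+
    have fin: "Q (r2, M2(qa := r2 13)) t2"
      if r2: "same_except {13, 16, 17, 18, 19, 20, 21} (r1(18 := n - r1 13)) r2"
        and M2: "same_except (mark_cells n b0 b1) M1 M2" and q2: "r1 13 \<le> r2 13"
        and S2: "side_mem s n g U p (r2 13) b0 b1 M2 Z W"
        and out: "r2 19 = 0 \<and> side_stop n g p (r2 13) b0 b1 M2 Z W \<or> r2 19 = 1 \<and> refuted s n g Z W p"
        and t2: "t2 + 60 * r1 13 \<le> t1 + 60 * r2 13 + 72" for r2 M2 t2
    proof -
      have mk: "marked n (M2(qa := x)) b0 p = marked n M2 b0 p" "marked n (M2(qa := x)) b1 p = marked n M2 b1 p"
        for x using lay(6) unfolding mark_cells_def by (auto intro!: marked_cong)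
      have c: "(M2(qa := x)) (b0 + v) = M2 (b0 + v)" "(M2(qa := x)) (b1 + v) = M2 (b1 + v)"
        if "v \<in> {1..n}" for x v using lay(6) that unfolding mark_cells_def by auto
      have "side_mem s n g U p (r2 13) b0 b1 (M2(qa := r2 13)) Z W"
        using S2 c unfolding side_mem_def mk by simp
      moreover have "side_stop n g p (r2 13) b0 b1 (M2(qa := r2 13)) Z W = side_stop n g p (r2 13) b0 b1 M2 Z W"
        unfolding side_stop_def mk ..
      moreover have "same_except (insert qa X) M (M2(qa := r2 13))"
        using M1 M2 unfolding same_except_def X_def by auto
      moreover have "same_except {13, 16, 17, 18, 19, 20, 21} r r2"
        using r1 r2 unfolding same_except_def by auto
      ultimately show ?thesis using out q q2 t1 t2 True unfolding X_def by (intro Q) simp_all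
    qed
    have K1: "base_regs n E (r1(18 := n - r1 13))"
      using K r1 unfolding base_regs_def same_except_def by simp
    have perm1: "M1 (D + j) = g j" if "j < n" for j using low[OF a] perm(1) that lay by simp
    show ?thesis
      apply (simp add: k1 look_code_def)
      apply (rule wp_look[OF K1 _ _ _ _ _ _ _ perm1 perm(2) inj lay(1-4) p _ ZW1])
      using q S1 apply (simp_all add: k1)
      subgoal premises prems for r2 M2 t2
      proof -
        have "r2 27 = qa" using prems(1) k1 unfolding same_except_def by simp
        then show ?thesis using fin[of r2 M2 "Suc t2"] prems by simp
      qed
      done
  qed
  show ?thesis
  proof (cases "M qa \<le> p")
    case False
    then show ?thesis using True S
      by (simp add: side_run_def R) (rule store, simp_all add: same_except_def R)
  next
    case le: True
    define b where "b = (if s then b0 else b1)"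
    define N where "N = M(b + Suc p := Suc p, b + g p := Suc p)"
    have inv: "side_inv s n g Z W p (M qa) (marked n M b0 p) (marked n M b1 p)"
      and st: "\<forall>v\<in>{1..n}. M (b0 + v) \<le> Suc p \<and> M (b1 + v) \<le> Suc p"
      using S unfolding side_mem_def by auto
    \<comment> \<open>A lookahead with \<open>q <= p\<close> carries no tentative values, so no old
      mark counts for \<open>p\<close> and a restart needs no clearing of the arrays.\<close>
    have old: "marked n M b0 p = {}" "marked n M b1 p = {}"
      using inv le unfolding side_inv_def by (auto dest!: lookaheadD(10) split: if_splits)
    have mk: "marked n N b0 p = (if s then {Suc p, g p} else {})"
        "marked n N b1 p = (if s then {} else {Suc p, g p})"
      using old gp p lay(4) unfolding N_def b_def marked_def by (auto split: if_splits)
    have "side_mem s n g U p (Suc p) b0 b1 N Z W"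
      unfolding side_mem_def mk
    proof (intro conjI impI)
      show "side_inv s n g Z W p (Suc p) (if s then {Suc p, g p} else {}) (if s then {} else {Suc p, g p})"
        by (rule side_start[OF p eq])
      show "\<forall>v\<in>{1..n}. N (b0 + v) \<le> Suc p \<and> N (b1 + v) \<le> Suc p" 
      proof
        fix v assume "v \<in> {1..n}"
        moreover have "N a = M a \<or> N a = Suc p" for a unfolding N_def by simp
        ultimately show "N (b0 + v) \<le> Suc p \<and> N (b1 + v) \<le> Suc p" using st by (metis order_refl)
      qed
    qed (use stop in \<open>auto simp: live_def stop_at_def split: if_splits\<close>)
    moreover have "same_except X M N"
      using gp p unfolding N_def X_def b_def same_except_def mark_cells_def by auto
    ultimately show ?thesis using True le k unfolding N_def b_def
      by (cases s) (simp add: side_run_def R, rule store, simp_all add: same_except_def R)+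
  qed
qed

lemma valid_fixing_refuted:
  assumes "\<gamma> permutes {1..n}" "Z \<subseteq> {1..n}" "p < n" "refuted s n (preimage \<gamma>) Z W p"
  shows "valid_fixing n \<gamma> Z W (if s then Suc p else preimage \<gamma> p, if s then 1 else 0)"
proof (cases s)
  case True
  then show ?thesis using assms valid_fixing_one[OF assms(1,2), of "Suc p" W] by (auto simp: refuted_def)
next
  case False
  then show ?thesis using assms valid_fixing_zero[OF assms(1,2) preimage_range[OF assms(1,3)], of W]
    by (auto simp: refuted_def)
qed

lemma wp_side:
  assumes K: "base_regs n E r"
    and R: "r 8 = v" "v \<in> {1..n}" "r 10 = D" "r 11 = B" "r 12 = p" "r 24 = Suc p" "r 25 = g p"
    and \<gamma>: "\<gamma> \<in> \<Gamma>" "\<gamma> permutes {1..n}" and g: "g = preimage \<gamma>"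
    and b: "b0 = B + 2 + (if s then 0 else 2 * n)" "b1 = b0 + n" "qa = B + (if s then 1 else 2)"
    and perm: "\<And>j. j < n \<Longrightarrow> M (D + j) = g j"
    and lay: "2 * n + 1 < D" "D + n \<le> E" "E + n < B" and p: "p < n"
    and G: "fixed_state n \<Gamma> I E (r 7) M"
    and eq: "\<forall>i<p. eq_at Suc g (zeros n M) (ones n M) i"
    and stop: "stop_at Suc g (zeros n M) (ones n M) p"
    and S: "side_mem s n g (insert v (pending E M h (r 7))) p (M qa) b0 b1 M (zeros n M) (ones n M)"
    and Q: "\<And>r' M' t'. same_except ({7, 27} \<union> {13..21}) r r' \<Longrightarrow> fixed_state n \<Gamma> I E (r' 7) M' \<Longrightarrow>
      advances n E (r 7) M (r' 7) M' \<Longrightarrow>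
      same_except (shared_cells n E \<union> insert qa (mark_cells n b0 b1)) M M' \<Longrightarrow> M qa \<le> M' qa \<Longrightarrow>
      side_mem s n g (pending E M' h (r' 7)) p (M' qa) b0 b1 M' (zeros n M') (ones n M') \<Longrightarrow>
      (live s g (zeros n M') (ones n M') p \<Longrightarrow> side_stop n g p (M' qa) b0 b1 M' (zeros n M') (ones n M')) \<Longrightarrow>
      stop_at Suc g (zeros n M') (ones n M') p \<Longrightarrow>
      t' + 60 * M qa \<le> t + 60 * M' qa + 200 \<Longrightarrow> Q (r', M') t'"
    and T: "t + 60 * n + 300 \<le> T"
  shows "wp (infeasible n \<Gamma> I T) (side_code s) (r, M) t Q"
proof -
  define Z where "Z = zeros n M"
  define W where "W = ones n M"
  define P where "P = pending E M h (r 7)"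
  define conf where "conf \<longleftrightarrow> v \<in> marked n M b0 p \<inter> W \<or> v \<in> marked n M b1 p \<inter> Z"
  define X where "X = insert qa (mark_cells n b0 b1)"
  define i where "i = (if s then 24 else 25 :: nat)"
  define w where "w = (if s then Suc p else g p)"
  have k: "r (Suc 0) = n" "r 22 = 2 * n" "r 0 = 0" using K unfolding base_regs_def by auto
  have rng: "g j \<in> {1..n}" if "j < n" for j using preimage_range[OF \<gamma>(2) that] g by simp
  have inj: "inj_on g {..<n}" using inj_preimage[OF \<gamma>(2)] g by simp
  have X: "B < a" if "a \<in> X" for a using that b unfolding X_def mark_cells_def by (auto split: if_splits)
  have iw: "r i = w" "i \<in> {24, 25}" "w \<in> {1..n}" using R p rng[OF p] unfolding i_def w_def by auto
  have \<tau>: "r 7 \<le> Suc n" using fixed_state_tail[OF G] .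
  \<comment> \<open>A conflicting \<open>v\<close> stays among the unchecked variables; the fixing
    that follows makes the lookahead idle, and the consistency of its marks is required only while
    it is live.\<close>
  have S': "side_mem s n g (if conf then insert v P else P) p (M qa) b0 b1 M Z W"
    using S unfolding conf_def P_def Z_def W_def side_mem_def by auto
  have ref: "refuted s n g Z W p" if conf
    using that S p side_conflict[of s n g Z W p "M qa" "marked n M b0 p" "marked n M b1 p" v]
    unfolding conf_def side_mem_def Z_def W_def by blast
  have "wp (infeasible n \<Gamma> I T) (IfZ 19 Skip (fix_code (if s then 3 else 4) (if s then 4 else 3) i)) (r2, M2) t2 Q"
    if r2: "same_except ({7, 27} \<union> {13..21}) r r2" "r2 7 = r 7" and M2: "same_except X M M2" and q2: "M qa \<le> M2 qa"
      and S2: "side_mem s n g (if conf then insert v P else P) p (M2 qa) b0 b1 M2 Z W"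
      and out: "r2 19 = 0 \<and> \<not> conf \<and> side_stop n g p (M2 qa) b0 b1 M2 Z W \<or> r2 19 = 1 \<and> refuted s n g Z W p"
      and t2: "t2 + 60 * M qa \<le> t + 60 * M2 qa + 170" for r2 M2 t2
  proof -
    have low: "M2 a = M a" if "a \<le> B" for a using M2 X that unfolding same_except_def by (metis leD)
    have ZW: "zeros n M2 = Z" "ones n M2 = W"
      unfolding Z_def W_def using lay by (auto intro!: zeros_cong ones_cong low)
    have adv: "advances n E (r 7) M (r2 7) M2" unfolding r2(2) using lay \<tau> by (intro advances_same low) auto
    have G2: "fixed_state n \<Gamma> I E (r2 7) M2"
      unfolding r2(2) using lay \<tau> by (intro fixed_state_same[OF G] low) auto
    have P2: "pending E M2 h (r2 7) = P"
      unfolding P_def r2(2) pending_def using lay \<tau> by (intro image_cong low) auto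
    show ?thesis
    proof (cases "r2 19 = 0")
      case True
      then have "Q (r2, M2) (t2 + 2)"
        using r2 M2 q2 S2 out t2 adv G2 stop
        by (intro Q) (auto simp: ZW P2[unfolded r2(2)] Z_def W_def X_def same_except_def)
      then show ?thesis using True by simp
    next
      case False
      then have nr: "refuted s n g Z W p" using out by simp
      have K2: "base_regs n E r2" using K r2(1) unfolding base_regs_def same_except_def by auto
      have V: "valid_fixing n \<gamma> (zeros n M2) (ones n M2) (w, if s then 1 else 0)"
        using nr unfolding ZW w_def Z_def W_def g
        by (rule valid_fixing_refuted[OF \<gamma>(2) zeros_ones_subset(1) p])
      have i2: "r2 i = w" "i \<notin> {7, 20, 21}" using r2(1) iw unfolding same_except_def by auto
      have "wp (infeasible n \<Gamma> I T) (fix_code (if s then 3 else 4) (if s then 4 else 3) i) (r2, M2) (t2 + 2) Q"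
      proof (rule wp_fix[OF K2 G2 _ \<gamma>(1) i2(1) iw(3) i2(2) V])
        fix r3 M3 t3
        assume r3: "same_except {7, 20, 21} r2 r3" and G3: "fixed_state n \<Gamma> I E (r3 7) M3"
          and adv3: "advances n E (r2 7) M2 (r3 7) M3" and M3: "same_except (shared_cells n E) M2 M3"
          and Z3: "zeros n M3 = (if s then zeros n M2 else insert w (zeros n M2))"
          and W3: "ones n M3 = (if s then insert w (ones n M2) else ones n M2)" and t3: "t3 \<le> t2 + 2 + 20"
        have hi: "M3 a = M2 a" if "B \<le> a" for a
          using M3 that lay unfolding same_except_def shared_cells_def by auto
        have nl: "\<not> live s g (zeros n M3) (ones n M3) p" unfolding live_def Z3 W3 w_def by simp
        have mk: "marked n M3 b0 p = marked n M2 b0 p" "marked n M3 b1 p = marked n M2 b1 p"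
          unfolding b by (auto intro!: marked_cong hi)
        have "side_mem s n g (pending E M3 h (r3 7)) p (M3 qa) b0 b1 M3 (zeros n M3) (ones n M3)"
          unfolding side_mem_def mk
        proof (intro conjI)
          have "side_inv s n g Z W p (M3 qa) (marked n M2 b0 p) (marked n M2 b1 p)"
            using S2 hi[of qa] b(3) unfolding side_mem_def by auto
          then show "side_inv s n g (zeros n M3) (ones n M3) p (M3 qa) (marked n M2 b0 p) (marked n M2 b1 p)"
            by (rule side_mono) (use Z3 W3 ZW in auto)
          show "\<forall>v\<in>{1..n}. M3 (b0 + v) \<le> Suc p \<and> M3 (b1 + v) \<le> Suc p"
            using S2 hi b unfolding side_mem_def by simp
        qed (use nl in simp)
        moreover have "stop_at Suc g (zeros n M3) (ones n M3) p"
          using stop unfolding Z3 W3 ZW Z_def W_def w_def stop_at_def by auto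
        moreover have "same_except (shared_cells n E \<union> X) M M3"
          using M2 M3 unfolding same_except_def by auto
        moreover have "same_except ({7, 27} \<union> {13..21}) r r3"
          using r2(1) r3 unfolding same_except_def by auto
        moreover have "M3 qa = M2 qa" using hi b(3) by simp
        ultimately show "Q (r3, M3) t3"
          using advances_trans[OF adv adv3] G3 nl q2 t2 t3 by (intro Q) (simp_all add: X_def)
      next
        have "M2 qa \<le> n" using S2 side_pos unfolding side_mem_def by blast
        then show "t2 + 2 + 20 \<le> T" using t2 T by simp
      qed (use lay in simp)
      then show ?thesis using False by simp
    qed
  qed
  note final = this
  have "wp (infeasible n \<Gamma> I T) (side_run s) (r1, M) t1
      (\<lambda>s' t'. wp (infeasible n \<Gamma> I T) (IfZ 19 Skip (fix_code (if s then 3 else 4) (if s then 4 else 3) i)) s' t' Q)"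
    if r1: "same_except ({27} \<union> {13..21}) r r1" "r1 14 = b0" "r1 15 = b1" "r1 27 = qa" "r1 13 = M qa"
      "r1 19 = (if conf then 1 else 0)" and t1: "t1 \<le> t + 50" for r1 t1
  proof -
    have K1: "base_regs n E r1" using K r1(1) unfolding base_regs_def same_except_def by auto
    have k1: "r1 10 = D" "r1 12 = p" "r1 24 = Suc p" "r1 25 = g p"
      using R r1(1) unfolding same_except_def by auto
    have out: "r1 19 = 0 \<or> r1 19 = 1 \<and> refuted s n g Z W p" using r1(6) ref by auto
    have lay': "E \<le> b0" "b0 + n \<le> b1" "E \<le> qa" "qa \<notin> mark_cells n b0 b1"
      using lay b unfolding mark_cells_def by (auto split: if_splits)
    show ?thesis
    proof (rule wp_side_run[OF K1 k1 r1(2-5) out perm rng inj lay(1,2) lay' p Z_def W_def _ _ S'])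
      show "\<forall>i<p. eq_at Suc g Z W i" "stop_at Suc g Z W p" using eq stop unfolding Z_def W_def by auto
      fix r2 M2 t2
      assume r2: "same_except {13, 16, 17, 18, 19, 20, 21} r1 r2"
        and A: "same_except (insert qa (mark_cells n b0 b1)) M M2" "M qa \<le> M2 qa"
          "side_mem s n g (if conf then insert v P else P) p (M2 qa) b0 b1 M2 Z W"
          "r2 19 = 0 \<and> side_stop n g p (M2 qa) b0 b1 M2 Z W \<or> r2 19 = 1 \<and> refuted s n g Z W p"
          "r2 19 = 0 \<longrightarrow> r1 19 = 0" "t2 + 60 * M qa \<le> t1 + 60 * M2 qa + 100"
      show "wp (infeasible n \<Gamma> I T) (IfZ 19 Skip (fix_code (if s then 3 else 4) (if s then 4 else 3) i)) (r2, M2) t2 Q"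
        using r1(1,6) r2 A t1 by (intro final) (auto simp: X_def same_except_def)
    qed simp_all
  qed
  note run = this
  define r0 where "r0 = r(19 := 0, 14 := b0, 15 := b1, 27 := qa, 13 := M qa)"
  have K0: "base_regs n E r0" using K unfolding base_regs_def r0_def by simp
  have r0: "r0 8 = v" "r0 12 = p" "r0 14 = b0" "r0 15 = b1" using R unfolding r0_def by simp_all
  have "wp (infeasible n \<Gamma> I T) conflict_code (r0, M) t0 (\<lambda>s' t'. wp (infeasible n \<Gamma> I T) (side_run s) s' t'
      (\<lambda>s' t'. wp (infeasible n \<Gamma> I T) (IfZ 19 Skip (fix_code (if s then 3 else 4) (if s then 4 else 3) i)) s' t' Q))"
    if "t0 \<le> t + 30" for t0
  proof (rule wp_conflict[OF K0 r0(1) R(2) r0(2-4)])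
    fix r1 t1
    assume r1: "same_except {19, 20} r0 r1" and t1: "t1 \<le> t0 + 20"
      and r19: "r1 19 = (if v \<in> marked n M b0 p \<inter> ones n M \<or> v \<in> marked n M b1 p \<inter> zeros n M
        then 1 else r0 19)"
    have "same_except ({27} \<union> {13..21}) r r1" using r1 unfolding same_except_def r0_def by auto
    moreover have "r1 14 = b0" "r1 15 = b1" "r1 27 = qa" "r1 13 = M qa"
      using r1 unfolding same_except_def r0_def by simp_all
    moreover have "r1 19 = (if conf then 1 else 0)" using r19 unfolding conf_def Z_def W_def by (simp add: r0_def)
    ultimately show "wp (infeasible n \<Gamma> I T) (side_run s) (r1, M) t1
      (\<lambda>s' t'. wp (infeasible n \<Gamma> I T) (IfZ 19 Skip (fix_code (if s then 3 else 4) (if s then 4 else 3) i)) s' t' Q)"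
      using t1 that by (intro run) simp_all
  qed
  moreover have "\<exists>t0\<le>t + 30. wp (infeasible n \<Gamma> I T) (side_init s) (r, M) t Q' = Q' (r0, M) t0" for Q'
    by (intro exI[of _ "if s then Suc (Suc (Suc (Suc (Suc (Suc (Suc t))))))
          else Suc (Suc (Suc (Suc (Suc (Suc (Suc (Suc t)))))))"])
      (simp add: side_init_def k R b r0_def)
  ultimately show ?thesis unfolding side_code_def i_def wp_Seq by blast
qed

section \<open>Advance of the main position by the program\<close>

lemma wp_main:
  assumes K: "base_regs n E r" and R: "r 10 = D" "r 12 = p0" "r 18 = n - p0" "p0 \<le> n"
    and \<gamma>: "\<gamma> \<in> \<Gamma>" "\<gamma> permutes {1..n}" and g: "g = preimage \<gamma>"
    and perm: "\<And>j. j < n \<Longrightarrow> M (D + j) = g j"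
    and lay: "2 * n + 1 < D" "D + n \<le> E"
    and G: "fixed_state n \<Gamma> I E (r 7) M"
    and eq: "\<forall>i<p0. eq_at Suc g (zeros n M) (ones n M) i"
    and Q: "\<And>r' M' t'. same_except ({7, 12} \<union> {13..21}) r r' \<Longrightarrow> fixed_state n \<Gamma> I E (r' 7) M' \<Longrightarrow>
      advances n E (r 7) M (r' 7) M' \<Longrightarrow> same_except (shared_cells n E) M M' \<Longrightarrow>
      p0 \<le> r' 12 \<Longrightarrow> r' 12 \<le> n \<Longrightarrow>
      \<forall>i<r' 12. eq_at Suc g (zeros n M') (ones n M') i \<Longrightarrow>
      (r' 12 < n \<Longrightarrow> stop_at Suc g (zeros n M') (ones n M') (r' 12)) \<Longrightarrow>
      t' + 60 * p0 \<le> t + 60 * r' 12 + 70 \<Longrightarrow> Q (r', M') t'"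
    and T: "t + 60 * n + 200 \<le> T"
  shows "wp (infeasible n \<Gamma> I T) (While 18 main_step) (r, M) t Q"
proof -
  define J :: "store \<Rightarrow> nat \<Rightarrow> bool" where "J = (\<lambda>(r', M') t'.
      same_except ({7, 12} \<union> {13..21}) r r' \<and> fixed_state n \<Gamma> I E (r' 7) M' \<and>
      advances n E (r 7) M (r' 7) M' \<and> same_except (shared_cells n E) M M' \<and>
      p0 \<le> r' 12 \<and> r' 12 \<le> n \<and>
      (\<forall>i<r' 12. eq_at Suc g (zeros n M') (ones n M') i) \<and>
      (r' 18 \<noteq> 0 \<longrightarrow> r' 18 = n - r' 12) \<and>
      (r' 18 = 0 \<longrightarrow> r' 12 < n \<longrightarrow> stop_at Suc g (zeros n M') (ones n M') (r' 12)) \<and>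
      t' + 60 * p0 \<le> t + 60 * r' 12 + (if r' 18 = 0 then 60 else 0))"
  have init: "J (r, M) t"
    using R G eq unfolding J_def by (auto simp: same_except_refl advances_refl)
  show ?thesis
  proof (rule wp_While[where I = J and \<mu> = "\<lambda>(r', M'). n - r' 12 + (if r' 18 = 0 then 0 else 1)"])
    show "J (r, M) t" by (rule init)
  next
    fix s' t' assume "J s' t'" "fst s' 18 = 0"
    then show "Q s' (t' + 1)" unfolding J_def by (cases s') (auto intro: Q)
  next
    fix s' t1 assume J: "J s' t1" and nz: "fst s' 18 \<noteq> 0"
    obtain r1 M1 where s': "s' = (r1, M1)" by (cases s')
    define p where "p = r1 12"
    define Z where "Z = zeros n M1"
    define W where "W = ones n M1"
    have r1: "same_except ({7, 12} \<union> {13..21}) r r1" and G1: "fixed_state n \<Gamma> I E (r1 7) M1"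
      and adv1: "advances n E (r 7) M (r1 7) M1" and M1: "same_except (shared_cells n E) M M1"
      and p0: "p0 \<le> p" and eq1: "\<forall>i<p. eq_at Suc g Z W i"
      and r18: "r1 18 = n - p" and t1: "t1 + 60 * p0 \<le> t + 60 * p"
      using J nz unfolding J_def s' p_def Z_def W_def by (auto split: if_splits)
    have pn: "p < n" using nz r18 unfolding s' by auto
    have K1: "base_regs n E r1" using K r1 unfolding base_regs_def same_except_def by auto
    have k: "r1 (Suc 0) = n" "r1 2 = 1" "r1 3 = 1" "r1 4 = Suc n" "r1 10 = D" "r1 12 = p"
      using r1 K1 R unfolding same_except_def base_regs_def p_def by auto
    have gp: "g p \<in> {1..n}" using preimage_range[OF \<gamma>(2) pn] g by simp
    have Mg: "M1 (D + p) = g p"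
      using M1 perm[OF pn] pn lay unfolding same_except_def shared_cells_def by auto
    have z: "M1 (Suc v) = 0 \<longleftrightarrow> v \<notin> Z" and w: "M1 (Suc (n + v)) = 0 \<longleftrightarrow> v \<notin> W" if "v \<in> {1..n}" for v
      using that unfolding Z_def W_def zeros_def ones_def by auto
    define F where "F = (\<lambda>(r', M') t'. J (r', M') t' \<and>
      n - r' 12 + (if r' 18 = 0 then 0 else 1) < n - p + (1::nat))"
    have pass: "F (r2, M2) t2"
      if r2: "same_except ({7, 12} \<union> {13..21}) r1 r2" "r2 12 = Suc p" "r2 18 = n - Suc p"
        and M2: "fixed_state n \<Gamma> I E (r2 7) M2"
        "advances n E (r1 7) M1 (r2 7) M2" "same_except (shared_cells n E) M1 M2"
        "eq_at Suc g (zeros n M2) (ones n M2) p" and t2: "t2 \<le> t1 + 60"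
      for r2 M2 t2
    proof -
      have "\<forall>i<p. eq_at Suc g (zeros n M2) (ones n M2) i"
        using eq1 M2(2) eq_at_mono unfolding Z_def W_def advances_def by blast
      then have "\<forall>i<Suc p. eq_at Suc g (zeros n M2) (ones n M2) i" using M2(4) by (simp add: less_Suc_eq)
      moreover have "same_except ({7, 12} \<union> {13..21}) r r2" using r1 r2(1) unfolding same_except_def by simp
      moreover have "same_except (shared_cells n E) M M2" using M1 M2(3) unfolding same_except_def by simp
      ultimately show ?thesis
        using p0 t1 t2 pn r2(2,3) M2(1) advances_trans[OF adv1 M2(2)] unfolding F_def J_def by auto
    qed
    have fixed: "wp (infeasible n \<Gamma> I T) (fix_code (if s then 3 else 4) (if s then 4 else 3) i) (r2, M1) t2
        (\<lambda>s' t'. F (effect (Sub 18 1 12) (effect (Add 12 12 2) s')) (Suc (Suc t')))"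
      if r2: "same_except {16, 17, 18, 20, 21} r1 r2" "r2 i = u" "i \<notin> {7, 20, 21}"
        and t2: "t2 \<le> t1 + 25" and u: "u = (if s then Suc p else g p)"
        and c: "if s then g p \<in> W else Suc p \<in> Z" for r2 i t2 s u
    proof -
      have V: "valid_fixing n \<gamma> Z W (u, if s then 1 else 0)"
      proof -
        have x: "x (Suc p)" if "lex_sol n Suc g x" "extends Z W x" "x (g p)" for x
          by (rule lex_sol_at[OF that(1,2) eq1 pn that(3)])
        have Z: "Z \<subseteq> {1..n}" unfolding Z_def by (rule zeros_ones_subset)
        show ?thesis
        proof (cases s)
          case True
          have "valid_fixing n \<gamma> Z W (Suc p, 1)"
            by (rule valid_fixing_one[OF \<gamma>(2) Z])
              (use pn True c x in \<open>simp_all add: extends_def flip: g\<close>)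
          then show ?thesis using True u by simp
        next
          case False
          have "valid_fixing n \<gamma> Z W (g p, 0)"
            by (rule valid_fixing_zero[OF \<gamma>(2) Z gp])
              (use False c x in \<open>auto simp add: extends_def simp flip: g\<close>)
          then show ?thesis using False u by simp
        qed
      qed
      have K2: "base_regs n E r2" using K1 r2 unfolding base_regs_def same_except_def by auto
      have G2: "fixed_state n \<Gamma> I E (r2 7) M1" and e: "r2 7 = r1 7" "r2 12 = p"
        using G1 r2(1) k unfolding same_except_def by auto
      have un: "u \<in> {1..n}" using u gp pn by auto
      show ?thesis
      proof (rule wp_fix[OF K2 G2 _ \<gamma>(1) r2(2) un r2(3) V[unfolded Z_def W_def]])
        fix r3 M3 t3
        assume r3: "same_except {7, 20, 21} r2 r3" and G3: "fixed_state n \<Gamma> I E (r3 7) M3"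
          and adv3: "advances n E (r2 7) M1 (r3 7) M3" and M3: "same_except (shared_cells n E) M1 M3"
          and Z3: "zeros n M3 = (if s then zeros n M1 else insert u (zeros n M1))"
          and W3: "ones n M3 = (if s then insert u (ones n M1) else ones n M1)" and t3: "t3 \<le> t2 + 20"
        have "eq_at Suc g (zeros n M3) (ones n M3) p"
          unfolding Z3 W3 eq_at_def using u c unfolding Z_def W_def by auto
        moreover have "same_except ({7, 12} \<union> {13..21}) r1 r3"
          using r2(1) r3 unfolding same_except_def by auto
        moreover have "r3 12 = p" using r3 e unfolding same_except_def by simp
        moreover have "r3 2 = 1" "r3 1 = n" using r3 K2 unfolding same_except_def base_regs_def by simp_all
        ultimately show "F (effect (Sub 18 1 12) (effect (Add 12 12 2) (r3, M3))) (Suc (Suc t3))"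
          using G3 adv3 M3 t2 t3 e by (simp, intro pass) (simp_all add: same_except_def)
      qed (use lay t1 t2 pn T in simp_all)
    qed
    have halt: "F (r2, M1) t2"
      if "same_except {16, 17, 18, 20, 21} r1 r2" "r2 18 = 0" "t2 \<le> t1 + 60" "stop_at Suc g Z W p" for r2 t2
    proof -
      have "same_except ({7, 12} \<union> {13..21}) r r2" "r2 7 = r1 7" "r2 12 = p"
        using r1 that(1) k unfolding same_except_def by auto
      then show ?thesis using that p0 pn t1 G1 adv1 M1 eq1 unfolding F_def J_def Z_def W_def by auto
    qed
    have "wp (infeasible n \<Gamma> I T) main_step (r1, M1) (t1 + 2) F"
    proof (cases "Suc p = g p")
      case True
      then have "eq_at Suc g (zeros n M1) (ones n M1) p" unfolding eq_at_def by simp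
      then show ?thesis
        by (simp add: main_step_def k Mg flip: True)
          (rule pass, simp_all add: same_except_def k G1 advances_refl)
    next
      case False
      then have ne: "\<not> (Suc p \<le> g p \<and> g p \<le> Suc p)" by auto
      have zp: "M1 (Suc (Suc p)) = 0 \<longleftrightarrow> Suc p \<notin> Z" using z[of "Suc p"] pn by simp
      note F1 = fixed[of _ 16 "Suc p" _ True, simplified] and F2 = fixed[of _ 17 "g p" _ False, simplified]
      show ?thesis
        by (simp add: main_step_def k Mg ne w[OF gp] zp, intro conjI impI;
            (rule F1 | rule F2 | rule halt); simp add: same_except_def stop_at_def False)
    qed
    then show "wp (infeasible n \<Gamma> I T) main_step s' (t1 + 2)
        (\<lambda>s2 t2. J s2 t2 \<and> (case s2 of (r', M') \<Rightarrow> n - r' 12 + (if r' 18 = 0 then 0 else 1))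
           < (case s' of (r', M') \<Rightarrow> n - r' 12 + (if r' 18 = 0 then 0 else 1)))"
      unfolding s' by (rule wp_mono) (use nz in \<open>auto simp: F_def s' p_def\<close>)
  qed (auto simp: infeasible_def)
qed

section \<open>Stability of the block of one permutation\<close>

lemma side_mem_cong:
  assumes "\<forall>a\<in>mark_cells n b0 b1. M' a = M a"
  shows "side_mem s n g U p q b0 b1 M' Z W = side_mem s n g U p q b0 b1 M Z W"
    and "side_stop n g p q b0 b1 M' Z W = side_stop n g p q b0 b1 M Z W"
proof -
  have "marked n M' b0 p = marked n M b0 p" "marked n M' b1 p = marked n M b1 p"
    using assms unfolding mark_cells_def by (auto intro!: marked_cong)
  moreover have "M' (b0 + v) = M (b0 + v)" "M' (b1 + v) = M (b1 + v)" if "v \<in> {1..n}" for v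
    using assms that unfolding mark_cells_def by auto
  ultimately show "side_mem s n g U p q b0 b1 M' Z W = side_mem s n g U p q b0 b1 M Z W"
    "side_stop n g p q b0 b1 M' Z W = side_stop n g p q b0 b1 M Z W"
    unfolding side_mem_def side_stop_def by simp_all
qed

text \<open>A newly fixed variable may contradict a mark, but it has a queue entry and is thus
  unchecked in \<open>U'\<close>. Disjointness of the new sets ensures that no variable fixed
  earlier appears with the opposite value.\<close>

lemma side_mem_advances:
  assumes S: "side_mem s n g U p q b0 b1 M (zeros n M) (ones n M)"
    and adv: "advances n E \<tau> M \<tau>' M'" and disj: "zeros n M' \<inter> ones n M' = {}"
    and marks: "\<forall>a\<in>mark_cells n b0 b1. M' a = M a"
    and U: "U \<union> pending E M' \<tau> \<tau>' \<subseteq> U'"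
  shows "side_mem s n g U' p q b0 b1 M' (zeros n M') (ones n M')"
  unfolding side_mem_cong(1)[of n b0 b1 M' M, OF marks]
proof -
  have A: "zeros n M \<subseteq> zeros n M'" "ones n M \<subseteq> ones n M'"
    "(zeros n M' \<union> ones n M') - (zeros n M \<union> ones n M) \<subseteq> pending E M' \<tau> \<tau>'"
    using adv unfolding advances_def by auto
  have "side_inv s n g (zeros n M') (ones n M') p q (marked n M b0 p) (marked n M b1 p)"
    using S side_mono[OF _ A(1,2)] unfolding side_mem_def by blast
  moreover have "marked n M b0 p \<inter> ones n M' \<subseteq> U' \<and> marked n M b1 p \<inter> zeros n M' \<subseteq> U'"
    if "live s g (zeros n M') (ones n M') p"
  proof -
    have "live s g (zeros n M) (ones n M) p" using that A(1,2) unfolding live_def by (auto split: if_splits)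
    then have "marked n M b0 p \<inter> ones n M \<subseteq> U" "marked n M b1 p \<inter> zeros n M \<subseteq> U"
      using S unfolding side_mem_def by auto
    then show ?thesis using A U disj by blast
  qed
  ultimately show "side_mem s n g U' p q b0 b1 M (zeros n M') (ones n M')"
    using S unfolding side_mem_def by blast
qed

text \<open>Marks made at or before \<open>p\<close> are at most \<open>Suc p <= p'\<close>, so none
  of them counts for \<open>p'\<close>: all expire at once without being touched.\<close>

lemma side_mem_move:
  assumes S: "side_mem s n g U p q b0 b1 M Z W" and "p' \<le> n" "p < p'" "Z \<inter> W = {}"
    "\<forall>i<p'. eq_at Suc g Z W i" "p' < n \<Longrightarrow> stop_at Suc g Z W p'"
  shows "side_mem s n g U' p' q b0 b1 M Z W"
proof -
  have le: "M (b0 + v) \<le> p' \<and> M (b1 + v) \<le> p'" if "v \<in> {1..n}" for v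
    using S that \<open>p < p'\<close> unfolding side_mem_def by fastforce
  then have e: "marked n M b0 p' = {}" "marked n M b1 p' = {}" unfolding marked_def by force+
  have "side_inv s n g Z W p' q {} {}"
    using S side_move assms(2-6) unfolding side_mem_def by blast
  then show ?thesis unfolding side_mem_def e using le by (simp add: le_SucI)
qed

lemma side_restart: "side_inv s n g Z W p q T0 T1 \<Longrightarrow> q \<le> p \<Longrightarrow> T0 = {} \<and> T1 = {}"
  unfolding side_inv_def using lookaheadD(10) by (metis (full_types))

text \<open>For main position \<open>n\<close> the bound \<open>q <= n\<close> puts the lookahead
  not beyond the main position, where it has no tentative values; no queue entry is left to be
  compared with them.\<close>

lemma side_mem_end:
  assumes "side_mem s n g U n q b0 b1 M Z W"
  shows "side_mem s n g U' n q b0 b1 M Z W"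
proof -
  have "side_inv s n g Z W n q (marked n M b0 n) (marked n M b1 n)" using assms unfolding side_mem_def by blast
  then have "marked n M b0 n = {} \<and> marked n M b1 n = {}"
    using side_pos side_restart by blast
  then show ?thesis using assms unfolding side_mem_def by simp
qed

text \<open>\<open>U\<close> collects the fixed variables that this permutation has not yet compared
  with its marks.\<close>

definition block ::
    "nat \<Rightarrow> (nat \<Rightarrow> nat) \<Rightarrow> nat set \<Rightarrow> nat \<Rightarrow> (nat \<Rightarrow> nat) \<Rightarrow> bool" where
  "block n g U B M \<longleftrightarrow>
     M B \<le> n \<and> (\<forall>i<M B. eq_at Suc g (zeros n M) (ones n M) i) \<and>
     side_mem True n g U (M B) (M (B + 1)) (B + 2) (B + 2 + n) M (zeros n M) (ones n M) \<and>
     side_mem False n g U (M B) (M (B + 2)) (B + 2 + 2 * n) (B + 2 + 3 * n) M (zeros n M) (ones n M)"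

text \<open>Separate from \<open>block\<close> because it is unstable: a later fixing can turn a
  stop into a forced comparison. It is asserted only as long as the tail of the queue stays
  put.\<close>

definition settled :: "nat \<Rightarrow> (nat \<Rightarrow> nat) \<Rightarrow> nat \<Rightarrow> (nat \<Rightarrow> nat) \<Rightarrow> bool" where
  "settled n g B M \<longleftrightarrow> (M B < n \<longrightarrow>
     stop_at Suc g (zeros n M) (ones n M) (M B) \<and>
     (live True g (zeros n M) (ones n M) (M B) \<longrightarrow>
        side_stop n g (M B) (M (B + 1)) (B + 2) (B + 2 + n) M (zeros n M) (ones n M)) \<and>
     (live False g (zeros n M) (ones n M) (M B) \<longrightarrow>
        side_stop n g (M B) (M (B + 2)) (B + 2 + 2 * n) (B + 2 + 3 * n) M (zeros n M) (ones n M)))"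

definition block_cells :: "nat \<Rightarrow> nat \<Rightarrow> nat set" where
  "block_cells n B = {B..B + 4 * n + 2}"

text \<open>The potential that pays for the loop rounds spent on this permutation. Its three
  summands are positions that never decrease and never exceed \<open>n\<close>.\<close>

definition progress :: "nat \<Rightarrow> (nat \<Rightarrow> nat) \<Rightarrow> nat" where
  "progress B M = M B + M (B + 1) + M (B + 2)"

lemma pending_advances:
  assumes "advances n E \<tau> M \<tau>' M'" "h \<le> \<tau>"
  shows "pending E M h \<tau> \<union> pending E M' \<tau> \<tau>' = pending E M' h \<tau>'"
proof -
  have "pending E M h \<tau> = (\<lambda>j. M' (E + j)) ` {h..<\<tau>}"
    using assms(1) unfolding pending_def advances_def by (intro image_cong) auto
  moreover have "\<tau> \<le> \<tau>'" using assms(1) unfolding advances_def by simp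
  ultimately show ?thesis
    unfolding pending_def by (simp add: image_Un[symmetric] ivl_disj_un_two(3) assms(2))
qed

lemma block_advances:
  assumes b: "block n g U B M" and adv: "advances n E \<tau> M \<tau>' M'" and disj: "zeros n M' \<inter> ones n M' = {}"
    and cells: "\<And>a. a \<in> block_cells n B \<Longrightarrow> M' a = M a"
    and U: "U \<union> pending E M' \<tau> \<tau>' \<subseteq> U'"
  shows "block n g U' B M'" and "progress B M' = progress B M"
    and "\<tau>' = \<tau> \<Longrightarrow> settled n g B M' = settled n g B M"
proof -
  have c: "M' B = M B" "M' (B + 1) = M (B + 1)" "M' (B + 2) = M (B + 2)"
    using cells[of B] cells[of "B + 1"] cells[of "B + 2"] unfolding block_cells_def by auto
  have m: "\<forall>a\<in>mark_cells n (B + 2) (B + 2 + n). M' a = M a"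
    using cells unfolding mark_cells_def block_cells_def by auto
  have m': "\<forall>a\<in>mark_cells n (B + 2 + 2 * n) (B + 2 + 3 * n). M' a = M a"
    using cells unfolding mark_cells_def block_cells_def by auto
  have A: "zeros n M \<subseteq> zeros n M'" "ones n M \<subseteq> ones n M'" using adv unfolding advances_def by auto
  show "block n g U' B M'"
    using b side_mem_advances[OF _ adv disj m U] side_mem_advances[OF _ adv disj m' U] eq_at_mono[OF _ A]
    unfolding block_def c by blast
  show "progress B M' = progress B M" unfolding progress_def c ..
  show "settled n g B M' = settled n g B M" if "\<tau>' = \<tau>"
  proof -
    have ZW: "zeros n M' = zeros n M" "ones n M' = ones n M" using adv that unfolding advances_def by auto
    show ?thesis
      unfolding settled_def c ZW side_mem_cong(2)[OF m] side_mem_cong(2)[OF m'] ..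
  qed
qed

section \<open>One permutation processed\<close>

lemma wp_process:
  assumes K: "base_regs n E r"
    and R: "r 8 = v" "v \<in> {1..n}" "r 10 = D" "r 11 = B"
    and \<gamma>: "\<gamma> \<in> \<Gamma>" "\<gamma> permutes {1..n}" and g: "g = preimage \<gamma>"
    and perm: "\<And>j. j < n \<Longrightarrow> M (D + j) = g j"
    and lay: "2 * n + 1 < D" "D + n \<le> E" "E + n < B"
    and G: "fixed_state n \<Gamma> I E (r 7) M"
    and b: "block n g (insert v (pending E M h (r 7))) B M" and h: "h \<le> r 7"
    and Q: "\<And>r' M' t'. same_except ({7, 12, 24, 25, 27} \<union> {13..21}) r r' \<Longrightarrow>
      fixed_state n \<Gamma> I E (r' 7) M' \<Longrightarrow> advances n E (r 7) M (r' 7) M' \<Longrightarrow>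
      same_except (shared_cells n E \<union> block_cells n B) M M' \<Longrightarrow>
      block n g (pending E M' h (r' 7)) B M' \<Longrightarrow> (r' 7 = r 7 \<Longrightarrow> settled n g B M') \<Longrightarrow>
      t' + 60 * progress B M \<le> t + 60 * progress B M' + 600 \<Longrightarrow> Q (r', M') t'"
    and T: "t + 180 * n + 700 \<le> T"
  shows "wp (infeasible n \<Gamma> I T) process_code (r, M) t Q"
proof -
  define p0 where "p0 = M B"
  have k: "r 11 = B" "r (Suc 0) = n" using K R unfolding base_regs_def by auto
  have p0: "p0 \<le> n" "\<forall>i<p0. eq_at Suc g (zeros n M) (ones n M) i"
    using b unfolding block_def p0_def by auto
  define qa where "qa s = B + (if s then 1 else 2)" for s
  define b0 where "b0 s = B + 2 + (if s then 0 else 2 * n)" for s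
  define b1 where "b1 s = b0 s + n" for s
  have cells: "B \<notin> insert (qa s) (mark_cells n (b0 s) (b1 s))" "insert (qa s) (mark_cells n (b0 s) (b1 s)) \<subseteq> block_cells n B"
    "qa s \<in> block_cells n B" "mark_cells n (b0 s) (b1 s) \<subseteq> block_cells n B"
    "\<forall>a\<in>insert (qa s) (mark_cells n (b0 s) (b1 s)). B < a"
    for s unfolding qa_def b0_def b1_def mark_cells_def block_cells_def by auto
  have apart: "insert (qa False) (mark_cells n (b0 False) (b1 False)) \<inter> insert (qa True) (mark_cells n (b0 True) (b1 True)) = {}"
    unfolding qa_def b0_def b1_def mark_cells_def by auto
  have above: "a \<notin> shared_cells n E" if "B \<le> a" for a using that lay unfolding shared_cells_def by auto
  have sep: "a \<notin> insert (qa s) (mark_cells n (b0 s) (b1 s))" if "a \<le> B" for a s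
    using cells(5)[of s] that by (meson leD)
  have abv: "B \<le> a" if "a \<in> insert (qa s) (mark_cells n (b0 s) (b1 s))" for a s
    using cells(5)[of s] that less_imp_le by blast
  have blk: "block n g U B N \<longleftrightarrow> N B \<le> n \<and> (\<forall>i<N B. eq_at Suc g (zeros n N) (ones n N) i) \<and>
      (\<forall>s. side_mem s n g U (N B) (N (qa s)) (b0 s) (b1 s) N (zeros n N) (ones n N))" for U N
    unfolding block_def qa_def b0_def b1_def by (auto simp: all_bool_eq algebra_simps)
  have stl: "settled n g B N \<longleftrightarrow> (N B < n \<longrightarrow> stop_at Suc g (zeros n N) (ones n N) (N B) \<and>
      (\<forall>s. live s g (zeros n N) (ones n N) (N B) \<longrightarrow>
        side_stop n g (N B) (N (qa s)) (b0 s) (b1 s) N (zeros n N) (ones n N)))" for N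
    unfolding settled_def qa_def b0_def b1_def by (auto simp: all_bool_eq algebra_simps)
  have prg: "progress B N = N B + N (qa True) + N (qa False)" for N
    unfolding progress_def qa_def by simp
  have side_keep: "side_mem s n g U' p (N' (qa s)) (b0 s) (b1 s) N' (zeros n N') (ones n N')"
    if "side_mem s n g U p (N (qa s)) (b0 s) (b1 s) N (zeros n N) (ones n N)" "advances n E \<tau> N \<tau>' N'"
      "fixed_state n \<Gamma> I E \<tau>' N'" "\<forall>a\<in>insert (qa s) (mark_cells n (b0 s) (b1 s)). N' a = N a"
      "U \<union> pending E N' \<tau> \<tau>' \<subseteq> U'" for s U U' p N N' \<tau> \<tau>'
    using side_mem_advances[OF that(1,2) _ _ that(5)] that(3,4) unfolding fixed_state_def by simp
  define r0 where "r0 = r(12 := p0, 18 := n - p0)"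
  have K0: "base_regs n E r0" using K unfolding base_regs_def r0_def by simp
  have r0: "r0 10 = D" "r0 12 = p0" "r0 18 = n - p0" "r0 7 = r 7" using R unfolding r0_def by simp_all
  have sides: "wp (infeasible n \<Gamma> I T) (side_code True) (r1, M1) t1
      (\<lambda>s' t'. wp (infeasible n \<Gamma> I T) (side_code False) s' t' Q)"
    if r1: "same_except ({7, 12, 24, 25} \<union> {13..21}) r r1" and p1: "M1 B = p1" "r1 12 = p1" "p0 \<le> p1" "p1 < n"
      and r1': "r1 24 = Suc p1" "r1 25 = g p1"
      and G1: "fixed_state n \<Gamma> I E (r1 7) M1" and adv1: "advances n E (r 7) M (r1 7) M1"
      and M1: "same_except (insert B (shared_cells n E)) M M1"
      and eq1: "\<forall>i<p1. eq_at Suc g (zeros n M1) (ones n M1) i"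
      and stop1: "stop_at Suc g (zeros n M1) (ones n M1) p1"
      and S1: "\<And>s. side_mem s n g (insert v (pending E M1 h (r1 7))) p1 (M1 (qa s)) (b0 s) (b1 s) M1 (zeros n M1) (ones n M1)"
      and t1: "t1 + 60 * p0 \<le> t + 60 * p1 + 100" for r1 M1 t1 p1
  proof -
    have K1: "base_regs n E r1" using K r1 unfolding base_regs_def same_except_def by auto
    have k1: "r1 8 = v" "r1 10 = D" "r1 11 = B" using R r1 unfolding same_except_def by auto
    have perm1: "M1 (D + j) = g j" if "j < n" for j
      using M1 perm[OF that] that lay unfolding same_except_def shared_cells_def by auto
    show ?thesis
    proof (rule wp_side[OF K1 k1(1) R(2) k1(2,3) p1(2) r1' \<gamma> g b0_def b1_def qa_def perm1 lay p1(4) G1 eq1 stop1 S1])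
      fix r2 M2 t2
      assume r2: "same_except ({7, 27} \<union> {13..21}) r1 r2" and G2: "fixed_state n \<Gamma> I E (r2 7) M2"
        and adv2: "advances n E (r1 7) M1 (r2 7) M2"
        and M2: "same_except (shared_cells n E \<union> insert (qa True) (mark_cells n (b0 True) (b1 True))) M1 M2"
        and q2: "M1 (qa True) \<le> M2 (qa True)"
        and S2: "side_mem True n g (pending E M2 h (r2 7)) p1 (M2 (qa True)) (b0 True) (b1 True) M2 (zeros n M2) (ones n M2)"
        and live2: "live True g (zeros n M2) (ones n M2) p1 \<Longrightarrow>
          side_stop n g p1 (M2 (qa True)) (b0 True) (b1 True) M2 (zeros n M2) (ones n M2)"
        and stop2: "stop_at Suc g (zeros n M2) (ones n M2) p1"
        and t2: "t2 + 60 * M1 (qa True) \<le> t1 + 60 * M2 (qa True) + 200"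
      have K2: "base_regs n E r2" using K1 r2 unfolding base_regs_def same_except_def by auto
      have k2: "r2 8 = v" "r2 10 = D" "r2 11 = B" "r2 12 = p1" "r2 24 = Suc p1" "r2 25 = g p1"
        using k1 p1 r1' r2 unfolding same_except_def by auto
      have perm2: "M2 (D + j) = g j" if "j < n" for j
      proof -
        have "D + j \<notin> shared_cells n E" using that lay unfolding shared_cells_def by auto
        moreover have "D + j \<le> B" using that lay by simp
        ultimately show ?thesis using M2 perm1[OF that] sep unfolding same_except_def by auto
      qed
      have h1: "h \<le> r1 7" using h adv1 unfolding advances_def by simp
      have eq2: "\<forall>i<p1. eq_at Suc g (zeros n M2) (ones n M2) i"
        using eq1 adv2 eq_at_mono unfolding advances_def by blast
      have keep2: "M2 a = M1 a" if "B \<le> a" "a \<notin> insert (qa True) (mark_cells n (b0 True) (b1 True))" for a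
        using that above M2 unfolding same_except_def by auto
      have keep2': "\<forall>a\<in>insert (qa False) (mark_cells n (b0 False) (b1 False)). M2 a = M1 a"
        using keep2[OF abv[of _ False]] apart by blast
      \<comment> \<open>What the first lookahead has fixed is now in the queue, so it counts as
        unchecked for the second one.\<close>
      have S2': "side_mem False n g (insert v (pending E M2 h (r2 7))) p1 (M2 (qa False)) (b0 False) (b1 False) M2
          (zeros n M2) (ones n M2)"
        using pending_advances[OF adv2 h1] by (intro side_keep[OF S1 adv2 G2 keep2']) auto
      show "wp (infeasible n \<Gamma> I T) (side_code False) (r2, M2) t2 Q"
      proof (rule wp_side[OF K2 k2(1) R(2) k2(2-6) \<gamma> g b0_def b1_def qa_def perm2 lay p1(4) G2 eq2 stop2 S2'])
        fix r3 M3 t3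
        assume r3: "same_except ({7, 27} \<union> {13..21}) r2 r3" and G3: "fixed_state n \<Gamma> I E (r3 7) M3"
          and adv3: "advances n E (r2 7) M2 (r3 7) M3"
          and M3: "same_except (shared_cells n E \<union> insert (qa False) (mark_cells n (b0 False) (b1 False))) M2 M3"
          and q3: "M2 (qa False) \<le> M3 (qa False)"
          and S3: "side_mem False n g (pending E M3 h (r3 7)) p1 (M3 (qa False)) (b0 False) (b1 False) M3 (zeros n M3) (ones n M3)"
          and live3: "live False g (zeros n M3) (ones n M3) p1 \<Longrightarrow>
            side_stop n g p1 (M3 (qa False)) (b0 False) (b1 False) M3 (zeros n M3) (ones n M3)"
          and stop3: "stop_at Suc g (zeros n M3) (ones n M3) p1"
          and t3: "t3 + 60 * M2 (qa False) \<le> t2 + 60 * M3 (qa False) + 200"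
        have keep3: "M3 a = M2 a" if "B \<le> a" "a \<notin> insert (qa False) (mark_cells n (b0 False) (b1 False))" for a
          using that above M3 unfolding same_except_def by auto
        have keep3': "\<forall>a\<in>insert (qa True) (mark_cells n (b0 True) (b1 True)). M3 a = M2 a"
          using keep3[OF abv[of _ True]] apart by blast
        have MB: "M3 B = p1" using keep2[of B] keep3[of B] cells(1) p1(1) by simp
        have h2: "h \<le> r2 7" using h1 adv2 unfolding advances_def by simp
        have S3': "side_mem True n g (pending E M3 h (r3 7)) p1 (M3 (qa True)) (b0 True) (b1 True) M3
            (zeros n M3) (ones n M3)"
          using pending_advances[OF adv3 h2] by (intro side_keep[OF S2 adv3 G3 keep3']) auto
        have eq3: "\<forall>i<p1. eq_at Suc g (zeros n M3) (ones n M3) i"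
          using eq2 adv3 eq_at_mono unfolding advances_def by blast
        have blk3: "block n g (pending E M3 h (r3 7)) B M3"
          unfolding blk MB using S3 S3' eq3 p1(4) by (auto simp: all_bool_eq)
        have stl3: "settled n g B M3" if "r3 7 = r 7"
        proof -
          \<comment> \<open>An unchanged tail means that the second lookahead has fixed nothing
            after the first had reached its stop, so this stop is still one.\<close>
          have "r3 7 = r2 7" using that adv1 adv2 adv3 unfolding advances_def by linarith
          then have ZW: "zeros n M3 = zeros n M2" "ones n M3 = ones n M2"
            using adv3 unfolding advances_def by auto
          have "side_stop n g p1 (M3 (qa True)) (b0 True) (b1 True) M3 (zeros n M2) (ones n M2)
            = side_stop n g p1 (M2 (qa True)) (b0 True) (b1 True) M2 (zeros n M2) (ones n M2)"
            using keep3' side_mem_cong(2)[of n "b0 True" "b1 True" M3 M2] by simp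
          then show ?thesis unfolding stl MB using live2 live3 stop3 ZW by (simp add: all_bool_eq)
        qed
        have "same_except ({7, 12, 24, 25, 27} \<union> {13..21}) r r3"
          using r1 r2 r3 unfolding same_except_def by auto
        moreover have "same_except (shared_cells n E \<union> block_cells n B) M M3"
        proof -
          have "B \<in> block_cells n B" unfolding block_cells_def by simp
          then have *: "a \<noteq> B" "a \<notin> insert (qa s) (mark_cells n (b0 s) (b1 s))"
            if "a \<notin> shared_cells n E \<union> block_cells n B" for a s
            using that cells(2)[of s] by blast+
          show ?thesis unfolding same_except_def
          proof (intro allI impI)
            fix a assume a: "a \<notin> shared_cells n E \<union> block_cells n B"
            then have "M1 a = M a" using M1 *(1)[OF a] unfolding same_except_def by simp
            moreover have "M2 a = M1 a" using M2 a *(2)[OF a, of True] unfolding same_except_def by blast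
            moreover have "M3 a = M2 a" using M3 a *(2)[OF a, of False] unfolding same_except_def by blast
            ultimately show "M3 a = M a" by simp
          qed
        qed
        moreover have "t3 + 60 * progress B M \<le> t + 60 * progress B M3 + 600"
        proof -
          have "M1 (qa s) = M (qa s)" for s
            using M1 above[of "qa s"] cells(5)[of s] unfolding same_except_def by auto
          moreover have "M2 (qa False) = M1 (qa False)" "M3 (qa True) = M2 (qa True)"
            using keep2' keep3' by auto
          ultimately show ?thesis unfolding prg MB p0_def[symmetric] using t1 t2 t3 by simp
        qed
        ultimately show "Q (r3, M3) t3"
          using G3 advances_trans[OF advances_trans[OF adv1 adv2] adv3] blk3 stl3 by (intro Q)
      next
        have "M2 (qa True) \<le> n" using S2 side_pos unfolding side_mem_def by blast
        then show "t2 + 60 * n + 300 \<le> T" using t1 t2 T p1(4) by simp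
      qed
    next
      show "t1 + 60 * n + 300 \<le> T" using t1 T p1(4) by simp
    qed
  qed
  have "wp (infeasible n \<Gamma> I T) (While 18 main_step) (r0, M) (t + 2)
      (\<lambda>s' t'. wp (infeasible n \<Gamma> I T) (Ins (Store 11 12) ;; Ins (Sub 20 1 12) ;; sides_code) s' t' Q)"
  proof (rule wp_main[OF K0 r0(1-3) p0(1) \<gamma> g perm lay(1,2) G[folded r0(4)] p0(2)])
    fix r1 M1 t1
    assume r1: "same_except ({7, 12} \<union> {13..21}) r0 r1" and G1: "fixed_state n \<Gamma> I E (r1 7) M1"
      and adv1: "advances n E (r0 7) M (r1 7) M1" and M1: "same_except (shared_cells n E) M M1"
      and p1: "p0 \<le> r1 12" "r1 12 \<le> n"
      and eq1: "\<forall>i<r1 12. eq_at Suc g (zeros n M1) (ones n M1) i"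
      and stop1: "r1 12 < n \<Longrightarrow> stop_at Suc g (zeros n M1) (ones n M1) (r1 12)"
      and t1: "t1 + 60 * p0 \<le> t + 2 + 60 * r1 12 + 70"
    define N where "N = M1(B := r1 12)"
    define p where "p = r1 12"
    have k1: "r1 11 = B" "r1 10 = D" "r1 (Suc 0) = n" "r1 2 = 1"
      using r1 R K unfolding same_except_def r0_def base_regs_def by auto
    have \<tau>: "r1 7 \<le> Suc n" by (rule fixed_state_tail[OF G1])
    have N: "N a = M1 a" if "a \<noteq> B" for a using that unfolding N_def by simp
    have NB: "N B = p" unfolding N_def p_def by simp
    have ZW: "zeros n N = zeros n M1" "ones n N = ones n M1"
      using lay by (auto intro!: zeros_cong ones_cong N)
    have GN: "fixed_state n \<Gamma> I E (r1 7) N" using lay \<tau> by (intro fixed_state_same[OF G1] N) auto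
    have "advances n E (r1 7) M1 (r1 7) N" using lay \<tau> by (intro advances_same N) auto
    then have advN: "advances n E (r 7) M (r1 7) N" using advances_trans adv1 r0(4) by metis
    have MN: "same_except (insert B (shared_cells n E)) M N"
      using M1 unfolding same_except_def N_def by simp
    have keep: "\<forall>a\<in>insert (qa s) (mark_cells n (b0 s) (b1 s)). N a = M a" for s
    proof
      fix a assume a: "a \<in> insert (qa s) (mark_cells n (b0 s) (b1 s))"
      then have "a \<noteq> B" "a \<notin> shared_cells n E" using sep[of B s] above[OF abv[OF a]] by auto
      then show "N a = M a" using MN unfolding same_except_def by simp
    qed
    have old: "side_mem s n g (insert v (pending E N h (r1 7))) p0 (N (qa s)) (b0 s) (b1 s) N (zeros n N) (ones n N)" for s
      using b pending_advances[OF advN h] unfolding blk p0_def[symmetric]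
      by (intro side_keep[OF _ advN GN keep]) auto
    have new: "side_mem s n g (insert v (pending E N h (r1 7))) p (N (qa s)) (b0 s) (b1 s) N (zeros n N) (ones n N)" for s
    proof (cases "p = p0")
      case True
      then show ?thesis using old by simp
    next
      case False
      then show ?thesis
        using p1 eq1 stop1 GN unfolding p_def fixed_state_def ZW
        by (intro side_mem_move[OF old[unfolded ZW]]) auto
    qed
    have reg: "same_except ({7, 12} \<union> {13..21}) r r1" using r1 unfolding same_except_def r0_def by auto
    show "wp (infeasible n \<Gamma> I T) (Ins (Store 11 12) ;; Ins (Sub 20 1 12) ;; sides_code) (r1, M1) t1 Q"
    proof (cases "p = n")
      case True
      have "block n g (pending E N h (r1 7)) B N"
        unfolding blk NB using eq1 new side_mem_end True unfolding ZW p_def by blast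
      moreover have "settled n g B N" unfolding stl NB using True by simp
      moreover have "same_except (shared_cells n E \<union> block_cells n B) M N"
        using MN unfolding same_except_def block_cells_def by auto
      moreover have "Suc (Suc (Suc (Suc t1))) + 60 * progress B M \<le> t + 60 * progress B N + 600"
        unfolding prg NB p0_def[symmetric] using t1 keep[of True] keep[of False] by (simp add: p_def)
      ultimately have "Q (r1(20 := 0), N) (Suc (Suc (Suc (Suc t1))))"
        using GN advN reg by (intro Q) (auto simp: same_except_def)
      then show ?thesis using True unfolding N_def p_def by (simp add: k1 sides_code_def)
    next
      case False
      then have pn: "p < n" using p1 unfolding p_def by simp
      have Np: "N (D + p) = g p" using MN perm[OF pn] pn lay unfolding same_except_def shared_cells_def by auto
      have "wp (infeasible n \<Gamma> I T) (side_code True) (r1(20 := n - p, 24 := Suc p, 25 := g p), N)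
        (Suc (Suc (Suc (Suc (Suc (Suc (Suc t1)))))))
        (\<lambda>s' t'. wp (infeasible n \<Gamma> I T) (side_code False) s' t' Q)"
        using reg NB p1(1) pn GN advN MN eq1 stop1 new t1
        by (intro sides[of _ _ p]) (auto simp: same_except_def p_def ZW)
      then show ?thesis using pn Np unfolding N_def p_def by (simp add: k1 sides_code_def)
    qed
  next
    show "t + 2 + 60 * n + 200 \<le> T" using T by simp
  qed
  then show ?thesis
    by (simp add: process_code_def k p0_def[symmetric] r0_def)
qed

section \<open>Sweeps over all permutations and the total time\<close>

locale symmetries =
  fixes n :: nat and \<gamma>s :: "(nat \<Rightarrow> nat) list" and I :: "nat set \<times> nat set"
  assumes n: "1 \<le> n" and perms: "\<And>\<gamma>. \<gamma> \<in> set \<gamma>s \<Longrightarrow> \<gamma> permutes {1..n}"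
begin

abbreviation m :: nat where "m \<equiv> length \<gamma>s"
text \<open>\<open>E\<close> is the first cell behind the input: two numbers, \<open>2 * n\<close>
  flags and \<open>2 * n\<close> cells per permutation. \<open>D k\<close> skips the forward array
  of permutation \<open>k\<close>, since only its inverse is read. \<open>B k\<close> leaves
  \<open>n + 1\<close> cells for the queue.\<close>

definition E :: nat where "E = 2 + 2 * n + 2 * n * m"
definition D :: "nat \<Rightarrow> nat" where "D k = 2 + 3 * n + 2 * n * k"
definition B :: "nat \<Rightarrow> nat" where "B k = E + n + 1 + (4 * n + 3) * k"
definition g :: "nat \<Rightarrow> nat \<Rightarrow> nat" where "g k = preimage (\<gamma>s ! k)"

definition total :: "(nat \<Rightarrow> nat) \<Rightarrow> nat" where "total M = (\<Sum>i<m. progress (B i) M)"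

text \<open>The first \<open>k\<close> permutations have processed the queue up to position \<open>h\<close>, the others have yet to
  process \<open>v\<close>.\<close>

definition sweep_inv :: "nat \<Rightarrow> nat \<Rightarrow> nat \<Rightarrow> nat \<Rightarrow> (nat \<Rightarrow> nat) \<Rightarrow> bool" where
  "sweep_inv k h v \<tau> M \<longleftrightarrow>
     fixed_state n (set \<gamma>s) I E \<tau> M \<and> h \<le> \<tau> \<and> (\<forall>i<m. \<forall>j<n. M (D i + j) = g i j) \<and>
     (\<forall>i<k. block n (g i) (pending E M h \<tau>) (B i) M \<and> (\<tau> = h \<longrightarrow> settled n (g i) (B i) M)) \<and>
     (\<forall>i. k \<le> i \<and> i < m \<longrightarrow> block n (g i) (insert v (pending E M h \<tau>)) (B i) M)"

lemma layout:
  assumes "k < m"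
  shows "2 * n + 1 < D k" "D k + n \<le> E" "E + n < B k"
proof -
  have "2 * n * Suc k \<le> 2 * n * m" using assms by (intro mult_le_mono2) simp
  then show "D k + n \<le> E" by (simp add: D_def E_def)
  show "2 * n + 1 < D k" "E + n < B k" using n by (simp_all add: D_def B_def)
qed

lemma blocks_disjoint:
  assumes "i \<noteq> k"
  shows "block_cells n (B i) \<inter> block_cells n (B k) = {}"
proof -
  have "block_cells n (B i) \<inter> block_cells n (B k) = {}" if "i < k" for i k
  proof -
    have "(4 * n + 3) * Suc i \<le> (4 * n + 3) * k" using that by (intro mult_le_mono2) simp
    then have "B i + (4 * n + 3) \<le> B k" by (simp add: B_def)
    then show ?thesis unfolding block_cells_def by auto
  qed
  from this[of i k] this[of k i] assms show ?thesis by (cases "i < k") auto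
qed

lemma block_shared_disjoint: "k < m \<Longrightarrow> block_cells n (B k) \<inter> shared_cells n E = {}"
  using layout[of k] unfolding block_cells_def shared_cells_def by auto

lemma block_progress: "block n f U b M \<Longrightarrow> progress b M \<le> 3 * n"
  unfolding block_def progress_def side_mem_def by (auto dest!: side_pos)

lemma total_bound:
  assumes "sweep_inv k h v \<tau> M"
  shows "total M \<le> 3 * (n * m)"
proof -
  have "progress (B i) M \<le> 3 * n" if "i < m" for i
    using assms that block_progress unfolding sweep_inv_def by (metis not_le)
  then have "total M \<le> (\<Sum>i<m. 3 * n)" unfolding total_def by (intro sum_mono) simp
  then show ?thesis by (simp add: ac_simps)
qed

text \<open>In the time limit, \<open>360 * (n * m)\<close> is twice
  \<open>60 * (3 * (n * m))\<close>: one half bounds the progress already paid for by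
  \<open>total_bound\<close>, the other is the reserve for the next call. The clause for
  \<open>m = 0\<close> stops the rounds after the dummy entry, as the limit then has to be
  constant.\<close>

lemma wp_sweep:
  assumes K: "base_regs n E r" and R: "r 29 = m" "r 30 = D 0" "r 31 = B 0" "r 23 = 4 * n + 3"
      "r 8 = v" "v \<in> {1..n}"
    and S: "sweep_inv 0 h v (r 7) M"
    and Q: "\<And>r' M' t'. same_except ({7, 24, 25, 27} \<union> {9..21}) r r' \<Longrightarrow> sweep_inv m h v (r' 7) M' \<Longrightarrow>
      (m = 0 \<Longrightarrow> r' 7 = r 7) \<Longrightarrow> t' + 60 * total M \<le> t + 60 * total M' + 700 * m + 10 \<Longrightarrow> Q (r', M') t'"
    and T: "t + 360 * (n * m) + 700 * m + 800 \<le> T"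
  shows "wp (infeasible n (set \<gamma>s) I T) sweep_code (r, M) t Q"
proof -
  define J :: "store \<Rightarrow> nat \<Rightarrow> bool" where "J = (\<lambda>(r', M') t'. \<exists>k\<le>m.
      same_except ({7, 24, 25, 27} \<union> {9..21}) r r' \<and> r' 9 = m - k \<and> r' 10 = D k \<and> r' 11 = B k \<and>
      sweep_inv k h v (r' 7) M' \<and> (k = 0 \<longrightarrow> r' 7 = r 7) \<and>
      t' + 60 * total M \<le> t + 60 * total M' + 700 * k + 5)"
  have r0: "r 0 = 0" using K unfolding base_regs_def by simp
  have "wp (infeasible n (set \<gamma>s) I T)
      (While 9 (process_code ;; Ins (Add 10 10 22) ;; Ins (Add 11 11 23) ;; Ins (Sub 9 9 2)))
      (r(9 := m, 10 := D 0, 11 := B 0), M) (Suc (Suc (Suc t))) Q"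
  proof (rule wp_While[where I = J and \<mu> = "\<lambda>(r', M'). r' 9"])
    show "J (r(9 := m, 10 := D 0, 11 := B 0), M) (Suc (Suc (Suc t)))"
      using S unfolding J_def by (auto simp: same_except_def intro!: exI[of _ 0])
  next
    fix s' t' assume "J s' t'" "fst s' 9 = 0"
    then show "Q s' (t' + 1)" unfolding J_def by (cases s') (auto intro: Q)
  next
    fix s' t1 assume J: "J s' t1" and nz: "fst s' 9 \<noteq> 0"
    obtain r1 M1 where s': "s' = (r1, M1)" by (cases s')
    obtain k where k: "k \<le> m" and r1: "same_except ({7, 24, 25, 27} \<union> {9..21}) r r1" "r1 9 = m - k"
      "r1 10 = D k" "r1 11 = B k" and S1: "sweep_inv k h v (r1 7) M1"
      and t1: "t1 + 60 * total M \<le> t + 60 * total M1 + 700 * k + 5"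
      using J unfolding J_def s' by auto
    have km: "k < m" using nz r1(2) unfolding s' by simp
    have \<gamma>: "\<gamma>s ! k \<in> set \<gamma>s" "\<gamma>s ! k permutes {1..n}" using km perms by auto
    have K1: "base_regs n E r1" using K r1 unfolding base_regs_def same_except_def by auto
    have k1: "r1 8 = v" "r1 22 = 2 * n" "r1 23 = 4 * n + 3" "r1 2 = 1"
      using r1(1) R K1 unfolding same_except_def base_regs_def by auto
    have G1: "fixed_state n (set \<gamma>s) I E (r1 7) M1" and h1: "h \<le> r1 7"
      and b1: "block n (g k) (insert v (pending E M1 h (r1 7))) (B k) M1"
      using S1 km unfolding sweep_inv_def by auto
    have perm1: "M1 (D i + j) = g i j" if "i < m" "j < n" for i j
      using S1 that unfolding sweep_inv_def by blast
    have "wp (infeasible n (set \<gamma>s) I T) process_code (r1, M1) (t1 + 2)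
        (\<lambda>s' t'. wp (infeasible n (set \<gamma>s) I T) (Ins (Add 10 10 22) ;; Ins (Add 11 11 23) ;; Ins (Sub 9 9 2)) s' t'
          (\<lambda>s2 t2. J s2 t2 \<and> (case s2 of (r', M') \<Rightarrow> r' 9) < r1 9))"
    proof (rule wp_process[OF K1 k1(1) R(6) r1(3,4) \<gamma> g_def perm1[OF km] layout[OF km] G1 b1 h1])
      fix r2 M2 t2
      assume r2: "same_except ({7, 12, 24, 25, 27} \<union> {13..21}) r1 r2" and G2: "fixed_state n (set \<gamma>s) I E (r2 7) M2"
        and adv: "advances n E (r1 7) M1 (r2 7) M2"
        and M2: "same_except (shared_cells n E \<union> block_cells n (B k)) M1 M2"
        and b2: "block n (g k) (pending E M2 h (r2 7)) (B k) M2"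
        and st2: "r2 7 = r1 7 \<Longrightarrow> settled n (g k) (B k) M2"
        and t2: "t2 + 60 * progress (B k) M1 \<le> t1 + 2 + 60 * progress (B k) M2 + 600"
      have disj: "zeros n M2 \<inter> ones n M2 = {}" using G2 unfolding fixed_state_def by blast
      have le: "r1 7 \<le> r2 7" using adv unfolding advances_def by simp
      have pend: "pending E M1 h (r1 7) \<union> pending E M2 (r1 7) (r2 7) = pending E M2 h (r2 7)"
        by (rule pending_advances[OF adv h1])
      have cells: "M2 a = M1 a" if "a \<in> block_cells n (B i)" "i < m" "i \<noteq> k" for a i
        using that M2 block_shared_disjoint[of i] blocks_disjoint[of i k] unfolding same_except_def by blast
      have past: "block n (g i) (pending E M2 h (r2 7)) (B i) M2 \<and> (r2 7 = h \<longrightarrow> settled n (g i) (B i) M2)"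
        if i: "i < Suc k" for i
      proof (cases "i = k")
        case True
        then show ?thesis using b2 st2 le h1 by auto
      next
        case False
        then have ik: "i < k" "i < m" using i km by auto
        note ba = block_advances[OF _ adv disj cells[OF _ ik(2) False]]
        have "block n (g i) (pending E M1 h (r1 7)) (B i) M1" and s1: "r1 7 = h \<longrightarrow> settled n (g i) (B i) M1"
          using S1 ik unfolding sweep_inv_def by auto
        then show ?thesis using ba(1) ba(3) pend le h1 by (metis le_antisym order_refl)
      qed
      have rest: "block n (g i) (insert v (pending E M2 h (r2 7))) (B i) M2" if i: "Suc k \<le> i" "i < m" for i
      proof -
        have "i \<noteq> k" using i by simp
        note ba = block_advances[OF _ adv disj cells[OF _ i(2) this]]
        have "block n (g i) (insert v (pending E M1 h (r1 7))) (B i) M1"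
          using S1 i unfolding sweep_inv_def by auto
        then show ?thesis using ba(1) pend by (metis Un_insert_left order_refl)
      qed
      have perm2: "M2 (D i + j) = g i j" if "i < m" "j < n" for i j
      proof -
        have "D i + j \<notin> shared_cells n E \<union> block_cells n (B k)"
          using layout[OF km] layout[OF that(1)] that(2) unfolding shared_cells_def block_cells_def by auto
        then show ?thesis using M2 perm1[OF that] unfolding same_except_def by simp
      qed
      have S2: "sweep_inv (Suc k) h v (r2 7) M2"
        unfolding sweep_inv_def using G2 h1 le perm2 past rest by (meson order_trans)
      have tot: "total M2 + progress (B k) M1 = total M1 + progress (B k) M2"
      proof -
        have "(\<Sum>i\<in>{..<m} - {k}. progress (B i) M2) = (\<Sum>i\<in>{..<m} - {k}. progress (B i) M1)"
        proof (rule sum.cong)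
          fix i assume "i \<in> {..<m} - {k}"
          then have i: "i < m" "i \<noteq> k" by auto
          show "progress (B i) M2 = progress (B i) M1"
            unfolding progress_def using cells[OF _ i] by (simp add: block_cells_def)
        qed simp
        then show ?thesis unfolding total_def using km by (simp add: sum.remove[of _ k])
      qed
      have r12: "same_except ({7, 24, 25, 27} \<union> {9..21}) r r2"
        by (rule same_except_trans[OF r1(1) r2]) auto
      have "J (r2(10 := D (Suc k), 11 := B (Suc k), 9 := m - Suc k), M2) (Suc (Suc (Suc t2)))"
        unfolding J_def prod.case
      proof (intro exI conjI)
        show "Suc k \<le> m" using km by simp
        show "same_except ({7, 24, 25, 27} \<union> {9..21}) r (r2(10 := D (Suc k), 11 := B (Suc k), 9 := m - Suc k))"
          using r12 unfolding same_except_def by simp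
      qed (use S2 t1 t2 tot in simp_all)
      moreover have "r2 10 = D k" "r2 11 = B k" "r2 9 = m - k" "r2 22 = 2 * n" "r2 23 = 4 * n + 3" "r2 2 = 1"
        using r1 k1 r2 unfolding same_except_def by auto
      moreover have "D k + 2 * n = D (Suc k)" "B k + (4 * n + 3) = B (Suc k)" by (simp_all add: D_def B_def)
      ultimately show "wp (infeasible n (set \<gamma>s) I T) (Ins (Add 10 10 22) ;; Ins (Add 11 11 23) ;; Ins (Sub 9 9 2)) (r2, M2) t2
          (\<lambda>s2 t2. J s2 t2 \<and> (case s2 of (r', M') \<Rightarrow> r' 9) < r1 9)"
        using km r1(2) by simp
    next
      define x where "x = n * m"
      have "n * Suc k \<le> x" using km unfolding x_def by (intro mult_le_mono2) simp
      then have "n \<le> x" by simp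
      moreover have "700 * k + 700 \<le> 700 * m" using km by simp
      moreover have "total M1 \<le> 3 * x" unfolding x_def by (rule total_bound[OF S1])
      moreover have "t + 360 * x + 700 * m + 800 \<le> T" using T unfolding x_def .
      ultimately show "t1 + 2 + 180 * n + 700 \<le> T" using t1 by linarith
    qed
    then show "wp (infeasible n (set \<gamma>s) I T)
        (process_code ;; Ins (Add 10 10 22) ;; Ins (Add 11 11 23) ;; Ins (Sub 9 9 2)) s' (t1 + 2)
        (\<lambda>s2 t2. J s2 t2 \<and> (case s2 of (r', M') \<Rightarrow> r' 9) < (case s' of (r', M') \<Rightarrow> r' 9))"
      by (simp only: s' wp_Seq prod.case)
  qed (auto simp: infeasible_def)
  then show ?thesis using R r0 by (simp add: sweep_code_def)
qed

text \<open>Each round removes one queue entry and the tail never exceeds \<open>Suc n\<close>,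
  which bounds the rounds. The term \<open>540 * (n * m)\<close> adds \<open>180 * (n * m)\<close>
  for the progress of earlier rounds to the reserve of a sweep.\<close>

lemma wp_rounds:
  assumes K: "base_regs n E r" and R: "r 29 = m" "r 30 = D 0" "r 31 = B 0" "r 23 = 4 * n + 3"
      "r 6 = 0" "r 7 = 1" "r 26 = 1"
    and S: "sweep_inv m 0 1 1 M"
    and Q: "\<And>r' M' t' h. same_except ({6, 7, 8, 24, 25, 26, 27} \<union> {9..21}) r r' \<Longrightarrow> sweep_inv m h 1 h M' \<Longrightarrow>
      (m = 0 \<Longrightarrow> h = 1) \<Longrightarrow> t' + 60 * total M \<le> t + 60 * total M' + h * (700 * m + 50) + 10 \<Longrightarrow> Q (r', M') t'"
    and T: "\<And>h. h \<le> n \<Longrightarrow> (m = 0 \<Longrightarrow> h = 0) \<Longrightarrow>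
      t + 540 * (n * m) + h * (700 * m + 50) + 700 * m + 900 \<le> T"
  shows "wp (infeasible n (set \<gamma>s) I T)
    (While 26
       (Ins (Add 20 5 6) ;; Ins (Load 8 20) ;; Ins (Add 6 6 2) ;; sweep_code ;;
        Ins (Sub 26 7 6))) (r, M) t Q"
proof -
  define J :: "store \<Rightarrow> nat \<Rightarrow> bool" where "J = (\<lambda>(r', M') t'. \<exists>h.
      same_except ({6, 7, 8, 24, 25, 26, 27} \<union> {9..21}) r r' \<and> r' 6 = h \<and> r' 26 = r' 7 - h \<and>
      sweep_inv m h 1 (r' 7) M' \<and> (m = 0 \<longrightarrow> r' 7 = 1) \<and>
      t' + 60 * total M \<le> t + 60 * total M' + h * (700 * m + 50))"
  show ?thesis
  proof (rule wp_While[where I = J and \<mu> = "\<lambda>(r', M'). Suc n - r' 6"])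
    show "J (r, M) t"
      using S R unfolding J_def by (auto simp: same_except_refl)
  next
    fix s' t' assume J: "J s' t'" and z: "fst s' 26 = 0"
    obtain r1 M1 where s': "s' = (r1, M1)" by (cases s')
    show "Q s' (t' + 1)"
      using J z unfolding J_def s' by (auto intro!: Q[where h = "r1 6"] simp: sweep_inv_def)
  next
    fix s' t1 assume J: "J s' t1" and nz: "fst s' 26 \<noteq> 0"
    obtain r1 M1 where s': "s' = (r1, M1)" by (cases s')
    define h where "h = r1 6"
    have r1: "same_except ({6, 7, 8, 24, 25, 26, 27} \<union> {9..21}) r r1" "r1 26 = r1 7 - h"
      and S1: "sweep_inv m h 1 (r1 7) M1" and m0: "m = 0 \<longrightarrow> r1 7 = 1"
      and t1: "t1 + 60 * total M \<le> t + 60 * total M1 + h * (700 * m + 50)"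
      using J unfolding J_def s' h_def by auto
    have h: "h < r1 7" using nz r1(2) unfolding s' by simp
    define v where "v = M1 (E + h)"
    have G1: "fixed_state n (set \<gamma>s) I E (r1 7) M1" using S1 unfolding sweep_inv_def by simp
    have v: "v \<in> {1..n}" and \<tau>: "r1 7 \<le> Suc n"
      using G1 h fixed_state_tail[OF G1] unfolding fixed_state_def v_def by auto
    have "{h..<r1 7} = insert h {Suc h..<r1 7}" using h by auto
    then have "pending E M1 h (r1 7) = insert v (pending E M1 (Suc h) (r1 7))"
      unfolding pending_def v_def by simp
    \<comment> \<open>Removing the head entry turns one pending variable into the variable
      \<open>v\<close> that every permutation has yet to process.\<close>
    then have S1': "sweep_inv 0 (Suc h) v (r1 7) M1"
      using S1 h unfolding sweep_inv_def by auto
    define r2 where "r2 = r1(20 := E + h, 8 := v, 6 := Suc h)"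
    have K1: "base_regs n E r1" using K r1 unfolding base_regs_def same_except_def by auto
    have k1: "r1 5 = E" "r1 6 = h" "r1 2 = 1" using K1 unfolding base_regs_def h_def by auto
    have K2: "base_regs n E r2" using K1 unfolding base_regs_def r2_def by simp
    have k2: "r2 29 = m" "r2 30 = D 0" "r2 31 = B 0" "r2 23 = 4 * n + 3" "r2 8 = v" "r2 7 = r1 7"
      using r1(1) R unfolding same_except_def r2_def by auto
    have "wp (infeasible n (set \<gamma>s) I T) sweep_code (r2, M1) (Suc (Suc (Suc (Suc (Suc t1)))))
        (\<lambda>s' t'. wp (infeasible n (set \<gamma>s) I T) (Ins (Sub 26 7 6)) s' t'
          (\<lambda>s2 t2. J s2 t2 \<and> (case s2 of (r', M') \<Rightarrow> Suc n - r' 6) < Suc n - h))"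
    proof (rule wp_sweep[OF K2 k2(1-5) v S1'[folded k2(6)]])
      fix r3 M3 t3
      assume r3: "same_except ({7, 24, 25, 27} \<union> {9..21}) r2 r3" and S3: "sweep_inv m (Suc h) v (r3 7) M3"
        and m3: "m = 0 \<Longrightarrow> r3 7 = r2 7" and t3: "t3 + 60 * total M1 \<le> Suc (Suc (Suc (Suc (Suc t1)))) + 60 * total M3 + 700 * m + 10"
      have e: "r3 6 = Suc h" using r3 unfolding same_except_def r2_def by simp
      have "J (r3(26 := r3 7 - Suc h), M3) (Suc t3)"
        unfolding J_def prod.case
      proof (intro exI conjI)
        show "same_except ({6, 7, 8, 24, 25, 26, 27} \<union> {9..21}) r (r3(26 := r3 7 - Suc h))"
          using r1(1) r3 unfolding same_except_def r2_def by simp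
        show "sweep_inv m (Suc h) 1 ((r3(26 := r3 7 - Suc h)) 7) M3"
          using S3 unfolding sweep_inv_def by auto
      qed (use e m0 m3 k2(6) t1 t3 in \<open>simp_all add: algebra_simps\<close>)
      then show "wp (infeasible n (set \<gamma>s) I T) (Ins (Sub 26 7 6)) (r3, M3) t3
          (\<lambda>s2 t2. J s2 t2 \<and> (case s2 of (r', M') \<Rightarrow> Suc n - r' 6) < Suc n - h)"
        using e h \<tau> by simp
    next
      have "total M1 \<le> 3 * (n * m)" by (rule total_bound[OF S1])
      moreover have "t + 540 * (n * m) + h * (700 * m + 50) + 700 * m + 900 \<le> T"
        using h \<tau> m0 by (intro T) auto
      ultimately show "Suc (Suc (Suc (Suc (Suc t1)))) + 360 * (n * m) + 700 * m + 800 \<le> T"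
        using t1 by simp
    qed
    then show "wp (infeasible n (set \<gamma>s) I T)
       (Ins (Add 20 5 6) ;; Ins (Load 8 20) ;; Ins (Add 6 6 2) ;; sweep_code ;; Ins (Sub 26 7 6)) s' (t1 + 2)
       (\<lambda>s2 t2. J s2 t2 \<and> (case s2 of (r', M') \<Rightarrow> Suc n - r' 6) < (case s' of (r', M') \<Rightarrow> Suc n - r' 6))"
      unfolding s' by (simp add: k1 r2_def v_def)
  qed (auto simp: infeasible_def)
qed

lemma wp_init:
  assumes M: "M 0 = n" "M 1 = m"
    and Q: "\<And>r' t'. base_regs n E r' \<Longrightarrow> r' 29 = m \<Longrightarrow> r' 30 = D 0 \<Longrightarrow> r' 31 = B 0 \<Longrightarrow> r' 23 = 4 * n + 3 \<Longrightarrow>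
      r' 6 = 0 \<Longrightarrow> r' 7 = 1 \<Longrightarrow> t' \<le> t + 30 + 10 * m \<Longrightarrow> Q (r', M(E := 1)) t'"
  shows "wp (infeasible n (set \<gamma>s) I T) init_code ((\<lambda>_. 0), M) t Q"
proof -
  define r0 :: "nat \<Rightarrow> nat" where "r0 = (\<lambda>_. 0)(1 := n, 2 := 1, 29 := m, 3 := 1, 4 := Suc n, 22 := n + n,
    20 := 2 + (n + n), 30 := 2 + (n + n) + n, 5 := 2 + (n + n), 9 := m)"
  define J :: "store \<Rightarrow> nat \<Rightarrow> bool" where "J = (\<lambda>(r', M') t'. M' = M \<and> r' 9 \<le> m \<and>
      same_except {5, 9} r0 r' \<and> r' 5 + 2 * n * r' 9 = E \<and> t' + 4 * r' 9 \<le> t + 11 + 4 * m)"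
  have "wp (infeasible n (set \<gamma>s) I T) (While 9 (Ins (Add 5 5 22) ;; Ins (Sub 9 9 2))) (r0, M)
      (Suc (Suc (Suc (Suc (Suc (Suc (Suc (Suc (Suc (Suc (Suc t)))))))))))
      (\<lambda>s' t'. wp (infeasible n (set \<gamma>s) I T) (Ins (Add 31 5 1) ;; Ins (Add 31 31 2) ;; Ins (Add 23 22 22) ;;
        Ins (Const 20 3) ;; Ins (Add 23 23 20) ;; Ins (Store 5 2) ;; Ins (Const 6 0) ;; Ins (Const 7 1)) s' t' Q)"
  proof (rule wp_While[where I = J and \<mu> = "\<lambda>(r', M'). r' 9"])
    show "J (r0, M) (Suc (Suc (Suc (Suc (Suc (Suc (Suc (Suc (Suc (Suc (Suc t)))))))))))"
      unfolding J_def by (simp add: same_except_refl r0_def E_def)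
  next
    fix s' t1 assume J: "J s' t1" and z: "fst s' 9 = 0"
    obtain r1 where s': "s' = (r1, M)" using J unfolding J_def by (cases s') auto
    have r1: "same_except {5, 9} r0 r1" "r1 5 = E" and t1: "t1 \<le> t + 11 + 4 * m"
      using J z unfolding J_def s' by auto
    have k1: "r1 (Suc 0) = n" "r1 2 = 1" "r1 22 = 2 * n" using r1(1) unfolding same_except_def r0_def by auto
    have "Q (r1(31 := Suc (E + n), 20 := 3, 23 := 4 * n + 3, 6 := 0, 7 := Suc 0), M(E := 1))
        (Suc (Suc (Suc (Suc (Suc (Suc (Suc (Suc (Suc t1)))))))))"
      using r1 t1 by (intro Q) (auto simp: base_regs_def same_except_def r0_def B_def D_def)
    then show "wp (infeasible n (set \<gamma>s) I T) (Ins (Add 31 5 1) ;; Ins (Add 31 31 2) ;; Ins (Add 23 22 22) ;;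
        Ins (Const 20 3) ;; Ins (Add 23 23 20) ;; Ins (Store 5 2) ;; Ins (Const 6 0) ;; Ins (Const 7 1)) s' (t1 + 1) Q"
      unfolding s' by (simp add: k1 r1(2) fun_upd_twist)
  next
    fix s' t1 assume J: "J s' t1" and nz: "fst s' 9 \<noteq> 0"
    obtain r1 where s': "s' = (r1, M)" using J unfolding J_def by (cases s') auto
    have r1: "same_except {5, 9} r0 r1" "r1 5 + 2 * n * r1 9 = E" "r1 9 \<le> m" and t1: "t1 + 4 * r1 9 \<le> t + 11 + 4 * m"
      using J unfolding J_def s' by auto
    obtain k where k: "r1 9 = Suc k" using nz unfolding s' by (cases "r1 9") auto
    have k1: "r1 2 = 1" "r1 22 = 2 * n" using r1(1) unfolding same_except_def r0_def by auto
    show "wp (infeasible n (set \<gamma>s) I T) (Ins (Add 5 5 22) ;; Ins (Sub 9 9 2)) s' (t1 + 2)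
        (\<lambda>s2 t2. J s2 t2 \<and> (case s2 of (r', M') \<Rightarrow> r' 9) < (case s' of (r', M') \<Rightarrow> r' 9))"
      using r1 t1 unfolding s' J_def by (simp add: k1 k same_except_def algebra_simps)
  qed (auto simp: infeasible_def)
  then show ?thesis
    by (simp add: init_code_def M(1) M(2)[simplified] r0_def fun_upd_twist)
qed

end

text \<open>With no unchecked variable left, the marks of every live lookahead agree with the fixed
  variables, so its stop yields a solution that contradicts the open fixing. These are the witnesses
  \<open>low\<close> and \<open>high\<close> for \<open>propagation_complete\<close>.\<close>

lemma settled_complete:
  assumes \<gamma>: "\<gamma> permutes {1..n}" and b: "block n (preimage \<gamma>) {} B M" and st: "settled n (preimage \<gamma>) B M"
    and disj: "zeros n M \<inter> ones n M = {}"
  shows "X_perm n \<gamma> \<inter> face n (zeros n M) (ones n M) \<noteq> {}"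
    and "complete_fixings n \<gamma> (zeros n M) (ones n M)"
proof -
  let ?g = "preimage \<gamma>" and ?Z = "zeros n M" and ?W = "ones n M" and ?p = "M B"
  have inj: "inj_on ?g {..<n}" by (rule inj_preimage[OF \<gamma>])
  have p: "?p \<le> n" and eq: "\<forall>i<?p. eq_at Suc ?g ?Z ?W i" using b unfolding block_def by auto
  have wit: "\<exists>x. lex_sol n Suc ?g x \<and> extends ?Z ?W x \<and> (if s then \<not> x (Suc ?p) else x (?g ?p))"
    if pl: "?p < n" "live s ?g ?Z ?W ?p" for s
  proof -
    have "\<exists>q b0 b1. side_mem s n ?g {} ?p q b0 b1 M ?Z ?W \<and> side_stop n ?g ?p q b0 b1 M ?Z ?W"
    proof (cases s)
      case True
      then have "side_stop n ?g ?p (M (B + 1)) (B + 2) (B + 2 + n) M ?Z ?W"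
        using st pl unfolding settled_def by simp
      then show ?thesis using b True unfolding block_def by auto
    next
      case False
      then have "side_stop n ?g ?p (M (B + 2)) (B + 2 + 2 * n) (B + 2 + 3 * n) M ?Z ?W"
        using st pl unfolding settled_def by simp
      then show ?thesis using b False unfolding block_def by auto
    qed
    then obtain q b0 b1 where S: "side_mem s n ?g {} ?p q b0 b1 M ?Z ?W"
      and E: "side_stop n ?g ?p q b0 b1 M ?Z ?W" by blast
    have iv: "side_inv s n ?g ?Z ?W ?p q (marked n M b0 ?p) (marked n M b1 ?p)"
      and nc: "marked n M b0 ?p \<inter> ?W = {}" "marked n M b1 ?p \<inter> ?Z = {}"
      using S pl(2) unfolding side_mem_def by auto
    have E1: "?p < q" "q < n \<Longrightarrow> stop_at Suc ?g (?Z \<union> marked n M b0 ?p) (?W \<union> marked n M b1 ?p) q"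
      using E unfolding side_stop_def by auto
    obtain x where "lex_sol n Suc ?g x" "extends ?Z ?W x" "if s then \<not> x (Suc ?p) else x (?g ?p)"
      by (rule side_witness[OF iv pl(1) E1(1) inj disj eq pl(2) E1(2) nc])
    then show ?thesis by blast
  qed
  have stop: "stop_at Suc ?g ?Z ?W ?p" if "?p < n" using st that unfolding settled_def by blast
  note C = propagation_complete[OF \<gamma> zeros_ones_subset disj p eq stop]
  have low: "\<exists>x. lex_sol n Suc ?g x \<and> extends ?Z ?W x \<and> \<not> x (Suc ?p)" if "?p < n" "Suc ?p \<notin> ?W"
    using wit[of True] that unfolding live_def by simp
  have high: "\<exists>x. lex_sol n Suc ?g x \<and> extends ?Z ?W x \<and> x (?g ?p)" if "?p < n" "?g ?p \<notin> ?Z"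
    using wit[of False] that unfolding live_def by simp
  show "X_perm n \<gamma> \<inter> face n ?Z ?W \<noteq> {}" by (rule C(1)[OF _ low high])
  show "complete_fixings n \<gamma> ?Z ?W" by (rule C(2)[OF _ low high])
qed

section \<open>Initial memory and the whole program\<close>

definition propagated ::
    "nat \<Rightarrow> (nat \<Rightarrow> nat) set \<Rightarrow> nat set \<times> nat set \<Rightarrow> nat \<Rightarrow> nat \<Rightarrow> store \<Rightarrow> nat \<Rightarrow> bool" where
  "propagated n \<Gamma> I E T = (\<lambda>(r, M) t.
     t \<le> T \<and> r 0 = 1 \<and> (\<exists>\<tau>. fixed_state n \<Gamma> I E \<tau> M) \<and>
     (\<forall>\<gamma>\<in>\<Gamma>. X_perm n \<gamma> \<inter> face n (zeros n M) (ones n M) \<noteq> {} \<and>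
       complete_fixings n \<gamma> (zeros n M) (ones n M)))"

context symmetries
begin

text \<open>A zeroed block says that all positions are \<open>0\<close> and that no variable is
  marked, since even a mark made at position \<open>0\<close> would be \<open>1\<close>.\<close>

lemma sweep_inv_init:
  assumes M: "\<And>a. E < a \<Longrightarrow> M a = 0" "M E = 1"
    and flags: "zeros n M = fst I" "ones n M = snd I" "\<And>v. v \<in> {1..n} \<Longrightarrow> M (1 + v) \<le> 1 \<and> M (1 + n + v) \<le> 1"
    and disj: "fst I \<inter> snd I = {}" and arr: "\<And>i j. i < m \<Longrightarrow> j < n \<Longrightarrow> M (D i + j) = g i j"
  shows "sweep_inv m 0 1 1 M" and "total M = 0"
proof -
  have z: "M a = 0" if "B k \<le> a" for k a using that M(1)[of a] by (simp add: B_def)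
  have mk: "marked n M (B k + c) 0 = {}" for k c using z[of k] unfolding marked_def by simp
  have S: "side_mem s n (g k) U 0 0 (B k + c) (B k + d) M Z W" for s k U c d Z W
    unfolding side_mem_def mk using z[of k] by (simp add: side_inv_def lookahead_empty)
  have "block n (g k) U (B k) M" for k U
    unfolding block_def using z[of k] S[of _ k U 2 "2 + n"] S[of _ k U "2 + 2 * n" "2 + 3 * n"]
    by (simp add: add.assoc)
  moreover have "fixed_state n (set \<gamma>s) I E 1 M"
    unfolding fixed_state_def using flags disj M(2) n by simp
  ultimately show "sweep_inv m 0 1 1 M" unfolding sweep_inv_def using arr by simp
  have "progress (B i) M = 0" for i unfolding progress_def using z[of i] by simp
  then show "total M = 0" unfolding total_def by simp
qed

lemma wp_propagation:
  assumes M: "\<And>a. E \<le> a \<Longrightarrow> M a = 0" "M 0 = n" "M 1 = m"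
    and flags: "zeros n M = fst I" "ones n M = snd I" "\<And>v. v \<in> {1..n} \<Longrightarrow> M (1 + v) \<le> 1 \<and> M (1 + n + v) \<le> 1"
    and disj: "fst I \<inter> snd I = {}" and arr: "\<And>i j. i < m \<Longrightarrow> j < n \<Longrightarrow> M (D i + j) = g i j"
    and T: "T = 4000 * max 1 (n * m)"
  shows "wp (infeasible n (set \<gamma>s) I T) propagation_code ((\<lambda>_. 0), M) 0
    (propagated n (set \<gamma>s) I E T)"
proof -
  \<comment> \<open>The origin of 4000: for positive \<open>m\<close>, \<open>h <= 2 * n\<close> and
    each of \<open>1\<close>, \<open>n\<close>, \<open>m\<close> is at most \<open>n * m\<close>, so
    the coefficients add up to 3781. For \<open>m = 0\<close> a single round leaves a constant of
    1081.\<close>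
  have bound: "31 + 10 * m + 540 * (n * m) + h * (700 * m + 50) + 700 * m + 1000 \<le> T"
    if "h \<le> Suc n" "m = 0 \<Longrightarrow> h \<le> 1" for h
  proof (cases "m = 0")
    case True
    then show ?thesis using that by (simp add: T)
  next
    case False
    then have m: "1 \<le> m" by linarith
    have 1: "n \<le> n * m" "m \<le> n * m" "1 \<le> n * m"
      using mult_le_mono2[OF m, of n] mult_le_mono1[OF n, of m] mult_le_mono[OF n m] by simp_all
    have "h * (700 * m + 50) \<le> 2 * n * (700 * m + 50)" using that(1) n by (intro mult_le_mono1) simp
    also have "\<dots> = 1400 * (n * m) + 100 * n" by (simp add: algebra_simps)
    finally have "h * (700 * m + 50) \<le> 1400 * (n * m) + 100 * n" .
    moreover have "T = 4000 * (n * m)" using 1 by (simp add: T max_def)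
    ultimately show ?thesis using 1 by linarith
  qed
  have lowM: "(M(E := 1)) a = M a" if "a < E" for a using that by simp
  have E: "2 * n + 1 < E" by (simp add: E_def)
  have f: "zeros n (M(E := 1)) = fst I" "ones n (M(E := 1)) = snd I"
    using zeros_ones_high[OF E] flags by simp_all
  have f3: "(M(E := 1)) (1 + v) \<le> 1 \<and> (M(E := 1)) (1 + n + v) \<le> 1" if "v \<in> {1..n}" for v
    using flags(3)[OF that] that E by simp
  have arr': "(M(E := 1)) (D i + j) = g i j" if "i < m" "j < n" for i j
    using arr[OF that] layout(2)[OF that(1)] that(2) by simp
  note I0 = sweep_inv_init[of "M(E := 1)", OF _ _ f f3 disj arr']
  have "wp (infeasible n (set \<gamma>s) I T) init_code ((\<lambda>_. 0), M) 0
    (\<lambda>s' t'. wp (infeasible n (set \<gamma>s) I T) (Ins (Const 26 1) ;;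
      While 26
       (Ins (Add 20 5 6) ;; Ins (Load 8 20) ;; Ins (Add 6 6 2) ;; sweep_code ;; Ins (Sub 26 7 6)) ;;
      Ins (Const 0 1)) s' t' (propagated n (set \<gamma>s) I E T))"
  proof (rule wp_init[OF M(2,3)])
    fix r1 t1
    assume r1: "base_regs n E r1" "r1 29 = m" "r1 30 = D 0" "r1 31 = B 0" "r1 23 = 4 * n + 3" "r1 6 = 0" "r1 7 = 1"
      and t1: "t1 \<le> 0 + 30 + 10 * m"
    define r2 where "r2 = r1(26 := 1)"
    have r2: "base_regs n E r2" "r2 29 = m" "r2 30 = D 0" "r2 31 = B 0" "r2 23 = 4 * n + 3" "r2 6 = 0" "r2 7 = 1" "r2 26 = 1"
      using r1 unfolding r2_def base_regs_def by simp_all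
    have "wp (infeasible n (set \<gamma>s) I T) (While 26
       (Ins (Add 20 5 6) ;; Ins (Load 8 20) ;; Ins (Add 6 6 2) ;; sweep_code ;; Ins (Sub 26 7 6))) (r2, M(E := 1)) (t1 + 1)
       (\<lambda>s' t'. wp (infeasible n (set \<gamma>s) I T) (Ins (Const 0 1)) s' t'
       (propagated n (set \<gamma>s) I E T))"
    proof (rule wp_rounds[OF r2 I0(1)])
      fix h assume "h \<le> n" "m = 0 \<Longrightarrow> h = 0"
      then show "t1 + 1 + 540 * (n * m) + h * (700 * m + 50) + 700 * m + 900 \<le> T"
        using bound[of h] t1 by simp
    next
      fix r3 M3 t3 h
      assume S3: "sweep_inv m h 1 h M3" and m0: "m = 0 \<Longrightarrow> h = 1"
        and t3: "t3 + 60 * total (M(E := 1)) \<le> t1 + 1 + 60 * total M3 + h * (700 * m + 50) + 10"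
      have G3: "fixed_state n (set \<gamma>s) I E h M3" using S3 unfolding sweep_inv_def by blast
      have disj3: "zeros n M3 \<inter> ones n M3 = {}" using G3 unfolding fixed_state_def by blast
      have "X_perm n \<gamma> \<inter> face n (zeros n M3) (ones n M3) \<noteq> {} \<and> complete_fixings n \<gamma> (zeros n M3) (ones n M3)"
        if \<gamma>: "\<gamma> \<in> set \<gamma>s" for \<gamma>
      proof -
        obtain k where k: "k < m" "\<gamma>s ! k = \<gamma>" using \<gamma> unfolding in_set_conv_nth by blast
        have "block n (g k) (pending E M3 h h) (B k) M3" "settled n (g k) (B k) M3"
          using S3 k(1) unfolding sweep_inv_def by simp_all
        then show ?thesis
          using settled_complete[OF perms[OF \<gamma>] _ _ disj3, of "B k"] k(2) unfolding g_def pending_def by simp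
      qed
      moreover have "Suc t3 \<le> T"
      proof -
        have "31 + 10 * m + 540 * (n * m) + h * (700 * m + 50) + 700 * m + 1000 \<le> T"
          using fixed_state_tail[OF G3] m0 by (intro bound) auto
        then show ?thesis using t3 t1 total_bound[OF S3] by linarith
      qed
      ultimately show "wp (infeasible n (set \<gamma>s) I T) (Ins (Const 0 1)) (r3, M3) t3
       (propagated n (set \<gamma>s) I E T)"
        using G3 by (auto simp: propagated_def)
    qed (use M(1) in auto)
    then show "wp (infeasible n (set \<gamma>s) I T) (Ins (Const 26 1) ;;
      While 26
       (Ins (Add 20 5 6) ;; Ins (Load 8 20) ;; Ins (Add 6 6 2) ;; sweep_code ;; Ins (Sub 26 7 6)) ;;
      Ins (Const 0 1)) (r1, M(E := 1)) t1 (propagated n (set \<gamma>s) I E T)"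
      unfolding wp_Seq[of _ "Ins (Const 26 1)"] wp_Seq[of _ "While _ _"] wp_Ins[of _ "Const 26 1"] effect_simps r2_def .
  qed
  then show ?thesis unfolding propagation_code_def wp_Seq[of _ init_code] .
qed

end

subsection \<open>Input and output\<close>

lemma nth_concat_uniform:
  assumes "\<And>xs. xs \<in> set xss \<Longrightarrow> length xs = l" "k < length xss" "j < l"
  shows "concat xss ! (l * k + j) = xss ! k ! j"
  using assms
proof (induction xss arbitrary: k)
  case (Cons xs xss)
  have l: "length xs = l" using Cons.prems(1) by simp
  show ?case
  proof (cases k)
    case 0
    then show ?thesis using l Cons.prems(3) by (simp add: nth_append)
  next
    case (Suc k')
    have "concat xss ! (l * k' + j) = xss ! k' ! j"
      using Cons.prems Suc by (intro Cons.IH) auto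
    then show ?thesis using l Suc by (simp add: nth_append algebra_simps)
  qed
qed simp

lemma length_concat_uniform:
  "(\<And>xs. xs \<in> set xss \<Longrightarrow> length xs = l) \<Longrightarrow> length (concat xss) = l * length xss"
  by (induction xss) auto

definition start_mem :: "nat list \<Rightarrow> nat \<Rightarrow> nat" where
  "start_mem xs a = (if a < length xs then xs ! a else 0)"

lemma start_mem_encode:
  fixes n :: nat and \<gamma>s :: "(nat \<Rightarrow> nat) list" and Z W :: "nat set"
  defines "M \<equiv> start_mem (encode_input n \<gamma>s Z W)"
  assumes ZW: "Z \<subseteq> {1..n}" "W \<subseteq> {1..n}"
  shows "M 0 = n" "M 1 = length \<gamma>s" "zeros n M = Z" "ones n M = W"
    and "\<And>v. v \<in> {1..n} \<Longrightarrow> M (1 + v) \<le> 1 \<and> M (1 + n + v) \<le> 1"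
    and "\<And>a. 2 + 2 * n + 2 * n * length \<gamma>s \<le> a \<Longrightarrow> M a = 0"
    and "\<And>k j. k < length \<gamma>s \<Longrightarrow> j < n \<Longrightarrow> M (2 + 3 * n + 2 * n * k + j) = preimage (\<gamma>s ! k) j"
proof -
  define C where "C = concat (map (perm_arrays n) \<gamma>s)"
  define H where "H = [n, length \<gamma>s] @ indicator_array n Z @ indicator_array n W"
  have lp: "length xs = 2 * n" if "xs \<in> set (map (perm_arrays n) \<gamma>s)" for xs
    using that by (auto simp: perm_arrays_def)
  have "length C = 2 * n * length (map (perm_arrays n) \<gamma>s)" unfolding C_def by (rule length_concat_uniform[OF lp])
  then have lC: "length C = 2 * n * length \<gamma>s" by simp
  have lH: "length H = 2 + 2 * n" by (simp add: H_def indicator_array_def)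
  have enc: "encode_input n \<gamma>s Z W = H @ C" by (simp add: encode_input_def C_def H_def)
  have lE: "length (encode_input n \<gamma>s Z W) = 2 + 2 * n + 2 * n * length \<gamma>s" unfolding enc by (simp only: length_append lC lH)
  have head: "M a = H ! a" if "a < 2 + 2 * n" for a
    using that lH unfolding M_def start_mem_def lE enc by (simp add: nth_append)
  have ind: "indicator_array n X ! i = of_bool (Suc i \<in> X)" "length (indicator_array n X) = n" if "i < n" for X i
    using that by (simp_all add: indicator_array_def del: upt_Suc)
  have fZ: "M (1 + v) = of_bool (v \<in> Z)" if "v \<in> {1..n}" for v
  proof -
    obtain i where "v = Suc i" "i < n" using \<open>v \<in> {1..n}\<close> by (cases v) auto
    then show ?thesis using head[of "1 + v"] ind[of i] by (simp add: H_def nth_append)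
  qed
  have fW: "M (1 + n + v) = of_bool (v \<in> W)" if "v \<in> {1..n}" for v
  proof -
    obtain i where "v = Suc i" "i < n" using \<open>v \<in> {1..n}\<close> by (cases v) auto
    then show ?thesis using head[of "1 + n + v"] ind[of i] by (simp add: H_def nth_append)
  qed
  show "M 0 = n" "M 1 = length \<gamma>s" using head[of 0] head[of 1] by (simp_all add: H_def)
  show "zeros n M = Z" "ones n M = W" using fZ fW ZW unfolding zeros_def ones_def by auto
  show "M (1 + v) \<le> 1 \<and> M (1 + n + v) \<le> 1" if "v \<in> {1..n}" for v using fZ[OF that] fW[OF that] by simp
  show "M a = 0" if "2 + 2 * n + 2 * n * length \<gamma>s \<le> a" for a
    using that unfolding M_def start_mem_def lE by simp
  show "M (2 + 3 * n + 2 * n * k + j) = preimage (\<gamma>s ! k) j" if "k < length \<gamma>s" "j < n" for k j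
  proof -
    have "2 * n * Suc k \<le> 2 * n * length \<gamma>s" using that(1) by (intro mult_le_mono2) simp
    then have "M (2 + 2 * n + (2 * n * k + (n + j))) = C ! (2 * n * k + (n + j))"
      using that(2) lH lC unfolding M_def start_mem_def lE enc by (simp add: nth_append ac_simps)
    also have "\<dots> = perm_arrays n (\<gamma>s ! k) ! (n + j)"
      unfolding C_def using nth_concat_uniform[of "map (perm_arrays n) \<gamma>s" "2 * n" k "n + j", OF lp] that by simp
    also have "\<dots> = preimage (\<gamma>s ! k) j"
      using that(2) by (simp add: perm_arrays_def nth_append del: upt_Suc)
    finally show ?thesis by (simp add: algebra_simps)
  qed
qed

theorem mainTheorem1:
  shows "\<exists>(P :: ram_program) (c :: nat).
    \<forall>(n :: nat) (\<Gamma> :: (nat \<Rightarrow> nat) set) (\<gamma>s :: (nat \<Rightarrow> nat) list) (I0 :: nat set) (I1 :: nat set).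
      1 \<le> n \<and> (\<forall>\<gamma>\<in>\<Gamma>. \<gamma> permutes {1..n}) \<and> distinct \<gamma>s \<and> set \<gamma>s = \<Gamma> \<and>
      I0 \<subseteq> {1..n} \<and> I1 \<subseteq> {1..n} \<and> I0 \<inter> I1 = {}
      \<longrightarrow>
      (\<exists>s. halts_within P (encode_input n \<gamma>s I0 I1) (c * max 1 (n * card \<Gamma>)) s \<and>
        (case decode_output n s of
           Infeasible \<Rightarrow> X_set n \<Gamma> \<inter> face n I0 I1 = {}
         | Feasible J0 J1 \<Rightarrow>
             I0 \<subseteq> J0 \<and> I1 \<subseteq> J1 \<and> J0 \<subseteq> {1..n} \<and> J1 \<subseteq> {1..n} \<and> J0 \<inter> J1 = {} \<and>
             (fixing_step n \<Gamma>)\<^sup>*\<^sup>* (I0, I1) (J0, J1) \<and>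
             (\<forall>\<gamma>\<in>\<Gamma>. X_perm n \<gamma> \<inter> face n J0 J1 \<noteq> {}) \<and>
             (\<forall>\<gamma>\<in>\<Gamma>. complete_fixings n \<gamma> J0 J1) \<and>
             X_set n \<Gamma> \<inter> face n J0 J1 = X_set n \<Gamma> \<inter> face n I0 I1))"
proof (rule exI[of _ "program propagation_code"], rule exI[of _ 4000], intro allI impI, elim conjE)
  fix n :: nat and \<Gamma> :: "(nat \<Rightarrow> nat) set" and \<gamma>s :: "(nat \<Rightarrow> nat) list" and I0 I1 :: "nat set"
  assume n: "1 \<le> n" and perms: "\<forall>\<gamma>\<in>\<Gamma>. \<gamma> permutes {1..n}" and dist: "distinct \<gamma>s" and \<Gamma>: "set \<gamma>s = \<Gamma>"
    and I: "I0 \<subseteq> {1..n}" "I1 \<subseteq> {1..n}" "I0 \<inter> I1 = {}"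
  interpret symmetries n \<gamma>s "(I0, I1)" using n perms \<Gamma> by unfold_locales auto
  define xs where "xs = encode_input n \<gamma>s I0 I1"
  define T where "T = 4000 * max 1 (n * card \<Gamma>)"
  have T: "T = 4000 * max 1 (n * m)" unfolding T_def \<Gamma>[symmetric] by (simp add: distinct_card[OF dist])
  note enc = start_mem_encode[OF I(1,2), where \<gamma>s = \<gamma>s, folded xs_def]
  have "wp (infeasible n (set \<gamma>s) (I0, I1) T) propagation_code ((\<lambda>_. 0), start_mem xs) 0
      (propagated n (set \<gamma>s) (I0, I1) E T)"
    using enc I(3) by (intro wp_propagation T) (simp_all add: E_def D_def g_def)
  then obtain t h r M where ex: "exec propagation_code ((\<lambda>_. 0), start_mem xs) t h (r, M)"
    and abt: "h \<Longrightarrow> infeasible n \<Gamma> (I0, I1) T (r, M) t" and fin: "\<not> h \<Longrightarrow> propagated n \<Gamma> (I0, I1) E T (r, M) t"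
    unfolding wp_def \<Gamma> split_paired_Ex add_0 by blast
  have "start_mem xs = (\<lambda>a. if a < length xs then xs ! a else 0)" by (simp add: start_mem_def fun_eq_iff)
  with ex obtain s where s: "halts_within (program propagation_code) xs t s" "regs s = r" "mem s = M"
    using program_correct[OF _ jump_free_propagation_code] by metis
  have t: "t \<le> T" using abt fin by (cases h) (auto simp: infeasible_def propagated_def)
  obtain k where "k \<le> t" "s = (ram_step (program propagation_code) ^^ k) (initial_config xs)"
      "halted (program propagation_code) s"
    using s(1) unfolding halts_within_def by blast
  with t have halt: "halts_within (program propagation_code) xs T s"
    unfolding halts_within_def by (intro exI[of _ k]) simp
  have "case decode_output n s of
       Infeasible \<Rightarrow> X_set n \<Gamma> \<inter> face n I0 I1 = {}
     | Feasible J0 J1 \<Rightarrow>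
         I0 \<subseteq> J0 \<and> I1 \<subseteq> J1 \<and> J0 \<subseteq> {1..n} \<and> J1 \<subseteq> {1..n} \<and> J0 \<inter> J1 = {} \<and>
         (fixing_step n \<Gamma>)\<^sup>*\<^sup>* (I0, I1) (J0, J1) \<and>
         (\<forall>\<gamma>\<in>\<Gamma>. X_perm n \<gamma> \<inter> face n J0 J1 \<noteq> {}) \<and>
         (\<forall>\<gamma>\<in>\<Gamma>. complete_fixings n \<gamma> J0 J1) \<and>
         X_set n \<Gamma> \<inter> face n J0 J1 = X_set n \<Gamma> \<inter> face n I0 I1"
    (is "case _ of Infeasible \<Rightarrow> ?inf | Feasible J0 J1 \<Rightarrow> ?feas J0 J1")
  proof (cases h)
    case True
    then show ?thesis using abt s(2) by (simp add: decode_output_def infeasible_def)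
  next
    case False
    then obtain \<tau> where G: "fixed_state n \<Gamma> (I0, I1) E \<tau> M" and r: "r 0 = 1"
      and C: "\<forall>\<gamma>\<in>\<Gamma>. X_perm n \<gamma> \<inter> face n (zeros n M) (ones n M) \<noteq> {} \<and>
        complete_fixings n \<gamma> (zeros n M) (ones n M)"
      using fin by (auto simp: propagated_def)
    \<comment> \<open>The output format tests flags for \<open>1\<close>, the sets read from memory
      test them for nonzero; both agree as flags never exceed \<open>1\<close>.\<close>
    have flag: "M (1 + v) = 1 \<longleftrightarrow> M (1 + v) \<noteq> 0" "M (1 + n + v) = 1 \<longleftrightarrow> M (1 + n + v) \<noteq> 0"
      if "v \<in> {1..n}" for v
      using G that unfolding fixed_state_def by (metis le_antisym less_one not_le one_neq_zero)+
    have "{v \<in> {1..n}. M (1 + v) = 1} = zeros n M" "{v \<in> {1..n}. M (1 + n + v) = 1} = ones n M"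
      unfolding zeros_def ones_def using flag by blast+
    then have dec: "decode_output n s = Feasible (zeros n M) (ones n M)"
      using r s(2,3) by (simp add: decode_output_def)
    have steps: "(fixing_step n \<Gamma>)\<^sup>*\<^sup>* (I0, I1) (zeros n M, ones n M)" and disj: "zeros n M \<inter> ones n M = {}"
      using G unfolding fixed_state_def by blast+
    show ?thesis
      unfolding dec using fixing_step_X_set[OF steps] steps disj zeros_ones_subset[of n M] C by simp
  qed
  with halt show "\<exists>s. halts_within (program propagation_code) (encode_input n \<gamma>s I0 I1)
      (4000 * max 1 (n * card \<Gamma>)) s \<and>
    (case decode_output n s of Infeasible \<Rightarrow> ?inf | Feasible J0 J1 \<Rightarrow> ?feas J0 J1)"
    unfolding xs_def T_def by blast
qed

end
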